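(* For each integer $n \ge 5$ let $r_n = \operatorname{acosh}\!\left(1 + 2\cos\left(\frac{2\pi}{n}\right)\right)$, which is the side length of the (unique up to isometry) regular $n$-gon with interior right angles in the hyperbolic plane $\mathbb{H}^2$; one has $r_5 < r_6 < \cdots$. Let $r_\infty = \lim_{n\to+\infty} r_n = \operatorname{acosh}(3)$. For $r > 0$ let $G_r$ be the subgroup of $\mathrm{Isom}^+(\mathbb{H}^2)$ generated by $R$ and $A_r$. Then $G_r$ is discrete if and only if $r \in \{r_n : n \ge 5\} \cup [r_\infty, +\infty)$. For all other values of $r > 0$ the group $G_r$ is dense in $\mathrm{Isom}^+(\mathbb{H}^2)$.
   Context: $\mathbb{H}^2$ is the hyperbolic plane (curvature $-1$) with a fixed orientation, and $\mathrm{Isom}^+(\mathbb{H}^2)\cong \mathrm{PSL}_2(\mathbb{R})$ is its group of orientation preserving isometries with its usual topology (pointwise convergence). Fix a point $x_0 \in \mathbb{H}^2$ and a unit tangent vector $v \in T_{x_0}\mathbb{H}^2$. $R$ is the clockwise rotation by a right angle ($\pi/2$) fixing $x_0$. For $r>0$, $A_r$ is the hyperbolic translation of distance $r$ along the geodesic with initial condition $v$, in the direction of $v$. Here $\operatorname{acosh}(x) = \log(x + \sqrt{x^2-1})$. A subgroup is discrete if it is discrete as a subset of $\mathrm{Isom}^+(\mathbb{H}^2)$. *)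

theory Defs
  imports "HOL-Analysis.Analysis" "HOL-Algebra.Generated_Groups"
begin

section \<open>The hyperbolic plane (upper half-plane model)\<close>

typedef hplane = "{z :: complex. Im z > 0}"
  morphisms coord hpoint
  by (rule exI[of _ \<i>]) simp

lemma Im_coord_pos [simp]: "Im (coord p) > 0"
  using coord[of p] by simp

definition cosh_hdist :: "complex \<Rightarrow> complex \<Rightarrow> real" where
  "cosh_hdist z w = 1 + (cmod (z - w))\<^sup>2 / (2 * Im z * Im w)"

lemma cosh_hdist_ge_1: "Im z > 0 \<Longrightarrow> Im w > 0 \<Longrightarrow> cosh_hdist z w \<ge> 1"
  by (simp add: cosh_hdist_def)

lemma cosh_hdist_gram:
  assumes "Im u > 0" "Im v > 0" "Im w > 0"
  defines "A \<equiv> cosh_hdist u v" and "B \<equiv> cosh_hdist v w" and "C \<equiv> cosh_hdist u w"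
  shows "A\<^sup>2 + B\<^sup>2 + C\<^sup>2 \<le> 1 + 2 * A * B * C"
proof -
  obtain a x b y c z where abc: "u = Complex a x" "v = Complex b y" "w = Complex c z"
    by (metis complex.exhaust)
  have pos: "x > 0" "y > 0" "z > 0"
    using assms abc by auto
  define D where "D = (b - a) * ((c\<^sup>2 + z\<^sup>2) - (a\<^sup>2 + x\<^sup>2)) - (c - a) * ((b\<^sup>2 + y\<^sup>2) - (a\<^sup>2 + x\<^sup>2))"
  define K L M where "K = (a - b)\<^sup>2 + x\<^sup>2 + y\<^sup>2" and "L = (b - c)\<^sup>2 + y\<^sup>2 + z\<^sup>2"
    and "M = (a - c)\<^sup>2 + x\<^sup>2 + z\<^sup>2"
  have A: "A = K / (2 * x * y)" and B: "B = L / (2 * y * z)" and C: "C = M / (2 * x * z)"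
    using pos unfolding A_def B_def C_def cosh_hdist_def abc cmod_power2 K_def L_def M_def
    by (simp_all add: divide_simps) (simp_all add: power2_eq_square algebra_simps)
  have "4 * x\<^sup>2 * y\<^sup>2 * z\<^sup>2 + K * L * M - z\<^sup>2 * K\<^sup>2 - x\<^sup>2 * L\<^sup>2 - y\<^sup>2 * M\<^sup>2 = D\<^sup>2"
    unfolding K_def L_def M_def D_def by algebra
  moreover have "1 + 2 * A * B * C - A\<^sup>2 - B\<^sup>2 - C\<^sup>2 =
      (4 * x\<^sup>2 * y\<^sup>2 * z\<^sup>2 + K * L * M - z\<^sup>2 * K\<^sup>2 - x\<^sup>2 * L\<^sup>2 - y\<^sup>2 * M\<^sup>2) / (4 * x\<^sup>2 * y\<^sup>2 * z\<^sup>2)"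
    unfolding A B C using pos by (simp add: power2_eq_square add_divide_distrib diff_divide_distrib mult_ac)
  ultimately have "1 + 2 * A * B * C - A\<^sup>2 - B\<^sup>2 - C\<^sup>2 = D\<^sup>2 / (4 * x\<^sup>2 * y\<^sup>2 * z\<^sup>2)"
    by simp
  also have "\<dots> \<ge> 0"
    by simp
  finally show ?thesis by simp
qed

instantiation hplane :: metric_space
begin

definition dist_hplane :: "hplane \<Rightarrow> hplane \<Rightarrow> real" where
  "dist_hplane p q = arcosh (cosh_hdist (coord p) (coord q))"

definition uniformity_hplane :: "(hplane \<times> hplane) filter" where
  "uniformity_hplane = (INF e\<in>{0<..}. principal {(p, q). dist p q < e})"

definition open_hplane :: "hplane set \<Rightarrow> bool" where
  "open_hplane U \<longleftrightarrow> (\<forall>p\<in>U. eventually (\<lambda>(p', q). p' = p \<longrightarrow> q \<in> U) uniformity)"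

instance proof
  fix p q r :: hplane
  show "dist p q = 0 \<longleftrightarrow> p = q"
    by (simp add: dist_hplane_def cosh_hdist_ge_1 less_imp_neq[symmetric])
       (simp add: cosh_hdist_def coord_inject less_imp_neq[symmetric])
  have comm: "dist r q = dist q r"
    by (simp add: dist_hplane_def cosh_hdist_def norm_minus_commute mult.commute mult.left_commute)
  define A where "A = cosh_hdist (coord p) (coord r)"
  define B where "B = cosh_hdist (coord r) (coord q)"
  define C where "C = cosh_hdist (coord p) (coord q)"
  have ge: "A \<ge> 1" "B \<ge> 1" "C \<ge> 1"
    by (simp_all add: A_def B_def C_def cosh_hdist_ge_1)
  have "A\<^sup>2 + B\<^sup>2 + C\<^sup>2 \<le> 1 + 2 * A * B * C"
    unfolding A_def B_def C_def by (rule cosh_hdist_gram) simp_all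
  then have "(C - A * B)\<^sup>2 \<le> (A\<^sup>2 - 1) * (B\<^sup>2 - 1)"
    by (simp add: power2_eq_square algebra_simps)
  then have "C - A * B \<le> sqrt ((A\<^sup>2 - 1) * (B\<^sup>2 - 1))"
    by (rule real_le_rsqrt)
  then have "C \<le> cosh (arcosh A + arcosh B)"
    using ge by (simp add: cosh_add sinh_arcosh_real real_sqrt_mult)
  then have "arcosh C \<le> arcosh (cosh (arcosh A + arcosh B))"
    using ge by (metis arcosh_real_strict_mono dual_order.order_iff_strict)
  then have "arcosh C \<le> arcosh A + arcosh B"
    using ge by (simp add: arcosh_cosh_real)
  then show "dist p q \<le> dist p r + dist q r"
    using comm by (simp add: dist_hplane_def A_def B_def C_def)
qed (simp_all only: uniformity_hplane_def open_hplane_def)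

end


section \<open>Orientation preserving isometries\<close>

definition hisometry :: "(hplane \<Rightarrow> hplane) \<Rightarrow> bool" where
  "hisometry f \<longleftrightarrow> bij f \<and> (\<forall>p q. dist (f p) (f q) = dist p q)"

text \<open>The half-plane is open, so the values of \<open>hpoint\<close> outside of it do not
  influence the derivative.\<close>

definition has_hderivative :: "(hplane \<Rightarrow> hplane) \<Rightarrow> (complex \<Rightarrow> complex) \<Rightarrow> hplane \<Rightarrow> bool" where
  "has_hderivative f D p \<longleftrightarrow> ((\<lambda>z. coord (f (hpoint z))) has_derivative D) (at (coord p))"

text \<open>\<open>Im (cnj u * w)\<close> is the determinant of the real vectors \<open>u\<close>, \<open>w\<close>;
  it is positive iff \<open>(u, w)\<close> is a positively oriented basis. Thus
  \<open>Im (cnj (D 1) * D \<i>)\<close> is the determinant of the real-linear map \<open>D\<close>.\<close>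

definition orientation_preserving :: "(hplane \<Rightarrow> hplane) \<Rightarrow> bool" where
  "orientation_preserving f \<longleftrightarrow>
     (\<forall>p. \<exists>D. has_hderivative f D p \<and> Im (cnj (D 1) * D \<i>) > 0)"

text \<open>The type \<open>hplane \<Rightarrow> hplane\<close> carries the product topology, that is, the topology
  of pointwise convergence.\<close>

definition Isom_plus :: "(hplane \<Rightarrow> hplane) monoid" where
  "Isom_plus = \<lparr>carrier = {f. hisometry f \<and> orientation_preserving f},
                monoid.mult = (\<lambda>f g. f \<circ> g), one = id\<rparr>"

lemma open_coord_domain: "open {z :: complex. Im z > 0}"
  by (simp add: open_halfspace_Im_gt)

lemma has_hderivative_id: "has_hderivative id (\<lambda>u. u) p"
  unfolding has_hderivative_def
  by (rule has_derivative_transform_within_open[OF has_derivative_ident open_coord_domain])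
     (auto simp: hpoint_inverse)

lemma has_hderivative_comp:
  assumes "has_hderivative g E p" "has_hderivative f D (g p)"
  shows "has_hderivative (f \<circ> g) (D \<circ> E) p"
  using diff_chain_at[of "\<lambda>z. coord (g (hpoint z))" E "coord p" "\<lambda>z. coord (f (hpoint z))" D] assms
  by (simp add: has_hderivative_def coord_inverse o_def)

lemma has_hderivative_linear: "has_hderivative f D p \<Longrightarrow> linear D"
  unfolding has_hderivative_def using has_derivative_linear by blast

lemma det_linear:
  assumes "linear D"
  shows "Im (cnj (D u) * D w) = Im (cnj (D 1) * D \<i>) * Im (cnj u * w)"
proof -
  have *: "D z = Re z *\<^sub>R D 1 + Im z *\<^sub>R D \<i>" for z
  proof -
    have "D z = D (Re z *\<^sub>R 1 + Im z *\<^sub>R \<i>)"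
      by (rule arg_cong) (simp add: complex_eq_iff)
    then show ?thesis
      by (simp only: linear_add[OF assms] linear_scale[OF assms])
  qed
  show ?thesis
    by (subst (1 2) *) (simp add: algebra_simps)
qed

lemma orientation_preserving_comp:
  assumes "orientation_preserving f" "orientation_preserving g"
  shows "orientation_preserving (f \<circ> g)"
  unfolding orientation_preserving_def
proof
  fix p
  obtain E where E: "has_hderivative g E p" "Im (cnj (E 1) * E \<i>) > 0"
    using assms(2) unfolding orientation_preserving_def by blast
  obtain D where D: "has_hderivative f D (g p)" "Im (cnj (D 1) * D \<i>) > 0"
    using assms(1) unfolding orientation_preserving_def by blast
  have "Im (cnj ((D \<circ> E) 1) * (D \<circ> E) \<i>) > 0"
    using det_linear[OF has_hderivative_linear[OF D(1)], of "E 1" "E \<i>"] E(2) D(2)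
    by (simp only: o_apply zero_less_mult_iff) simp
  then show "\<exists>D. has_hderivative (f \<circ> g) D p \<and> Im (cnj (D 1) * D \<i>) > 0"
    using has_hderivative_comp[OF E(1) D(1)] by blast
qed

lemma orientation_preserving_inv:
  assumes f: "orientation_preserving f" and bij: "bij f"
  shows "orientation_preserving (inv_into UNIV f)"
  unfolding orientation_preserving_def
proof
  fix q
  define p where "p = inv_into UNIV f q"
  have fp: "f p = q"
    using bij by (simp add: p_def bij_is_surj surj_f_inv_f)
  obtain D where D: "has_hderivative f D p" "Im (cnj (D 1) * D \<i>) > 0"
    using f unfolding orientation_preserving_def by blast
  have lin: "linear D"
    using D(1) by (rule has_hderivative_linear)
  have "inj D"
  proof (subst linear_injective_0[OF lin], intro allI impI)
    fix u assume "D u = 0"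
    then have "Im (cnj u * w) = 0" for w
      using det_linear[OF lin, of u w] D(2) by simp
    from this[of 1] this[of \<i>] show "u = 0"
      by (simp add: complex_eq_iff)
  qed
  then obtain E where E: "linear E" "D \<circ> E = id"
    using linear_injective_imp_surjective[OF lin] linear_surjective_right_inverse[OF lin] by blast
  let ?f = "\<lambda>z. coord (f (hpoint z))" and ?g = "\<lambda>z. coord (inv_into UNIV f (hpoint z))"
  have "continuous_on {z. Im z > 0} ?f"
  proof (intro continuous_at_imp_continuous_on ballI)
    fix z :: complex assume "z \<in> {z. Im z > 0}"
    then have "coord (hpoint z) = z"
      by (simp add: hpoint_inverse)
    then show "isCont ?f z"
      using f has_derivative_continuous
      unfolding orientation_preserving_def has_hderivative_def by metis
  qed
  moreover have "?g (?f z) = z" if "z \<in> {z. Im z > 0}" for z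
    using that bij by (simp add: coord_inverse hpoint_inverse bij_is_inj inv_f_f)
  moreover have "coord p \<in> {z. Im z > 0}"
    by simp
  ultimately have "(?g has_derivative E) (at (?f (coord p)))"
    using has_derivative_inverse_strong[OF open_coord_domain, of "coord p" ?f ?g D E] D(1) E(2)
    unfolding has_hderivative_def by blast
  then have g: "has_hderivative (inv_into UNIV f) E q"
    by (simp add: has_hderivative_def coord_inverse fp)
  have "Im (cnj (D 1) * D \<i>) * Im (cnj (E 1) * E \<i>) = 1"
    using det_linear[OF lin, of "E 1" "E \<i>"] E(2) by (simp add: fun_eq_iff)
  then have "Im (cnj (E 1) * E \<i>) > 0"
    using D(2) by (metis zero_less_mult_pos zero_less_one)
  with g show "\<exists>E. has_hderivative (inv_into UNIV f) E q \<and> Im (cnj (E 1) * E \<i>) > 0"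
    by blast
qed

lemma group_Isom_plus: "group Isom_plus"
proof (rule groupI)
  show "x \<otimes>\<^bsub>Isom_plus\<^esub> y \<in> carrier Isom_plus"
    if "x \<in> carrier Isom_plus" "y \<in> carrier Isom_plus" for x y
    using that by (auto simp: Isom_plus_def hisometry_def bij_comp orientation_preserving_comp)
  show "\<one>\<^bsub>Isom_plus\<^esub> \<in> carrier Isom_plus"
    by (auto simp: Isom_plus_def hisometry_def orientation_preserving_def
        intro!: exI[of _ "\<lambda>u. u"] has_hderivative_id)
  show "\<exists>y\<in>carrier Isom_plus. y \<otimes>\<^bsub>Isom_plus\<^esub> x = \<one>\<^bsub>Isom_plus\<^esub>"
    if x: "x \<in> carrier Isom_plus" for x
  proof
    have bij: "bij x" and iso: "\<And>p q. dist (x p) (x q) = dist p q"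
      using x by (auto simp: Isom_plus_def hisometry_def)
    have "dist (inv_into UNIV x p) (inv_into UNIV x q) = dist p q" for p q
      using iso[of "inv_into UNIV x p" "inv_into UNIV x q"] bij by (simp add: bij_is_surj surj_f_inv_f)
    then show "inv_into UNIV x \<in> carrier Isom_plus"
      using x bij by (simp add: Isom_plus_def hisometry_def bij_imp_bij_inv orientation_preserving_inv)
    show "inv_into UNIV x \<otimes>\<^bsub>Isom_plus\<^esub> x = \<one>\<^bsub>Isom_plus\<^esub>"
      using bij by (simp add: Isom_plus_def bij_is_inj)
  qed
qed (auto simp: Isom_plus_def o_assoc)


section \<open>Geodesics, rotations and translations\<close>

definition geodesic_line :: "(real \<Rightarrow> hplane) \<Rightarrow> bool" where
  "geodesic_line \<gamma> \<longleftrightarrow> (\<forall>s t. dist (\<gamma> s) (\<gamma> t) = \<bar>s - t\<bar>)"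

definition geodesic_from :: "hplane \<Rightarrow> complex \<Rightarrow> (real \<Rightarrow> hplane) \<Rightarrow> bool" where
  "geodesic_from p u \<gamma> \<longleftrightarrow>
     geodesic_line \<gamma> \<and> \<gamma> 0 = p \<and> ((\<lambda>t. coord (\<gamma> t)) has_vector_derivative u) (at 0)"

text \<open>Tangent vectors at \<open>p\<close> are complex numbers; the Riemannian metric at \<open>p\<close> is the Euclidean
  one divided by \<open>(Im (coord p))\<^sup>2\<close>.\<close>

definition unit_tangent :: "hplane \<Rightarrow> complex \<Rightarrow> bool" where
  "unit_tangent p u \<longleftrightarrow> cmod u / Im (coord p) = 1"

definition clockwise_quarter_turn :: "hplane \<Rightarrow> (hplane \<Rightarrow> hplane)" where
  "clockwise_quarter_turn p =
     (THE f. f \<in> carrier Isom_plus \<and> f p = p \<and> has_hderivative f (\<lambda>u. - \<i> * u) p)"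

definition translation :: "hplane \<Rightarrow> complex \<Rightarrow> real \<Rightarrow> (hplane \<Rightarrow> hplane)" where
  "translation p u r =
     (THE f. f \<in> carrier Isom_plus \<and> (\<exists>\<gamma>. geodesic_from p u \<gamma> \<and> (\<forall>t. f (\<gamma> t) = \<gamma> (t + r))))"

definition G :: "hplane \<Rightarrow> complex \<Rightarrow> real \<Rightarrow> (hplane \<Rightarrow> hplane) set" where
  "G x\<^sub>0 v r = generate Isom_plus {clockwise_quarter_turn x\<^sub>0, translation x\<^sub>0 v r}"


section \<open>Regular polygons\<close>

definition direction :: "hplane \<Rightarrow> hplane \<Rightarrow> complex" where
  "direction p q = (THE u. \<exists>\<gamma>. geodesic_from p u \<gamma> \<and> \<gamma> (dist p q) = q)"

text \<open>The model is conformal, so hyperbolic angles are the Euclidean angles between tangent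
  vectors.\<close>

definition hangle :: "hplane \<Rightarrow> hplane \<Rightarrow> hplane \<Rightarrow> real" where
  "hangle q p r =
     arccos (inner (direction p q) (direction p r) / (cmod (direction p q) * cmod (direction p r)))"

definition strictly_left_of :: "hplane \<Rightarrow> hplane \<Rightarrow> hplane \<Rightarrow> bool" where
  "strictly_left_of p q x \<longleftrightarrow> x \<noteq> p \<and> Im (cnj (direction p q) * direction p x) > 0"

text \<open>The vertices \<open>P 0, \<dots>, P (n - 1)\<close> of a strictly convex polygon, listed
  counterclockwise: the remaining vertices lie to the left of each oriented side.\<close>

definition convex_polygon :: "nat \<Rightarrow> (nat \<Rightarrow> hplane) \<Rightarrow> bool" where
  "convex_polygon n P \<longleftrightarrow> n \<ge> 3 \<and> inj_on P {..<n} \<and>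
     (\<forall>i<n. \<forall>j<n. j \<noteq> i \<and> j \<noteq> Suc i mod n \<longrightarrow>
        strictly_left_of (P i) (P (Suc i mod n)) (P j))"

definition regular_polygon :: "nat \<Rightarrow> real \<Rightarrow> real \<Rightarrow> (nat \<Rightarrow> hplane) \<Rightarrow> bool" where
  "regular_polygon n s \<alpha> P \<longleftrightarrow> convex_polygon n P \<and>
     (\<forall>i<n. dist (P i) (P (Suc i mod n)) = s) \<and>
     (\<forall>i<n. hangle (P ((i + n - 1) mod n)) (P i) (P (Suc i mod n)) = \<alpha>)"


section \<open>The exceptional lengths\<close>

definition r_seq :: "nat \<Rightarrow> real" where
  "r_seq n = arcosh (1 + 2 * cos (2 * pi / real n))"

definition r_inf :: real where
  "r_inf = arcosh 3"

end

theory Submission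
  imports Defs
begin

text \<open>
  Place \<open>x\<^sub>0\<close> at \<open>\<i>\<close> with \<open>v\<close> pointing up. With \<open>c = cosh (r/2) / sqrt 2\<close>, the composition of \<open>R\<close> and
  \<open>A\<^sub>r\<close> has trace \<open>2 c\<close>, and \<open>c = cos (pi / n)\<close> iff \<open>r = r_seq n\<close>, while \<open>c \<ge> 1\<close> iff \<open>r \<ge> r_inf\<close>.

  Discreteness: \<open>R\<close> and \<open>A\<^sub>r\<close> are products of the reflections in three lines meeting at the angles \<open>pi/4\<close>,
  \<open>pi/2\<close> and \<open>pi/n\<close> (the last pair being disjoint if \<open>c \<ge> 1\<close>). Tits' argument for Coxeter groups
  shows that no nontrivial element of the reflection group maps a point of the open triangle into
  the triangle.

  Density: otherwise \<open>c = cos \<theta>\<close> with \<open>0 < \<theta> < pi/4\<close> and \<open>\<theta>\<close> not of the form \<open>pi/n\<close>. Then \<open>R A\<^sub>r\<close> is a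
  rotation by \<open>2 \<theta>\<close>, and some power of it has an angle so small that together with the half turn
  \<open>R\<^sup>2 A\<^sub>r\<close> it violates Joergensen's inequality. The iteration \<open>B \<mapsto> B T B\<^sup>-\<^sup>1\<close> from the proof of that inequality
  therefore yields elements tending to the rotation \<open>T\<close>; commutators formed from them are
  infinitesimal rotations about the centre of \<open>T\<close>, so the closure contains all rotations about
  that centre, and hence everything.

  Polygons: the vertices of a right-angled polygon with side \<open>s\<close> form an orbit \<open>M\<^sup>j \<i>\<close> of a matrix \<open>M\<close> of
  trace \<open>2 cosh (s/2) / sqrt 2\<close>. In terms of the Chebyshev coefficients of \<open>M\<^sup>j\<close>, convexity says that the
  first \<open>n - 1\<close> of them are positive, and closing up says that the \<open>n\<close>-th vanishes.
\<close>

section \<open>Reflection groups acting with linear forms\<close>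

text \<open>\<open>cheb c k\<close> is the Chebyshev polynomial of the second kind of degree \<open>k - 1\<close> at \<open>c\<close>.\<close>

fun cheb :: "real \<Rightarrow> nat \<Rightarrow> real" where
  "cheb c 0 = 0"
| "cheb c (Suc 0) = 1"
| "cheb c (Suc (Suc k)) = 2 * c * cheb c (Suc k) - cheb c k"

lemma cheb_cos: "cheb (cos x) k * sin x = sin (real k * x)"
proof (induction "cos x" k rule: cheb.induct)
  case (3 k)
  have "cheb (cos x) (Suc (Suc k)) * sin x
      = 2 * cos x * (cheb (cos x) (Suc k) * sin x) - cheb (cos x) k * sin x"
    by (simp add: algebra_simps)
  also have "\<dots> = 2 * cos x * sin (real (Suc k) * x) - sin (real k * x)"
    using 3 by simp
  also have "\<dots> = 2 * cos x * sin (real k * x + x) - sin (real k * x)"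
    by (simp add: algebra_simps)
  also have "\<dots> = sin (real k * x + x + x)"
    by (simp only: sin_add cos_add)
       (use sin_cos_squared_add[of x] in \<open>simp add: power2_eq_square algebra_simps; algebra\<close>)
  finally show ?case
    by (simp add: algebra_simps)
qed simp_all

text \<open>For \<open>c \<ge> 1\<close> the recursion makes the successive increments
  nondecreasing, and the first increment is 1.\<close>

lemma cheb_increasing:
  assumes "c \<ge> 1"
  shows "cheb c k \<ge> 0 \<and> cheb c (Suc k) \<ge> cheb c k + 1"
proof (induction k)
  case (Suc k)
  have "1 * cheb c (Suc k) \<le> c * cheb c (Suc k)"
    using Suc assms by (intro mult_right_mono) auto
  then show ?case
    using Suc by (simp only: cheb.simps) linarith
qed simp

lemma cheb_pos_of_ge_1: "c \<ge> 1 \<Longrightarrow> k > 0 \<Longrightarrow> cheb c k > 0"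
  using cheb_increasing[of c "k - 1"] by (cases k) auto

text \<open>By \<open>cheb_cos\<close> the sign is that of \<open>sin (k * pi / m)\<close>, whose
  argument lies strictly between 0 and \<open>pi\<close>.\<close>

lemma cheb_pos_of_cos:
  assumes "m \<ge> 2" "0 < k" "k < m"
  shows "cheb (cos (pi / real m)) k > 0"
proof -
  have "0 < pi / real m" "pi / real m < pi"
    using assms by (auto simp: divide_simps)
  then have s: "sin (pi / real m) > 0"
    by (rule sin_gt_zero)
  have "sin (real k * (pi / real m)) > 0"
    using assms by (intro sin_gt_zero) (auto simp: divide_simps)
  then show ?thesis
    using cheb_cos[of "pi / real m" k] s by (metis zero_less_mult_pos2)
qed

text \<open>These values express that a determinant 1 matrix of trace
  \<open>2 * cos (pi / m)\<close> has \<open>m\<close>-th power minus the identity. They yield both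
  the braid relation and the closing up of polygons.\<close>

lemma cheb_at_order:
  assumes "m \<ge> 2"
  shows "cheb (cos (pi / real m)) m = 0" "cheb (cos (pi / real m)) (m - 1) = 1"
    "cheb (cos (pi / real m)) (Suc m) = - 1"
proof -
  have "0 < pi / real m" "pi / real m < pi"
    using assms by (auto simp: divide_simps)
  then have s: "sin (pi / real m) > 0"
    by (rule sin_gt_zero)
  have *: "real (m - 1) * (pi / real m) = pi - pi / real m" "real (Suc m) * (pi / real m) = pi + pi / real m"
    "real m * (pi / real m) = pi"
    using assms by (auto simp: field_simps of_nat_diff)
  show "cheb (cos (pi / real m)) m = 0" "cheb (cos (pi / real m)) (m - 1) = 1"
    "cheb (cos (pi / real m)) (Suc m) = - 1"
    using cheb_cos[of "pi / real m" m] cheb_cos[of "pi / real m" "m - 1"] cheb_cos[of "pi / real m" "Suc m"] s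
    unfolding * by (auto simp: sin_add sin_diff) (metis less_irrefl minus_mult_left mult.left_neutral mult_right_cancel)
qed

text \<open>The reduced words of a dihedral group. The first letter is fixed and the last one
  depends on the parity of \<open>k\<close>, hence the case distinction in
  \<open>form_word_alt\<close>.\<close>

fun alt :: "'i \<Rightarrow> 'i \<Rightarrow> nat \<Rightarrow> 'i list" where
  "alt i j 0 = []"
| "alt i j (Suc k) = i # alt j i k"

lemma set_alt: "set (alt i j k) \<subseteq> {i, j}"
  by (induction i j k rule: alt.induct) auto

lemma length_alt [simp]: "length (alt i j k) = k"
  by (induction i j k rule: alt.induct) auto

section \<open>Abstract reflections and their dihedral subgroups\<close>

text \<open>As usual for Coxeter matrices, but with \<open>m i j = 0\<close> standing for \<open>m i j = \<infinity>\<close>. The abstract points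
  replace the dual of the geometric representation; \<open>form i > 0\<close> is the half-space bounded by the
  mirror of \<open>s i\<close>.\<close>

locale mirrors =
  fixes s :: "'i \<Rightarrow> 'x \<Rightarrow> 'x" and form :: "'i \<Rightarrow> 'x \<Rightarrow> real"
    and c :: "'i \<Rightarrow> 'i \<Rightarrow> real" and m :: "'i \<Rightarrow> 'i \<Rightarrow> nat"
  assumes separates: "(\<And>i. form i x = form i y) \<Longrightarrow> x = y"
    and form_self: "form i (s i x) = - form i x"
    and form_other: "i \<noteq> j \<Longrightarrow> form j (s i x) = form j x + 2 * c i j * form i x"
    and c_sym: "c i j = c j i"
    and gram: "i \<noteq> j \<Longrightarrow> m i j \<ge> 2 \<and> c i j = cos (pi / real (m i j)) \<or> m i j = 0 \<and> c i j \<ge> 1"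
begin

fun word :: "'i list \<Rightarrow> 'x \<Rightarrow> 'x" where
  "word [] x = x"
| "word (i # is) x = s i (word is x)"

lemma word_append: "word (us @ vs) x = word us (word vs x)"
  by (induction us) auto

text \<open>Every form takes the same value on both sides: \<open>form i\<close> changes sign twice,
  and the multiple of \<open>form i x\<close> added to another form is subtracted again.\<close>

lemma s_s [simp]: "s i (s i x) = x"
proof (rule separates)
  fix j
  show "form j (s i (s i x)) = form j x"
    by (cases "i = j") (auto simp: form_self form_other)
qed

text \<open>Removing the first two letters reduces \<open>k\<close> by two and produces exactly the
  recursion of \<open>cheb\<close>. The word starts with the mirror other than \<open>i\<close>, the
  case in which \<open>form i\<close> is expected to stay positive.\<close>

lemma form_word_alt:
  assumes "i \<noteq> j"
  shows "form i (word (alt j i k) y) =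
    (if even k then cheb (c i j) (Suc k) * form i y + cheb (c i j) k * form j y
     else cheb (c i j) k * form i y + cheb (c i j) (Suc k) * form j y)"
  using assms
proof (induction k arbitrary: i j rule: less_induct)
  case (less k)
  note ji = form_other[OF less.prems[symmetric]]
  consider "k = 0" | "k = 1" | l where "k = Suc (Suc l)"
    by (metis One_nat_def not0_implies_Suc)
  then show ?case
  proof cases
    case 3
    let ?w = "word (alt j i l) y"
    have "form i (word (alt j i k) y) = - form i ?w + 2 * c i j * form j (word (alt i j (Suc l)) y)"
      by (simp add: 3 ji form_self c_sym[of j i])
    then have "form i (word (alt j i k) y) =
      - (if even l then cheb (c i j) (Suc l) * form i y + cheb (c i j) l * form j y
         else cheb (c i j) l * form i y + cheb (c i j) (Suc l) * form j y) + 2 * c i j *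
        (if odd l then cheb (c i j) (Suc (Suc l)) * form j y + cheb (c i j) (Suc l) * form i y
         else cheb (c i j) (Suc l) * form j y + cheb (c i j) (Suc (Suc l)) * form i y)"
      using less.IH[of l i j] less.IH[of "Suc l" j i] less.prems c_sym[of j i] 3
      by (simp only: even_Suc) simp
    then show ?thesis
      unfolding 3 by (cases "even l") (simp_all add: algebra_simps del: word.simps alt.simps)
  qed (auto simp: ji c_sym[of j i])
qed

lemma form_word_alt':
  assumes "i \<noteq> j"
  shows "form i (word (alt i j (Suc k)) y) = - form i (word (alt j i k) y)"
  by (simp add: form_self)

lemma cheb_pos:
  assumes "i \<noteq> j" "k > 0" "m i j = 0 \<or> k < m i j"
  shows "cheb (c i j) k > 0"
  using gram[OF assms(1)] assms cheb_pos_of_ge_1 cheb_pos_of_cos by fastforce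

lemma form_word_alt_pos:
  assumes "i \<noteq> j" "m i j = 0 \<or> k < m i j" "form i y > 0" "form j y > 0"
  shows "form i (word (alt j i k) y) > 0"
proof -
  \<comment> \<open>At \<open>k + 1 = m i j\<close> this coefficient vanishes, so only nonnegativity
    holds in general; the other coefficient is positive then.\<close>
  have "cheb (c i j) (Suc k) \<ge> 0"
  proof (cases "k + 1 = m i j")
    case True
    then show ?thesis
      using gram[OF assms(1)] cheb_at_order(1)[of "m i j"] by auto
  next
    case False
    then show ?thesis
      using cheb_pos[of i j "Suc k"] assms by fastforce
  qed
  moreover have "cheb (c i j) k \<ge> 0"
    using cheb_pos[of i j k] assms by (cases "k = 0") auto
  moreover have "cheb (c i j) k > 0 \<or> cheb (c i j) (Suc k) > 0"
    using cheb_pos[of i j k] assms by (cases "k = 0") auto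
  ultimately show ?thesis
    unfolding form_word_alt[OF assms(1)] using assms(3,4)
    by (smt (verit) mult_nonneg_nonneg mult_pos_pos)
qed

text \<open>The component of \<open>form l\<close> orthogonal to \<open>form i\<close> and
  \<open>form j\<close> is fixed by both reflections. It exists because the Gram matrix of the two
  forms is nonsingular.\<close>

lemma orthogonal_invariant:
  assumes "i \<noteq> j" "l \<noteq> i" "l \<noteq> j" "(c i j)\<^sup>2 \<noteq> 1"
  obtains p q where "\<And>x. form l (s i x) + p * form i (s i x) + q * form j (s i x) = form l x + p * form i x + q * form j x"
    "\<And>x. form l (s j x) + p * form i (s j x) + q * form j (s j x) = form l x + p * form i x + q * form j x"
proof
  \<comment> \<open>Cramer's rule for the linear system \<open>pq\<close> below; \<open>d\<close> is
    the Gram determinant.\<close>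
  define d p q where "d = 1 - (c i j)\<^sup>2" and "p = (c i l + c i j * c j l) / d"
    and "q = (c j l + c i j * c i l) / d"
  have d: "d \<noteq> 0"
    using assms by (simp add: d_def)
  have "p - c i j * q = c i l * (1 - (c i j)\<^sup>2) / d" "q - c i j * p = c j l * (1 - (c i j)\<^sup>2) / d"
    using d by (simp_all add: p_def q_def field_simps power2_eq_square)
  then have pq: "c i l - p + c i j * q = 0" "c j l - q + c i j * p = 0"
    using d unfolding d_def[symmetric] by (simp_all add: algebra_simps)
  show "form l (s i x) + p * form i (s i x) + q * form j (s i x) = form l x + p * form i x + q * form j x" for x
  proof -
    have "form l (s i x) + p * form i (s i x) + q * form j (s i x)
      = form l x + p * form i x + q * form j x + 2 * (c i l - p + c i j * q) * form i x"
      using assms form_other[of i l x] form_other[of i j x] by (simp add: form_self algebra_simps)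
    then show ?thesis using pq by simp
  qed
  show "form l (s j x) + p * form i (s j x) + q * form j (s j x) = form l x + p * form i x + q * form j x" for x
  proof -
    have "form l (s j x) + p * form i (s j x) + q * form j (s j x)
      = form l x + p * form i x + q * form j x + 2 * (c j l - q + c i j * p) * form j x"
      using assms form_other[of j l x] form_other[of j i x] c_sym[of j i] by (simp add: form_self algebra_simps)
    then show ?thesis using pq by simp
  qed
qed

lemma invariant_alt:
  assumes "\<And>x. f (s i x) = f x" "\<And>x. f (s j x) = f x"
  shows "f (word (alt i j k) x) = f x \<and> f (word (alt j i k) x) = f x"
  by (induction k) (simp_all add: assms)

text \<open>By the values 1, 0, -1 in \<open>cheb_at_order\<close>, both sides equal the same one of
  \<open>- form i y\<close> and \<open>- form j y\<close>, according to the parity of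
  \<open>k\<close>.\<close>

lemma braid_aux:
  assumes "i \<noteq> j" "k \<ge> 2" "c i j = cos (pi / real k)"
  shows "form i (word (alt i j k) y) = form i (word (alt j i k) y)"
proof -
  obtain n where k: "k = Suc n"
    using assms(2) by (cases k) auto
  show ?thesis
    using cheb_at_order[OF assms(2)] form_word_alt[OF assms(1), of k y] form_word_alt[OF assms(1), of n y]
      form_word_alt'[OF assms(1), of n y]
    unfolding k assms(3)[unfolded k] by (auto simp del: cheb.simps(3) alt.simps)
qed

text \<open>The forms \<open>i\<close> and \<open>j\<close> agree by \<open>braid_aux\<close>. Any
  third form differs from a common invariant of both reflections by a combination of these two, so
  it agrees as well.\<close>

lemma braid:
  assumes "i \<noteq> j" "m i j \<ge> 2"
  shows "word (alt i j (m i j)) = word (alt j i (m i j))"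
proof
  fix y
  let ?k = "m i j"
  have c: "c i j = cos (pi / real ?k)"
    using gram[OF assms(1)] assms(2) by auto
  have ai: "form i (word (alt i j ?k) y) = form i (word (alt j i ?k) y)"
    using braid_aux assms c by blast
  have aj: "form j (word (alt i j ?k) y) = form j (word (alt j i ?k) y)"
    using braid_aux[of j i ?k y] assms c c_sym[of i j] by simp
  have "0 < pi / real ?k" "pi / real ?k < pi"
    using assms by (auto simp: divide_simps)
  then have "(sin (pi / real ?k))\<^sup>2 > 0"
    using sin_gt_zero by (metis zero_less_power)
  then have c2: "(c i j)\<^sup>2 \<noteq> 1"
    unfolding c by (simp add: cos_squared_eq)
  show "word (alt i j ?k) y = word (alt j i ?k) y"
  proof (rule separates)
    fix l
    consider "l = i" | "l = j" | "l \<noteq> i" "l \<noteq> j" by blast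
    then show "form l (word (alt i j ?k) y) = form l (word (alt j i ?k) y)"
    proof cases
      case 3
      obtain p q where
        "\<And>x. form l (s i x) + p * form i (s i x) + q * form j (s i x) = form l x + p * form i x + q * form j x"
        "\<And>x. form l (s j x) + p * form i (s j x) + q * form j (s j x) = form l x + p * form i x + q * form j x"
        using orthogonal_invariant[OF assms(1) 3 c2] by blast
      from invariant_alt[of "\<lambda>x. form l x + p * form i x + q * form j x", OF this]
      show ?thesis
        using ai aj by (metis add_right_cancel)
    qed (use ai aj in auto)
  qed
qed

text \<open>A new letter in front either cancels the first letter of an alternating word or
  lengthens the word; the braid relation prevents lengths beyond \<open>m i j\<close>.\<close>

lemma dihedral_normal_form:
  assumes "i \<noteq> j" "set us \<subseteq> {i, j}"
  shows "\<exists>k\<le>length us. (m i j = 0 \<or> k \<le> m i j) \<and>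
    (word us = word (alt i j k) \<or> word us = word (alt j i k))"
  using assms(2)
proof (induction us)
  case Nil
  then show ?case by (intro exI[of _ 0]) auto
next
  case (Cons a us)
  \<comment> \<open>\<open>b\<close> is the letter other than \<open>a\<close>; the claim is
    symmetric in \<open>i\<close> and \<open>j\<close>, so it may be stated with \<open>a\<close>
    and \<open>b\<close>.\<close>
  define b where "b = (if a = i then j else i)"
  have ab: "{a, b} = {i, j}" "a \<noteq> b"
    using Cons.prems assms(1) by (auto simp: b_def)
  have sym: "word us = word (alt a b k) \<or> word us = word (alt b a k) \<longleftrightarrow>
    word us = word (alt i j k) \<or> word us = word (alt j i k)" for us k
    using ab by (auto simp: doubleton_eq_iff)
  have braid': "word (alt a b (m i j)) = word (alt b a (m i j))" if "m i j \<noteq> 0"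
  proof -
    have "m i j \<ge> 2"
      using gram[OF assms(1)] that by auto
    then show ?thesis
      using ab braid[OF assms(1)] by (auto simp: doubleton_eq_iff)
  qed
  have step: "word (a # us) x = s a (word us x)" for x
    by simp
  have "\<exists>k\<le>length us. (m i j = 0 \<or> k \<le> m i j) \<and> (word us = word (alt a b k) \<or> word us = word (alt b a k))"
    unfolding sym using Cons by simp
  then obtain k where k: "k \<le> length us" "m i j = 0 \<or> k \<le> m i j"
    and w: "word us = word (alt a b k) \<or> word us = word (alt b a k)"
    by blast
  have cancel: ?case if "k > 0" "word us = word (alt a b k)"
  proof -
    obtain l where l: "k = Suc l" using \<open>k > 0\<close> gr0_conv_Suc by blast
    have "word (a # us) = word (alt b a l)"
      by (rule ext) (simp add: that(2) l)
    then have "word (a # us) = word (alt i j l) \<or> word (a # us) = word (alt j i l)"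
      using sym by blast
    moreover have "l \<le> length (a # us)" "m i j = 0 \<or> l \<le> m i j"
      using k l by auto
    ultimately show ?thesis
      by blast
  qed
  show ?case
  proof (cases "k > 0 \<and> word us = word (alt a b k)")
    case True
    then show ?thesis using cancel by blast
  next
    case False
    then have w': "word us = word (alt b a k)"
      using w by auto
    show ?thesis
    proof (cases "m i j = 0 \<or> Suc k \<le> m i j")
      case True
      have "word (a # us) = word (alt a b (Suc k))"
        by (rule ext) (simp add: w')
      then have "word (a # us) = word (alt i j (Suc k)) \<or> word (a # us) = word (alt j i (Suc k))"
        using sym by blast
      moreover have "Suc k \<le> length (a # us)"
        using k by simp
      ultimately show ?thesis
        using True by blast
    next
      \<comment> \<open>Here \<open>k = m i j\<close>, and the braid relation rewrites the word to
        begin with \<open>a\<close>, the cancelling case that is already excluded.\<close>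
      case f: False
      then have "k = m i j" "m i j \<noteq> 0"
        using k by auto
      then show ?thesis
        using braid' w' False by simp
    qed
  qed
qed

text \<open>The dichotomy of \<open>tits\<close> for two mirrors. A normal form beginning with
  \<open>j\<close> keeps \<open>form i\<close> positive; one beginning with \<open>i\<close> makes
  it negative and can be shortened by that letter.\<close>

lemma dihedral:
  assumes "i \<noteq> j" "set us \<subseteq> {i, j}"
  shows "(\<forall>y. form i y > 0 \<and> form j y > 0 \<longrightarrow> form i (word us y) > 0) \<or>
    (\<forall>y. form i y > 0 \<and> form j y > 0 \<longrightarrow> form i (word us y) < 0) \<and>
    (\<exists>vs. set vs \<subseteq> {i, j} \<and> length vs < length us \<and> (\<forall>y. word vs y = s i (word us y)))"
proof -
  obtain k where k: "k \<le> length us" "m i j = 0 \<or> k \<le> m i j"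
    and w: "word us = word (alt i j k) \<or> word us = word (alt j i k)"
    using dihedral_normal_form[OF assms] by blast
  show ?thesis
  proof (cases "(m i j = 0 \<or> k < m i j) \<and> word us = word (alt j i k)")
    case True
    then show ?thesis
      using form_word_alt_pos[OF assms(1), of k] by auto
  next
    case False
    \<comment> \<open>The longest element, with \<open>k = m i j\<close>, has both normal forms; the
      one beginning with \<open>i\<close> is taken.\<close>
    have w': "word us = word (alt i j k)"
    proof (cases "m i j = 0 \<or> k < m i j")
      case False
      then have "k = m i j" "m i j \<ge> 2"
        using k gram[OF assms(1)] by auto
      then show ?thesis
        using w braid[OF assms(1)] by metis
    qed (use False w in auto)
    show ?thesis
    proof (cases k)
      case 0
      then show ?thesis
        using w' by auto
    next
      case (Suc l)
      have "set (alt j i l) \<subseteq> {i, j}"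
        using set_alt[of j i l] by auto
      moreover have "\<forall>y. word (alt j i l) y = s i (word us y)"
        by (simp add: w' Suc)
      moreover have "form i (word us y) < 0" if "form i y > 0" "form j y > 0" for y
        using form_word_alt_pos[OF assms(1), of l y] that k by (auto simp: w' Suc form_self)
      ultimately show ?thesis
        using k Suc by (metis length_alt less_eq_Suc_le)
    qed
  qed
qed

section \<open>Word length and Tits' argument\<close>

definition chamber :: "'x set" where
  "chamber = {x. \<forall>i. form i x > 0}"

text \<open>Meaningful only on \<open>range word\<close>; outside of it \<open>LEAST\<close> ranges
  over an empty condition.\<close>

definition len :: "('x \<Rightarrow> 'x) \<Rightarrow> nat" where
  "len w = (LEAST n. \<exists>us. length us = n \<and> word us = w)"

lemma len_word_le: "len (word us) \<le> length us"
  unfolding len_def by (rule Least_le) blast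

lemma shortest_word:
  assumes "w \<in> range word"
  obtains us where "word us = w" "length us = len w"
proof -
  from assms obtain us where "word us = w" by auto
  then have "\<exists>n us. length us = n \<and> word us = w" by blast
  from LeastI_ex[OF this] show ?thesis
    using that unfolding len_def by blast
qed

lemma len_comp:
  assumes "w \<in> range word"
  shows "word us \<circ> w \<in> range word" "len (word us \<circ> w) \<le> length us + len w"
proof -
  obtain vs where vs: "word vs = w" "length vs = len w"
    using shortest_word[OF assms] by blast
  have "word us \<circ> w = word (us @ vs)"
    by (auto simp: word_append vs(1)[symmetric])
  then show "word us \<circ> w \<in> range word" "len (word us \<circ> w) \<le> length us + len w"
    using len_word_le[of "us @ vs"] vs(2) by auto
qed

lemma word_single: "word [i] = s i"
  by auto

text \<open>Induction on the length. If \<open>w = s j w'\<close> with \<open>j \<noteq> i\<close>, split off from \<open>w'\<close> the longest possible word in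
  \<open>s i\<close> and \<open>s j\<close>; the rest maps the chamber into the positive side of both mirrors, which reduces the
  claim to the dihedral group.\<close>

lemma tits:
  assumes "w \<in> range word"
  shows "(\<forall>x\<in>chamber. form i (w x) > 0) \<or>
    (\<forall>x\<in>chamber. form i (w x) < 0) \<and> len (s i \<circ> w) < len w"
  using assms
proof (induction "len w" arbitrary: w i rule: less_induct)
  case less
  obtain us where us: "word us = w" "length us = len w"
    using shortest_word[OF less.prems] by blast
  show ?case
  proof (cases us)
    case Nil
    then show ?thesis
      using us by (auto simp: chamber_def)
  next
    case (Cons j us')
    define w' where "w' = word us'"
    have w: "w = s j \<circ> w'"
      by (auto simp: us(1)[symmetric] Cons w'_def)
    have w'_range: "w' \<in> range word"
      by (simp add: w'_def)
    have w'_len: "len w' < len w"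
      using us(2) len_word_le[of us'] by (simp add: Cons w'_def)
    have len_w: "len w \<le> Suc (len w')"
      using len_comp(2)[OF w'_range, of "[j]"] by (simp add: word_single w del: word.simps)
    show ?thesis
    proof (cases "i = j")
      \<comment> \<open>\<open>s i\<close> takes \<open>w'\<close> to the longer \<open>w\<close>,
        which rules out the second alternative of the induction hypothesis for
        \<open>w'\<close>.\<close>
      case True
      have "s i \<circ> w = w'"
        by (auto simp: w True)
      moreover have "s i \<circ> w' = w"
        by (auto simp: w True)
      moreover have "\<forall>x\<in>chamber. form i (w' x) > 0"
        using less.hyps[OF w'_len w'_range, of i] w'_len \<open>s i \<circ> w' = w\<close> by auto
      ultimately show ?thesis
        using w'_len by (auto simp: w True form_self)
    next
      case False
      \<comment> \<open>\<open>n\<close> will be the least length of a remaining factor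
        \<open>v\<close> when a word in \<open>i\<close>, \<open>j\<close> is split off from
        \<open>w'\<close> without increasing the total length.\<close>
      define D where "D n \<longleftrightarrow> (\<exists>us v. w' = word us \<circ> v \<and> set us \<subseteq> {i, j} \<and> v \<in> range word \<and>
        length us + len v \<le> len w' \<and> len v = n)" for n
      have "D (len w')"
        unfolding D_def by (intro exI[of _ "[]"] exI[of _ w']) (auto simp: w'_range)
      then obtain n where n: "D n" "\<And>k. k < n \<Longrightarrow> \<not> D k"
        using exists_least_iff[of D] by auto
      then obtain us v where v: "w' = word us \<circ> v" "set us \<subseteq> {i, j}" "v \<in> range word"
        "length us + len v \<le> len w'" "len v = n"
        unfolding D_def by blast
      \<comment> \<open>Otherwise the induction hypothesis for \<open>v\<close> moves a letter
        \<open>k\<close> from \<open>v\<close> into the dihedral word, contradicting the minimality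
        of \<open>n\<close>.\<close>
      have pos: "\<forall>x\<in>chamber. form k (v x) > 0" if k: "k \<in> {i, j}" for k
      proof (rule ccontr)
        assume "\<not> (\<forall>x\<in>chamber. form k (v x) > 0)"
        moreover have "len v < len w"
          using v(4) w'_len by linarith
        ultimately have "len (s k \<circ> v) < len v"
          using less.hyps[OF _ v(3), of k] by blast
        moreover have "w' = word (us @ [k]) \<circ> (s k \<circ> v)"
          by (auto simp: v(1) word_append)
        moreover have "s k \<circ> v \<in> range word"
          using len_comp(1)[OF v(3), of "[k]"] by (simp add: word_single del: word.simps)
        moreover have "set (us @ [k]) \<subseteq> {i, j}" "length (us @ [k]) + len (s k \<circ> v) \<le> len w'"
          using v(2,4) k \<open>len (s k \<circ> v) < len v\<close> by auto
        ultimately have "D (len (s k \<circ> v))" "len (s k \<circ> v) < n"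
          using v(5) unfolding D_def by blast+
        then show False
          using n(2) by blast
      qed
      have w_eq: "w = word (j # us) \<circ> v"
        by (auto simp: w v(1))
      have "set (j # us) \<subseteq> {i, j}"
        using v(2) by auto
      from dihedral[OF False this] show ?thesis
      proof (elim disjE conjE exE)
        assume "\<forall>y. 0 < form i y \<and> 0 < form j y \<longrightarrow> 0 < form i (word (j # us) y)"
        then show ?thesis
          using pos by (auto simp: w_eq)
      next
        fix vs
        assume neg: "\<forall>y. 0 < form i y \<and> 0 < form j y \<longrightarrow> form i (word (j # us) y) < 0"
          and vs: "set vs \<subseteq> {i, j}" "length vs < length (j # us)"
            "\<forall>y. word vs y = s i (word (j # us) y)"
        have "s i \<circ> w = word vs \<circ> v"
          using vs(3) by (auto simp: w_eq)
        then have "len (s i \<circ> w) \<le> length vs + len v"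
          using len_comp(2)[OF v(3)] by simp
        then have "len (s i \<circ> w) < len w"
          using vs(2) v(4) w'_len by simp
        then show ?thesis
          using neg pos by (auto simp: w_eq)
      qed
    qed
  qed
qed

text \<open>Remove the first letter \<open>j\<close> of a shortest word. The rest gets longer under
  \<open>s j\<close>, so by \<open>tits\<close> it keeps \<open>form j\<close> positive on the
  chamber; restoring \<open>s j\<close> makes the form negative.\<close>

theorem chamber_free:
  assumes "w \<in> range word" "x \<in> chamber" "w x \<in> chamber"
  shows "w = id"
proof (rule ccontr)
  assume "w \<noteq> id"
  obtain us where us: "word us = w" "length us = len w"
    using shortest_word[OF assms(1)] by blast
  with \<open>w \<noteq> id\<close> obtain j us' where Cons: "us = j # us'"
    by (cases us) auto
  have "len (s j \<circ> w) \<le> length us'"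
  proof -
    have "s j \<circ> w = word us'"
      by (auto simp: us(1)[symmetric] Cons)
    then show ?thesis
      using len_word_le by simp
  qed
  have "s j \<circ> word us' = w"
    by (auto simp: us(1)[symmetric] Cons)
  moreover have "len (word us') < len w"
    using len_word_le[of us'] us(2) by (simp add: Cons)
  ultimately have "form j (word us' x) > 0"
    using tits[of "word us'" j] assms(2) by auto
  then have "form j (w x) < 0"
    using \<open>s j \<circ> word us' = w\<close> by (auto simp: form_self)
  then show False
    using assms(3) unfolding chamber_def by (metis (mono_tags) mem_Collect_eq less_asym)
qed

end

section \<open>Dense subgroups of SU(1,1)\<close>

text \<open>The pair \<open>(a, b)\<close> stands for the matrix with rows \<open>(a, b)\<close> and \<open>(cnj b, cnj a)\<close>.\<close>

definition pmul :: "complex \<times> complex \<Rightarrow> complex \<times> complex \<Rightarrow> complex \<times> complex" where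
  "pmul x y = (fst x * fst y + snd x * cnj (snd y), fst x * snd y + snd x * cnj (fst y))"

text \<open>The adjugate matrix, which is the inverse on \<open>su11\<close>, where the determinant
  is 1.\<close>

definition pinv :: "complex \<times> complex \<Rightarrow> complex \<times> complex" where
  "pinv x = (cnj (fst x), - snd x)"

definition su11 :: "(complex \<times> complex) set" where
  "su11 = {x. (cmod (fst x))\<^sup>2 - (cmod (snd x))\<^sup>2 = 1}"

lemma cmod_sq: "complex_of_real ((cmod z)\<^sup>2) = z * cnj z"
  by (rule complex_norm_square)

lemma su11_iff: "(a, b) \<in> su11 \<longleftrightarrow> a * cnj a - b * cnj b = 1"
proof -
  have "(a, b) \<in> su11 \<longleftrightarrow> complex_of_real ((cmod a)\<^sup>2 - (cmod b)\<^sup>2) = 1"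
    by (simp only: su11_def mem_Collect_eq fst_conv snd_conv of_real_eq_1_iff)
  then show ?thesis
    by (simp only: of_real_diff cmod_sq)
qed

lemma closed_su11: "closed su11"
  unfolding su11_def by (intro closed_Collect_eq continuous_intros)

fun ppow :: "complex \<times> complex \<Rightarrow> nat \<Rightarrow> complex \<times> complex" where
  "ppow x 0 = (1, 0)"
| "ppow x (Suc n) = pmul x (ppow x n)"

text \<open>The operator norm of the matrix, its singular values being the sum and the absolute
  difference of the two moduli.\<close>

definition pnorm :: "complex \<times> complex \<Rightarrow> real" where
  "pnorm x = cmod (fst x) + cmod (snd x)"

lemma pnorm_nonneg [simp]: "pnorm x \<ge> 0"
  by (simp add: pnorm_def)

lemma pnorm_triangle: "pnorm (x + y) \<le> pnorm x + pnorm y"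
  unfolding pnorm_def fst_add snd_add
  using norm_triangle_ineq[of "fst x" "fst y"] norm_triangle_ineq[of "snd x" "snd y"] by linarith

lemma pnorm_pmul: "pnorm (pmul x y) \<le> pnorm x * pnorm y"
proof -
  have "cmod (fst x * fst y + snd x * cnj (snd y)) \<le> cmod (fst x) * cmod (fst y) + cmod (snd x) * cmod (snd y)"
    "cmod (fst x * snd y + snd x * cnj (fst y)) \<le> cmod (fst x) * cmod (snd y) + cmod (snd x) * cmod (fst y)"
    by (metis norm_triangle_ineq norm_mult complex_mod_cnj)+
  then show ?thesis
    by (simp add: pnorm_def pmul_def algebra_simps)
qed

lemma pmul_diff: "pmul x y - pmul z w = pmul x (y - w) + pmul (x - z) w"
  by (simp add: pmul_def prod_eq_iff algebra_simps)

text \<open>Rotations have norm 1, so splitting off one factor by \<open>pmul_diff\<close>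
  multiplies the error by at most \<open>1 + \<eta>\<close> and adds at most
  \<open>\<eta>\<close>.\<close>

lemma ppow_approx:
  assumes "pnorm (g - (cis p, 0)) \<le> \<eta>"
  shows "pnorm (ppow g k - (cis (real k * p), 0)) \<le> (1 + \<eta>) ^ k - 1"
proof (induction k)
  case 0
  then show ?case by (simp add: pnorm_def zero_prod_def)
next
  case (Suc k)
  let ?r = "\<lambda>k. (cis (real k * p), 0::complex)"
  have \<eta>: "\<eta> \<ge> 0"
    using assms pnorm_nonneg order_trans by blast
  have g: "pnorm g \<le> 1 + \<eta>"
    using pnorm_triangle[of "g - (cis p, 0)" "(cis p, 0)"] assms by (simp add: pnorm_def)
  have r: "?r (Suc k) = pmul (cis p, 0) (?r k)"
    by (simp add: pmul_def cis_mult algebra_simps)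
  have "pnorm (ppow g (Suc k) - ?r (Suc k)) \<le> pnorm (pmul g (ppow g k - ?r k)) + pnorm (pmul (g - (cis p, 0)) (?r k))"
    unfolding r ppow.simps pmul_diff by (rule pnorm_triangle)
  also have "\<dots> \<le> pnorm g * pnorm (ppow g k - ?r k) + pnorm (g - (cis p, 0)) * pnorm (?r k)"
    by (intro add_mono pnorm_pmul)
  also have "\<dots> \<le> (1 + \<eta>) * ((1 + \<eta>) ^ k - 1) + \<eta> * 1"
    using g assms Suc \<eta> by (intro add_mono mult_mono) (auto simp: pnorm_def)
  also have "\<dots> = (1 + \<eta>) ^ Suc k - 1"
    by (simp add: algebra_simps)
  finally show ?case .
qed

lemma cis_near_zero:
  assumes "e \<longlonglongrightarrow> 0" "\<And>n. e n \<noteq> (0::real)"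
  shows "(\<lambda>n. (cis (\<kappa> * e n) - 1) / of_real (e n)) \<longlonglongrightarrow> \<i> * of_real \<kappa>"
proof -
  have "((\<lambda>z. exp (\<i> * of_real \<kappa> * z)) has_field_derivative (\<i> * of_real \<kappa>)) (at 0)"
    by (auto intro!: derivative_eq_intros)
  then have "((\<lambda>z. (exp (\<i> * of_real \<kappa> * z) - 1) / z) \<longlongrightarrow> \<i> * of_real \<kappa>) (at 0)"
    by (simp add: has_field_derivative_iff)
  moreover have "filterlim (\<lambda>n. complex_of_real (e n)) (at 0) sequentially"
    using assms by (auto simp: filterlim_at tendsto_of_real_iff[symmetric] intro!: always_eventually tendsto_eq_intros)
  ultimately have "(\<lambda>n. (exp (\<i> * of_real \<kappa> * of_real (e n)) - 1) / of_real (e n)) \<longlonglongrightarrow> \<i> * of_real \<kappa>"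
    by (rule filterlim_compose)
  then show ?thesis
    by (simp add: cis_conv_exp mult.assoc)
qed

lemma floor_div_mult_tendsto:
  assumes "e \<longlonglongrightarrow> 0" "\<And>n. e n > (0::real)" "T \<ge> 0"
  shows "(\<lambda>n. real (nat \<lfloor>T / e n\<rfloor>) * e n) \<longlonglongrightarrow> T"
proof (rule tendsto_sandwich[of "\<lambda>n. T - e n" _ _ "\<lambda>n. T"])
  have *: "real (nat \<lfloor>T / e n\<rfloor>) = of_int \<lfloor>T / e n\<rfloor>" for n
    using assms(2)[of n] assms(3) by simp
  show "\<forall>\<^sub>F n in sequentially. T - e n \<le> real (nat \<lfloor>T / e n\<rfloor>) * e n"
  proof (rule always_eventually, rule allI)
    fix n
    have "T / e n - 1 \<le> of_int \<lfloor>T / e n\<rfloor>" by linarith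
    from mult_right_mono[OF this, of "e n"] show "T - e n \<le> real (nat \<lfloor>T / e n\<rfloor>) * e n"
      using assms(2)[of n] unfolding * by (simp add: algebra_simps)
  qed
  show "\<forall>\<^sub>F n in sequentially. real (nat \<lfloor>T / e n\<rfloor>) * e n \<le> T"
  proof (rule always_eventually, rule allI)
    fix n
    have "of_int \<lfloor>T / e n\<rfloor> \<le> T / e n" by linarith
    from mult_right_mono[OF this, of "e n"] show "real (nat \<lfloor>T / e n\<rfloor>) * e n \<le> T"
      using assms(2)[of n] unfolding * by simp
  qed
  show "(\<lambda>n. T - e n) \<longlonglongrightarrow> T"
    using tendsto_diff[OF tendsto_const assms(1), of T] by simp
qed auto

section \<open>Closed subgroups of SU(1,1) and the rotations in them\<close>

locale su11_subgroup =
  fixes S :: "(complex \<times> complex) set"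
  assumes su11: "S \<subseteq> su11"
    and one: "(1, 0) \<in> S"
    and mul: "x \<in> S \<Longrightarrow> y \<in> S \<Longrightarrow> pmul x y \<in> S"
    and inv: "x \<in> S \<Longrightarrow> pinv x \<in> S"
begin

lemma closure_subgroup: "su11_subgroup (closure S)"
proof
  show "closure S \<subseteq> su11"
    using su11 closed_su11 by (rule closure_minimal)
  show "(1, 0) \<in> closure S"
    using one closure_subset by blast
  show "pmul x y \<in> closure S" if xy: "x \<in> closure S" "y \<in> closure S" for x y
  proof -
    obtain f g where fg: "\<And>n. f n \<in> S" "f \<longlonglongrightarrow> x" "\<And>n. g n \<in> S" "g \<longlonglongrightarrow> y"
      using xy unfolding closure_sequential by blast
    have "(\<lambda>n. pmul (f n) (g n)) \<longlonglongrightarrow> pmul x y"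
      unfolding pmul_def using fg by (intro tendsto_intros)
    then show ?thesis
      unfolding closure_sequential by (intro exI[of _ "\<lambda>n. pmul (f n) (g n)"] conjI allI mul fg)
  qed
  show "pinv x \<in> closure S" if x: "x \<in> closure S" for x
  proof -
    obtain f where f: "\<And>n. f n \<in> S" "f \<longlonglongrightarrow> x"
      using x unfolding closure_sequential by blast
    have "(\<lambda>n. pinv (f n)) \<longlonglongrightarrow> pinv x"
      unfolding pinv_def using f by (intro tendsto_intros)
    then show ?thesis
      unfolding closure_sequential by (intro exI[of _ "\<lambda>n. pinv (f n)"] conjI allI inv f)
  qed
qed

lemma ppow_mem: "x \<in> S \<Longrightarrow> ppow x k \<in> S"
  by (induction k) (auto simp: one mul)

text \<open>Since \<open>g n\<close> agrees with the rotation \<open>cis (\<kappa> * e n)\<close> up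
  to \<open>o(e n)\<close>, its power with exponent about \<open>T / e n\<close> tends to the
  rotation \<open>cis (\<kappa> * T)\<close>.\<close>

lemma rotations_of_infinitesimal:
  assumes S: "closed S" "\<And>n. g n \<in> S"
    and e: "e \<longlonglongrightarrow> 0" "\<And>n. e n > 0"
    and fst: "(\<lambda>n. (fst (g n) - 1) / of_real (e n)) \<longlonglongrightarrow> \<i> * of_real \<kappa>"
    and snd: "(\<lambda>n. snd (g n) / of_real (e n)) \<longlonglongrightarrow> 0"
    and "\<kappa> \<noteq> 0"
  shows "(cis t, 0) \<in> S"
proof -
  \<comment> \<open>Exponents are natural numbers, so \<open>t\<close> is shifted by a multiple of
    \<open>2 * pi\<close> that makes \<open>T\<close> nonnegative.\<close>
  have "real_of_int \<lceil>\<bar>t\<bar>\<rceil> \<ge> \<bar>t\<bar>"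
    by linarith
  moreover have "real_of_int \<lceil>\<bar>t\<bar>\<rceil> * 1 \<le> real_of_int \<lceil>\<bar>t\<bar>\<rceil> * (2 * pi)"
    using pi_gt3 calculation by (intro mult_left_mono) auto
  ultimately have "t + 2 * pi * real_of_int \<lceil>\<bar>t\<bar>\<rceil> \<ge> 0" "t + 2 * pi * real_of_int (- \<lceil>\<bar>t\<bar>\<rceil>) \<le> 0"
    unfolding of_int_minus by argo+
  then obtain j :: int where j: "(t + 2 * pi * j) / \<kappa> \<ge> 0"
    by (metis divide_nonneg_nonneg divide_nonpos_nonpos linear)
  define T where "T = (t + 2 * pi * j) / \<kappa>"
  have cis_T: "cis (\<kappa> * T) = cis t"
    using \<open>\<kappa> \<noteq> 0\<close> by (simp add: T_def cis_mult[symmetric])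
  define k where "k n = nat \<lfloor>T / e n\<rfloor>" for n
  have ke: "(\<lambda>n. real (k n) * e n) \<longlonglongrightarrow> T"
    unfolding k_def using e j by (intro floor_div_mult_tendsto) (auto simp: T_def)
  \<comment> \<open>The error per factor is \<open>o(e n)\<close>; over about \<open>T / e n\<close>
    factors the bound of \<open>ppow_approx\<close> still tends to 0.\<close>
  define \<eta> where "\<eta> n = pnorm (g n - (cis (\<kappa> * e n), 0))" for n
  have "(\<lambda>n. cmod ((fst (g n) - 1) / of_real (e n) - (cis (\<kappa> * e n) - 1) / of_real (e n)) +
      cmod (snd (g n) / of_real (e n))) \<longlonglongrightarrow> cmod (\<i> * of_real \<kappa> - \<i> * of_real \<kappa>) + cmod 0"
    using e(2) by (intro tendsto_intros fst snd cis_near_zero e) (metis less_irrefl)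
  moreover have "cmod ((fst (g n) - 1) / of_real (e n) - (cis (\<kappa> * e n) - 1) / of_real (e n)) +
      cmod (snd (g n) / of_real (e n)) = \<eta> n / e n" for n
    using e(2)[of n]
    by (simp add: \<eta>_def pnorm_def norm_divide add_divide_distrib flip: diff_divide_distrib)
  ultimately have \<eta>e: "(\<lambda>n. \<eta> n / e n) \<longlonglongrightarrow> 0"
    by simp
  have "(\<lambda>n. exp ((\<eta> n / e n) * (real (k n) * e n)) - 1) \<longlonglongrightarrow> exp (0 * T) - 1"
    by (intro tendsto_intros \<eta>e ke)
  then have lim: "(\<lambda>n. exp (\<eta> n * real (k n)) - 1) \<longlonglongrightarrow> 0"
    using e(2) by (simp add: less_imp_neq[symmetric])
  have bound: "pnorm (ppow (g n) (k n) - (cis (real (k n) * (\<kappa> * e n)), 0)) \<le> exp (\<eta> n * real (k n)) - 1" for n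
  proof -
    have "(1 + \<eta> n) ^ k n \<le> exp (\<eta> n) ^ k n"
      by (intro power_mono) (auto simp: \<eta>_def)
    then show ?thesis
      using ppow_approx[of "g n" "\<kappa> * e n" "\<eta> n" "k n"]
      by (simp add: \<eta>_def exp_of_nat_mult mult.commute)
  qed
  have "(\<lambda>n. ppow (g n) (k n) - (cis (real (k n) * (\<kappa> * e n)), 0)) \<longlonglongrightarrow> (0, 0)"
  proof -
    have "(\<lambda>n. fst (ppow (g n) (k n) - (cis (real (k n) * (\<kappa> * e n)), 0))) \<longlonglongrightarrow> 0"
      by (rule Lim_null_comparison[OF always_eventually lim], rule allI, rule order_trans[OF _ bound])
         (simp add: pnorm_def)
    moreover have "(\<lambda>n. snd (ppow (g n) (k n) - (cis (real (k n) * (\<kappa> * e n)), 0))) \<longlonglongrightarrow> 0"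
      by (rule Lim_null_comparison[OF always_eventually lim], rule allI, rule order_trans[OF _ bound])
         (simp add: pnorm_def)
    ultimately show ?thesis
      by (subst prod.collapse[symmetric]) (rule tendsto_Pair)
  qed
  moreover have "(\<lambda>n. (cis (real (k n) * (\<kappa> * e n)), 0::complex)) \<longlonglongrightarrow> (cis (\<kappa> * T), 0)"
  proof -
    have "(\<lambda>n. (cis (\<kappa> * (real (k n) * e n)), 0::complex)) \<longlonglongrightarrow> (cis (\<kappa> * T), 0)"
      unfolding cis.ctr Complex_eq by (intro tendsto_intros ke)
    then show ?thesis
      by (simp add: mult.left_commute)
  qed
  ultimately have lim: "(\<lambda>n. ppow (g n) (k n)) \<longlonglongrightarrow> (cis (\<kappa> * T), 0)"
    using tendsto_add by fastforce
  have "(cis (\<kappa> * T), 0) \<in> S"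
    by (rule closed_sequentially[OF S(1) ppow_mem lim]) (rule S(2))
  then show ?thesis
    by (simp only: cis_T)
qed

text \<open>Rotations on both sides adjust the arguments of the two entries freely, so only the
  modulus of the second entry matters. Products reach every modulus up to twice a given one, hence
  all of them.\<close>

lemma full_of_rotations:
  assumes rot: "\<And>t. (cis t, 0) \<in> S" and ab: "(a, b) \<in> S" "b \<noteq> 0"
  shows "S = su11"
proof
  have unit: "\<exists>t. z = cis t * w" if "cmod z = cmod w" for z w :: complex
  proof (cases "w = 0")
    case False
    then have "z / w = cis (Arg (z / w))"
      using that by (subst cis_Arg) (auto simp: sgn_div_norm norm_divide)
    then show ?thesis
      using False by (metis nonzero_eq_divide_eq)
  qed (use that in auto)
  have sphere: "(z, w) \<in> S" if zw: "(z, w) \<in> su11" and x: "(z', w') \<in> S" "cmod w = cmod w'" for z w z' w'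
  proof -
    have "(z', w') \<in> su11"
      using x(1) su11 by blast
    with zw have "(cmod z)\<^sup>2 = 1 + (cmod w)\<^sup>2" "(cmod z')\<^sup>2 = 1 + (cmod w')\<^sup>2"
      by (auto simp: su11_def)
    with x(2) have "(cmod z)\<^sup>2 = (cmod z')\<^sup>2"
      by (simp only:)
    then have "cmod z = cmod z'"
      by (rule power2_eq_imp_eq) auto
    then obtain u v where uv: "z = cis u * z'" "w = cis v * w'"
      using unit x(2) by blast
    \<comment> \<open>A left rotation turns both entries alike, a right rotation turns them
      oppositely; half sum and half difference therefore give the phases \<open>u\<close> and
      \<open>v\<close>.\<close>
    have *: "cis ((u + v) / 2) * cis ((u - v) / 2) = cis u" "cis ((u + v) / 2) * cnj (cis ((u - v) / 2)) = cis v"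
      by (simp_all add: cis_mult cis_cnj field_simps)
    have "pmul (pmul (cis ((u + v) / 2), 0) (z', w')) (cis ((u - v) / 2), 0) =
      (cis ((u + v) / 2) * cis ((u - v) / 2) * z', cis ((u + v) / 2) * cnj (cis ((u - v) / 2)) * w')"
      by (simp add: pmul_def)
    then show ?thesis
      using mul[OF mul[OF rot x(1)] rot] unfolding uv * by metis
  qed
  have double: "\<exists>z w. (z, w) \<in> S \<and> cmod w = \<rho>'"
    if x: "(z, w) \<in> S" "cmod w = \<rho>" and \<rho>': "\<rho> > 0" "0 \<le> \<rho>'" "\<rho>' \<le> 2 * \<rho>" for \<rho> \<rho>' z w
  proof -
    define h where "h = sqrt (1 + \<rho>\<^sup>2)"
    have h: "h \<ge> 1" "h\<^sup>2 = 1 + \<rho>\<^sup>2"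
      by (auto simp: h_def)
    \<comment> \<open>Chosen so that the square of
      \<open>(of_real h * cis \<sigma>, of_real \<rho>)\<close> has second entry
      \<open>2 * \<rho> * h * cos \<sigma> = \<rho>'\<close>.\<close>
    define \<sigma> where "\<sigma> = arccos (\<rho>' / (2 * \<rho> * h))"
    have "2 * \<rho> * 1 \<le> 2 * \<rho> * h"
      using h \<rho>' by (intro mult_left_mono) auto
    with \<rho>' have "\<rho>' \<le> 2 * \<rho> * h"
      by linarith
    then have "0 \<le> \<rho>' / (2 * \<rho> * h)" "\<rho>' / (2 * \<rho> * h) \<le> 1"
      using \<rho>' h by (auto simp: divide_simps)
    then have \<sigma>: "cos \<sigma> = \<rho>' / (2 * \<rho> * h)"
      by (simp add: \<sigma>_def)
    have "(of_real h * cis \<sigma>, of_real \<rho>) \<in> S"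
      using x \<rho>' h by (intro sphere[OF _ x(1)]) (auto simp: su11_def norm_mult)
    from mul[OF this this] have "(pmul (of_real h * cis \<sigma>, of_real \<rho>) (of_real h * cis \<sigma>, of_real \<rho>)) \<in> S" .
    moreover have "snd (pmul (of_real h * cis \<sigma>, of_real \<rho>) (of_real h * cis \<sigma>, of_real \<rho>)) = of_real (2 * \<rho> * h * cos \<sigma>)"
      by (simp add: pmul_def complex_eq_iff)
    moreover have "2 * \<rho> * h * cos \<sigma> = \<rho>'"
      using \<rho>' h \<sigma> by simp
    ultimately show ?thesis
      using \<rho>' by (metis abs_of_nonneg norm_of_real prod.collapse)
  qed
  have all: "\<exists>z w. (z, w) \<in> S \<and> cmod w = \<rho>" if "0 \<le> \<rho>" "\<rho> \<le> 2 ^ k * cmod b" for \<rho> k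
    using that
  proof (induction k arbitrary: \<rho>)
    case 0
    then show ?case
      using double[OF ab(1) refl, of \<rho>] ab(2) by auto
  next
    case (Suc k)
    obtain z w where zw: "(z, w) \<in> S" "cmod w = 2 ^ k * cmod b"
      using Suc.IH[of "2 ^ k * cmod b"] by auto
    then show ?case
      using double[OF zw, of \<rho>] Suc.prems ab(2) by auto
  qed
  show "su11 \<subseteq> S"
  proof
    fix x assume x: "x \<in> su11"
    obtain z w where zw: "x = (z, w)" by (cases x)
    obtain k where "cmod w / cmod b < 2 ^ k"
      using real_arch_pow[of 2 "cmod w / cmod b"] by auto
    then have "cmod w \<le> 2 ^ k * cmod b"
      using ab(2) by (simp add: divide_simps mult.commute split: if_splits)
    then obtain z' w' where "(z', w') \<in> S" "cmod w' = cmod w"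
      using all[of "cmod w" k] by auto
    then show "x \<in> S"
      using sphere x zw by metis
  qed
qed (rule su11)

text \<open>The squared moduli \<open>x n\<close> of the second entries of \<open>B n\<close> satisfy \<open>x (Suc n) = \<mu> * (1 + x n) * x n\<close> with
  \<open>\<mu> = 4 * (sin \<psi>)\<^sup>2\<close>, so they tend to 0 without vanishing.
  The commutators \<open>g n\<close> of \<open>h n = T\<^sup>-\<^sup>1 B (Suc n)\<close> and \<open>T (h n) T\<^sup>-\<^sup>1\<close> are \<open>(1 + \<i> \<kappa> x n, 0)\<close> up to \<open>o(x n)\<close>.\<close>

lemma rotations_of_joergensen:
  assumes S: "closed S" "(cis \<psi>, 0) \<in> S" "B\<^sub>0 \<in> S" "snd B\<^sub>0 \<noteq> 0"
    and \<psi>: "sin \<psi> \<noteq> 0" "4 * (sin \<psi>)\<^sup>2 * (cmod (fst B\<^sub>0))\<^sup>2 < 1"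
  shows "(cis t, 0) \<in> S"
proof -
  define c where "c = cis \<psi>"
  define \<mu> where "\<mu> = 4 * (sin \<psi>)\<^sup>2"
  have c: "c * cnj c = 1" "c - cnj c = 2 * \<i> * of_real (sin \<psi>)" "c\<^sup>2 - (cnj c)\<^sup>2 = 2 * \<i> * of_real (sin (2 * \<psi>))"
    by (simp_all add: c_def complex_eq_iff power2_eq_square sin_double)
  have \<mu>: "\<mu> > 0"
    using \<psi>(1) by (simp add: \<mu>_def)
  define T where "T = (c, 0::complex)"
  have T: "T \<in> S" "pinv T = (cnj c, 0)"
    using S(2) by (auto simp: T_def c_def pinv_def)
  define B where "B = rec_nat B\<^sub>0 (\<lambda>_ x. pmul (pmul x T) (pinv x))"
  have B_0: "B 0 = B\<^sub>0" and B_Suc: "B (Suc n) = pmul (pmul (B n) T) (pinv (B n))" for n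
    by (auto simp: B_def)
  have B: "B n \<in> S" for n
    by (induction n) (auto simp: B_0 B_Suc S T mul inv)
  define a b x where "a n = fst (B n)" and "b n = snd (B n)" and "x n = (cmod (b n))\<^sup>2" for n
  have B_ab: "B n = (a n, b n)" for n
    by (simp add: a_def b_def)
  have bx: "b n * cnj (b n) = of_real (x n)" for n
    by (simp only: x_def cmod_sq)
  have ax: "a n * cnj (a n) = 1 + of_real (x n)" for n
    using B[of n] su11 bx[of n] by (auto simp: B_ab su11_iff subset_iff algebra_simps)
  have a2: "(cmod (a n))\<^sup>2 = 1 + x n" for n
    using B[of n] su11 by (auto simp: B_ab su11_def x_def)
  have a_Suc: "a (Suc n) = (1 + of_real (x n)) * c - of_real (x n) * cnj c"
    and b_Suc: "b (Suc n) = - 2 * \<i> * of_real (sin \<psi>) * (a n * b n)" for n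
  proof -
    have "B (Suc n) = pmul (pmul (a n, b n) T) (pinv (a n, b n))"
      using B_Suc[of n] unfolding B_ab[of n] .
    then have "a (Suc n) = (a n * cnj (a n)) * c - (b n * cnj (b n)) * cnj c"
      "b (Suc n) = - (c - cnj c) * (a n * b n)"
      unfolding B_ab[of "Suc n"] T_def by (simp_all add: pmul_def pinv_def algebra_simps)
    then show "a (Suc n) = (1 + of_real (x n)) * c - of_real (x n) * cnj c"
      "b (Suc n) = - 2 * \<i> * of_real (sin \<psi>) * (a n * b n)"
      unfolding ax bx c by simp_all
  qed
  have x_Suc: "x (Suc n) = \<mu> * (1 + x n) * x n" for n
    unfolding x_def[of "Suc n"] b_Suc norm_mult power_mult_distrib a2
    by (simp add: \<mu>_def x_def)
  have x_pos: "x n > 0" for n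
  proof (induction n)
    case 0
    then show ?case using S(4) by (simp add: x_def b_def B_0)
  next
    case (Suc n)
    then show ?case using \<mu> by (simp add: x_Suc add_pos_pos)
  qed
  \<comment> \<open>This is the quantity that the hypothesis bounds by 1. It bounds all later ratios
    of successive \<open>x n\<close> too, because \<open>x n\<close> never exceeds
    \<open>x 0\<close>.\<close>
  define q where "q = \<mu> * (1 + x 0)"
  have q: "0 < q" "q < 1"
    using \<psi>(2) \<mu> x_pos[of 0] a2[of 0] by (auto simp: q_def \<mu>_def a_def B_0 add_pos_pos)
  have x_le: "x n \<le> x 0 * q ^ n" for n
  proof (induction n)
    case (Suc n)
    have "x 0 * q ^ n \<le> x 0 * 1"
      using q x_pos[of 0] by (intro mult_left_mono power_le_one) auto
    with Suc have "x n \<le> x 0"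
      by linarith
    then have "\<mu> * (1 + x n) \<le> q"
      unfolding q_def using \<mu> by (intro mult_left_mono) auto
    then have "x (Suc n) \<le> q * (x 0 * q ^ n)"
      unfolding x_Suc using Suc q x_pos[of n] by (intro mult_mono) auto
    then show ?case
      by (simp add: algebra_simps)
  qed simp
  have x_lim: "x \<longlonglongrightarrow> 0"
  proof (rule tendsto_sandwich[of "\<lambda>n. 0" _ _ "\<lambda>n. x 0 * q ^ n"])
    show "(\<lambda>n. x 0 * q ^ n) \<longlonglongrightarrow> 0"
      using q by (intro tendsto_mult_right_zero LIMSEQ_power_zero) auto
  qed (use x_le x_pos in \<open>auto intro!: always_eventually less_imp_le\<close>)
  \<comment> \<open>\<open>h n\<close> tends to the identity, its first entry at rate
    \<open>x n\<close> but its second only at rate \<open>sqrt (x n)\<close>. Conjugation by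
    \<open>T\<close> turns the second entry by \<open>c\<close> squared, so the commutator has a
    diagonal term of order \<open>x n\<close>.\<close>
  define h where "h n = pmul (pinv T) (B (Suc n))" for n
  define h' where "h' n = pmul (pmul T (h n)) (pinv T)" for n
  define g where "g n = pmul (pmul (h n) (h' n)) (pinv (pmul (h' n) (h n)))" for n
  have g_S: "g n \<in> S" for n
    unfolding g_def h'_def h_def using B T by (intro mul inv) auto
  define u where "u n = 1 + of_real (x n) * (1 - (cnj c)\<^sup>2)" for n
  define w where "w n = cnj c * b (Suc n)" for n
  have h_eq: "h n = (u n, w n)" for n
  proof -
    have "h n = (cnj c * a (Suc n), cnj c * b (Suc n))"
      by (simp add: h_def T B_ab pmul_def)
    moreover have "cnj c * a (Suc n) = (1 + of_real (x n)) * (c * cnj c) - of_real (x n) * (cnj c)\<^sup>2"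
      unfolding a_Suc by (simp add: algebra_simps power2_eq_square)
    ultimately show ?thesis
      unfolding c by (simp add: u_def w_def algebra_simps)
  qed
  have h'_eq: "h' n = (u n, c\<^sup>2 * w n)" for n
  proof -
    have "h' n = ((c * cnj c) * u n, c\<^sup>2 * w n)"
      by (simp add: h'_def T(2) h_eq) (simp add: T_def pmul_def power2_eq_square)
    then show ?thesis unfolding c by simp
  qed
  have ww: "w n * cnj (w n) = of_real (\<mu> * (1 + x n) * x n)" for n
  proof -
    have "w n * cnj (w n) = (c * cnj c) * (b (Suc n) * cnj (b (Suc n)))"
      by (simp add: w_def)
    then show ?thesis by (simp only: c(1) bx x_Suc mult_1)
  qed
  \<comment> \<open>\<open>of_real (x n)\<close> times \<open>(\<delta> n, \<epsilon> n)\<close> is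
    the difference of the two products of \<open>h n\<close> and \<open>h' n\<close>; multiplied by
    the inverse of \<open>(P n, Q n)\<close> it is the deviation of \<open>g n\<close> from the
    identity.\<close>
  define \<delta> where "\<delta> n = - 2 * \<i> * of_real (sin (2 * \<psi>)) * of_real (\<mu> * (1 + x n))" for n
  define \<epsilon> where "\<epsilon> n = 2 * \<i> * of_real (sin (2 * \<psi>)) * (c\<^sup>2 - 1) * w n" for n
  define P where "P n = (u n)\<^sup>2 + c\<^sup>2 * of_real (\<mu> * (1 + x n) * x n)" for n
  define Q where "Q n = u n * w n + c\<^sup>2 * w n * cnj (u n)" for n
  have P_eq: "pmul (h' n) (h n) = (P n, Q n)" for n
    unfolding P_def Q_def ww[symmetric] h_eq h'_eq pmul_def
    by (simp add: power2_eq_square mult.assoc)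
  have hh': "pmul (h n) (h' n) = (P n + of_real (x n) * \<delta> n, Q n + of_real (x n) * \<epsilon> n)" for n
  proof -
    have "pmul (h n) (h' n) = (P n - (c\<^sup>2 - (cnj c)\<^sup>2) * (w n * cnj (w n)), Q n + (u n - cnj (u n)) * ((c\<^sup>2 - 1) * w n))"
      unfolding P_def Q_def ww[symmetric] h_eq h'_eq pmul_def
      by (simp add: algebra_simps power2_eq_square)
    moreover have "u n - cnj (u n) = of_real (x n) * (c\<^sup>2 - (cnj c)\<^sup>2)"
      by (simp add: u_def algebra_simps)
    ultimately show ?thesis
      unfolding ww c \<delta>_def \<epsilon>_def by (simp add: algebra_simps)
  qed
  have PQ: "P n * cnj (P n) - Q n * cnj (Q n) = 1" for n
  proof -
    have "(P n, Q n) \<in> S"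
      unfolding P_eq[symmetric] h'_def h_def using B T by (intro mul inv) auto
    then show ?thesis
      using su11 by (auto simp: su11_iff)
  qed
  have g_fst: "(fst (g n) - 1) / of_real (x n) = \<delta> n * cnj (P n) - \<epsilon> n * cnj (Q n)"
    and g_snd: "snd (g n) / of_real (x n) = \<epsilon> n * P n - \<delta> n * Q n" for n
  proof -
    have "fst (g n) = (P n * cnj (P n) - Q n * cnj (Q n)) + of_real (x n) * (\<delta> n * cnj (P n) - \<epsilon> n * cnj (Q n))"
      "snd (g n) = of_real (x n) * (\<epsilon> n * P n - \<delta> n * Q n)"
      unfolding g_def P_eq hh' by (simp_all add: pmul_def pinv_def algebra_simps)
    then show "(fst (g n) - 1) / of_real (x n) = \<delta> n * cnj (P n) - \<epsilon> n * cnj (Q n)"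
      "snd (g n) / of_real (x n) = \<epsilon> n * P n - \<delta> n * Q n"
      unfolding PQ using x_pos[of n] by simp_all
  qed
  define \<kappa> where "\<kappa> = - 2 * sin (2 * \<psi>) * \<mu>"
  \<comment> \<open>The first entry has modulus at least 1, so the hypothesis forces
    \<open>4 * sin \<psi> * sin \<psi> < 1\<close>. Thus \<open>cos \<psi>\<close> and
    \<open>\<kappa>\<close> do not vanish.\<close>
  have "(cmod (fst B\<^sub>0))\<^sup>2 \<ge> 1"
    using a2[of 0] x_pos[of 0] by (simp add: a_def B_0)
  then have "4 * (sin \<psi>)\<^sup>2 * 1 \<le> 4 * (sin \<psi>)\<^sup>2 * (cmod (fst B\<^sub>0))\<^sup>2"
    by (intro mult_left_mono) auto
  then have "cos \<psi> \<noteq> 0"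
    using \<psi>(2) sin_cos_squared_add[of \<psi>] by (auto simp: power2_eq_square)
  then have \<kappa>: "\<kappa> \<noteq> 0"
    using \<psi>(1) \<mu> by (simp add: \<kappa>_def sin_double)
  have w_lim: "w \<longlonglongrightarrow> 0"
  proof -
    have "(\<lambda>n. sqrt (x (Suc n))) \<longlonglongrightarrow> sqrt 0"
      by (intro tendsto_intros LIMSEQ_Suc x_lim)
    moreover have "sqrt (x (Suc n)) = cmod (w n)" for n
      by (simp add: x_def w_def norm_mult c_def)
    ultimately show ?thesis
      using tendsto_norm_zero_iff by fastforce
  qed
  have x_lim': "(\<lambda>n. complex_of_real (x n)) \<longlonglongrightarrow> 0"
    using tendsto_of_real[OF x_lim] by simp
  have lims: "\<delta> \<longlonglongrightarrow> \<i> * of_real \<kappa>" "\<epsilon> \<longlonglongrightarrow> 0" "P \<longlonglongrightarrow> 1" "Q \<longlonglongrightarrow> 0"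
  proof -
    have "\<delta> \<longlonglongrightarrow> - 2 * \<i> * of_real (sin (2 * \<psi>)) * of_real (\<mu> * (1 + 0))"
      unfolding \<delta>_def by (intro tendsto_intros x_lim)
    then show "\<delta> \<longlonglongrightarrow> \<i> * of_real \<kappa>"
      by (simp add: \<kappa>_def mult_ac)
    show "\<epsilon> \<longlonglongrightarrow> 0"
      unfolding \<epsilon>_def by (intro tendsto_mult_right_zero w_lim)
    have u: "u \<longlonglongrightarrow> 1 + 0 * (1 - (cnj c)\<^sup>2)"
      unfolding u_def by (intro tendsto_intros x_lim')
    have "P \<longlonglongrightarrow> (1 + 0 * (1 - (cnj c)\<^sup>2))\<^sup>2 + c\<^sup>2 * of_real (\<mu> * (1 + 0) * 0)"
      unfolding P_def by (intro tendsto_intros u x_lim)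
    then show "P \<longlonglongrightarrow> 1" by simp
    have "Q \<longlonglongrightarrow> (1 + 0 * (1 - (cnj c)\<^sup>2)) * 0 + c\<^sup>2 * 0 * cnj (1 + 0 * (1 - (cnj c)\<^sup>2))"
      unfolding Q_def by (intro tendsto_intros u w_lim)
    then show "Q \<longlonglongrightarrow> 0" by simp
  qed
  show ?thesis
  proof (rule rotations_of_infinitesimal[where g = g and e = x and \<kappa> = \<kappa>])
    have "(\<lambda>n. \<delta> n * cnj (P n) - \<epsilon> n * cnj (Q n)) \<longlonglongrightarrow> \<i> * of_real \<kappa> * cnj 1 - 0 * cnj 0"
      by (intro tendsto_intros lims)
    then show "(\<lambda>n. (fst (g n) - 1) / of_real (x n)) \<longlonglongrightarrow> \<i> * of_real \<kappa>"
      unfolding g_fst by simp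
    have "(\<lambda>n. \<epsilon> n * P n - \<delta> n * Q n) \<longlonglongrightarrow> 0 * 1 - \<i> * of_real \<kappa> * 0"
      by (intro tendsto_intros lims)
    then show "(\<lambda>n. snd (g n) / of_real (x n)) \<longlonglongrightarrow> 0"
      unfolding g_snd by simp
  qed (use S g_S x_lim x_pos \<kappa> in auto)
qed

end

section \<open>A small power of an irregular rotation\<close>

text \<open>If \<open>n = \<lfloor>pi / \<theta>\<rfloor>\<close>, then \<open>pi\<close> lies strictly between \<open>n \<theta>\<close> and \<open>(n + 1) \<theta>\<close>, hence within \<open>\<theta> / 2\<close> of one of them.\<close>

lemma small_multiple_angle:
  assumes "0 < \<theta>" "\<theta> < pi / 4" "\<And>n::nat. n > 0 \<Longrightarrow> \<theta> \<noteq> pi / real n"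
  obtains k :: nat where "sin (real k * \<theta>) \<noteq> 0" "2 * (sin (real k * \<theta>))\<^sup>2 < (sin \<theta>)\<^sup>2"
proof -
  define n where "n = nat \<lfloor>pi / \<theta>\<rfloor>"
  have "real n = of_int \<lfloor>pi / \<theta>\<rfloor>"
    using assms by (simp add: n_def)
  then have "real n \<le> pi / \<theta>" "pi / \<theta> < real n + 1"
    by linarith+
  then have n: "real n * \<theta> \<le> pi" "pi < (real n + 1) * \<theta>"
    using assms by (simp_all add: field_simps)
  have "real n * \<theta> \<noteq> pi"
    using assms(3)[of n] assms(1) by (cases "n = 0") (auto simp: field_simps)
  with n have n': "real n * \<theta> < pi" by simp
  have half: "2 * (sin (\<theta> / 2))\<^sup>2 < (sin \<theta>)\<^sup>2"
  proof -
    have c: "2 * (cos (\<theta> / 2))\<^sup>2 = 1 + cos \<theta>"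
      using cos_double_cos[of "\<theta> / 2"] by simp
    have "(sin \<theta>)\<^sup>2 = 2 * (sin (\<theta> / 2))\<^sup>2 * (2 * (cos (\<theta> / 2))\<^sup>2)"
      using sin_double[of "\<theta> / 2"] by (simp add: power_mult_distrib)
    also have "\<dots> = 2 * (sin (\<theta> / 2))\<^sup>2 * (1 + cos \<theta>)"
      by (simp only: c)
    also have "\<dots> > 2 * (sin (\<theta> / 2))\<^sup>2 * 1"
    proof (rule mult_strict_left_mono)
      show "1 < 1 + cos \<theta>"
        using assms(1,2) cos_gt_zero_pi[of \<theta>] by simp
      show "0 < 2 * (sin (\<theta> / 2))\<^sup>2"
        using sin_gt_zero[of "\<theta> / 2"] assms(1,2) by simp
    qed
    finally show ?thesis by simp
  qed
  have small: "sin y \<noteq> 0 \<and> 2 * (sin y)\<^sup>2 < (sin \<theta>)\<^sup>2" if "0 < y" "y \<le> \<theta> / 2" for y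
  proof -
    have "sin y > 0"
      using that assms by (intro sin_gt_zero) auto
    moreover have "sin y \<le> sin (\<theta> / 2)"
      using that assms by (intro sin_monotone_2pi_le) auto
    ultimately show ?thesis
      using half power_mono[of "sin y" "sin (\<theta> / 2)" 2] by linarith
  qed
  show thesis
  proof (cases "pi - real n * \<theta> \<le> \<theta> / 2")
    case True
    then show thesis
      using small[of "pi - real n * \<theta>"] n' that[of n] by simp
  next
    case False
    have "sin (real (Suc n) * \<theta> - pi) = - sin (real (Suc n) * \<theta>)"
      by (simp add: sin_diff)
    then show thesis
      using small[of "real (Suc n) * \<theta> - pi"] n(2) False that[of "Suc n"] by (simp add: algebra_simps)
  qed
qed

text \<open>The normalisation of \<open>H\<close> turns the bound of
  \<open>small_multiple_angle\<close> into the hypothesis of \<open>rotations_of_joergensen\<close>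
  for the \<open>k\<close>-th power of the rotation. The closure then contains all rotations and the
  element \<open>H\<close> with nonzero second entry.\<close>

theorem (in su11_subgroup) dense_of_rotation_and_half_turn:
  assumes T: "(cis \<theta>, 0) \<in> S" and H: "H \<in> S" "2 * (sin \<theta>)\<^sup>2 * (cmod (fst H))\<^sup>2 = 1"
    and \<theta>: "0 < \<theta>" "\<theta> < pi / 4" "\<And>n::nat. n > 0 \<Longrightarrow> \<theta> \<noteq> pi / real n"
  shows "closure S = su11"
proof -
  obtain k :: nat where k: "sin (real k * \<theta>) \<noteq> 0" "2 * (sin (real k * \<theta>))\<^sup>2 < (sin \<theta>)\<^sup>2"
    using small_multiple_angle[OF \<theta>] by blast
  interpret C: su11_subgroup "closure S"
    by (rule closure_subgroup)
  have S: "x \<in> closure S" if "x \<in> S" for x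
    using that closure_subset by blast
  have "ppow (cis \<theta>, 0) n = (cis (real n * \<theta>), 0)" for n
    by (induction n) (auto simp: pmul_def cis_mult algebra_simps)
  then have Tk: "(cis (real k * \<theta>), 0) \<in> S"
    using ppow_mem[OF T, of k] by simp
  have "sin \<theta> > 0" "sin \<theta> < sin (pi / 4)"
    using \<theta> by (auto intro!: sin_gt_zero sin_monotone_2pi)
  then have s: "(sin \<theta>)\<^sup>2 > 0" "2 * (sin \<theta>)\<^sup>2 < 1"
    using power_strict_mono[of "sin \<theta>" "sin (pi / 4)" 2] by (auto simp: sin_45 power_divide)
  \<comment> \<open>Otherwise the first entry has modulus 1, so
    \<open>2 * sin \<theta> * sin \<theta> = 1\<close>, which \<open>\<theta> < pi / 4\<close>
    excludes.\<close>
  have H1: "snd H \<noteq> 0"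
  proof
    assume "snd H = 0"
    moreover have "H \<in> su11" using H(1) su11 by blast
    ultimately have "(cmod (fst H))\<^sup>2 = 1"
      by (simp add: su11_def)
    then show False using H(2) s by simp
  qed
  have "(cmod (fst H))\<^sup>2 > 0"
    using H(2) by (metis mult_zero_right zero_less_power2 zero_neq_one power_zero_numeral)
  then have "2 * (2 * (sin (real k * \<theta>))\<^sup>2) * (cmod (fst H))\<^sup>2 < 2 * (sin \<theta>)\<^sup>2 * (cmod (fst H))\<^sup>2"
    using k(2) by (intro mult_strict_right_mono) auto
  then have "4 * (sin (real k * \<theta>))\<^sup>2 * (cmod (fst H))\<^sup>2 < 1"
    using H(2) by simp
  from C.rotations_of_joergensen[OF closed_closure S[OF Tk] S[OF H(1)] H1 k(1) this]
  have "(cis t, 0) \<in> closure S" for t .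
  then show ?thesis
    using C.full_of_rotations[of "fst H" "snd H"] S[OF H(1)] H1 by auto
qed

section \<open>Moebius transformations, isometries and geodesics\<close>

typedef sl2 = "{q :: real \<times> real \<times> real \<times> real. case q of (a, b, c, d) \<Rightarrow> a * d - b * c = 1}"
  morphisms entries of_entries
  by (rule exI[of _ "(1, 0, 0, 1)"]) simp

definition ea :: "sl2 \<Rightarrow> real" where "ea g = fst (entries g)"
definition eb :: "sl2 \<Rightarrow> real" where "eb g = fst (snd (entries g))"
definition ec :: "sl2 \<Rightarrow> real" where "ec g = fst (snd (snd (entries g)))"
definition ed :: "sl2 \<Rightarrow> real" where "ed g = snd (snd (snd (entries g)))"

definition sl2_of :: "real \<Rightarrow> real \<Rightarrow> real \<Rightarrow> real \<Rightarrow> sl2" where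
  "sl2_of a b c d = of_entries (a, b, c, d)"

lemma det1: "ea g * ed g - eb g * ec g = 1"
  using entries[of g] by (auto simp: ea_def eb_def ec_def ed_def split_beta)

lemma entries_sl2_of:
  assumes "a * d - b * c = 1"
  shows "ea (sl2_of a b c d) = a" "eb (sl2_of a b c d) = b" "ec (sl2_of a b c d) = c" "ed (sl2_of a b c d) = d"
  using assms by (simp_all add: ea_def eb_def ec_def ed_def sl2_of_def of_entries_inverse)

lemma sl2_eqI:
  assumes "ea g = ea h" "eb g = eb h" "ec g = ec h" "ed g = ed h"
  shows "g = h"
proof -
  have "entries g = entries h"
    using assms by (simp add: ea_def eb_def ec_def ed_def prod_eq_iff)
  then show ?thesis
    by (simp add: entries_inject)
qed

instantiation sl2 :: monoid_mult
begin

definition "1 = sl2_of 1 0 0 1"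
definition "g * h = sl2_of (ea g * ea h + eb g * ec h) (ea g * eb h + eb g * ed h)
  (ec g * ea h + ed g * ec h) (ec g * eb h + ed g * ed h)"

lemma entries_one [simp]: "ea 1 = 1" "eb 1 = 0" "ec 1 = 0" "ed 1 = 1"
  by (simp_all add: one_sl2_def entries_sl2_of)

lemma det_mult:
  "(ea g * ea h + eb g * ec h) * (ec g * eb h + ed g * ed h) -
   (ea g * eb h + eb g * ed h) * (ec g * ea h + ed g * ec h) = 1"
  using det1[of g] det1[of h] by algebra

lemma entries_mult [simp]:
  "ea (g * h) = ea g * ea h + eb g * ec h" "eb (g * h) = ea g * eb h + eb g * ed h"
  "ec (g * h) = ec g * ea h + ed g * ec h" "ed (g * h) = ec g * eb h + ed g * ed h"
  by (simp_all add: times_sl2_def entries_sl2_of det_mult)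

instance
  by standard (auto intro!: sl2_eqI simp: algebra_simps)

end

definition sinv :: "sl2 \<Rightarrow> sl2" where
  "sinv g = sl2_of (ed g) (- eb g) (- ec g) (ea g)"

lemma entries_sinv [simp]: "ea (sinv g) = ed g" "eb (sinv g) = - eb g" "ec (sinv g) = - ec g" "ed (sinv g) = ea g"
  using det1[of g] by (simp_all add: sinv_def entries_sl2_of algebra_simps)

lemma sinv_left [simp]: "sinv g * g = 1" and sinv_right [simp]: "g * sinv g = 1"
  using det1[of g] by (auto intro!: sl2_eqI simp: algebra_simps)

lemma sinv_left' [simp]: "sinv g * (g * h) = h" and sinv_right' [simp]: "g * (sinv g * h) = h"
  by (simp_all flip: mult.assoc)

lemma sinv_sinv [simp]: "sinv (sinv g) = g"
  by (rule sl2_eqI) auto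

lemma sinv_mult: "sinv (g * h) = sinv h * sinv g"
  by (rule sl2_eqI) (auto simp: algebra_simps)

section \<open>The action on the upper half-plane and its derivative\<close>

definition denom :: "sl2 \<Rightarrow> complex \<Rightarrow> complex" where
  "denom g z = of_real (ec g) * z + of_real (ed g)"

definition mob :: "sl2 \<Rightarrow> complex \<Rightarrow> complex" where
  "mob g z = (of_real (ea g) * z + of_real (eb g)) / denom g z"

definition act :: "sl2 \<Rightarrow> hplane \<Rightarrow> hplane" where
  "act g p = hpoint (mob g (coord p))"

lemma denom_nonzero [simp]:
  assumes "Im z > 0" shows "denom g z \<noteq> 0"
proof
  assume "denom g z = 0"
  then have "ec g * Im z = 0" "ec g * Re z + ed g = 0"
    by (auto simp: denom_def complex_eq_iff)
  then have "ec g = 0" "ed g = 0"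
    using assms by auto
  then show False
    using det1[of g] by simp
qed

lemma mob_diff:
  assumes "Im z > 0" "Im w > 0"
  shows "mob g z - mob g w = (z - w) / (denom g z * denom g w)"
proof -
  have "(of_real (ea g) * z + of_real (eb g)) * denom g w - (of_real (ea g) * w + of_real (eb g)) * denom g z
     = (z - w) * of_real (ea g * ed g - eb g * ec g)"
    by (simp add: denom_def algebra_simps)
  then show ?thesis
    using assms by (simp add: mob_def det1 diff_frac_eq)
qed

lemma Im_mob:
  assumes "Im z > 0"
  shows "Im (mob g z) = Im z / (cmod (denom g z))\<^sup>2"
proof -
  have "mob g z = (of_real (ea g) * z + of_real (eb g)) * cnj (denom g z) / of_real ((cmod (denom g z))\<^sup>2)"
    unfolding mob_def by (rule complex_div_cnj)
  then have "Im (mob g z) = Im ((of_real (ea g) * z + of_real (eb g)) * cnj (denom g z)) / (cmod (denom g z))\<^sup>2"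
    by (simp only: Im_divide_of_real)
  also have "Im ((of_real (ea g) * z + of_real (eb g)) * cnj (denom g z)) = Im z * (ea g * ed g - eb g * ec g)"
    by (simp add: denom_def algebra_simps)
  finally show ?thesis
    by (simp add: det1)
qed

lemma Im_mob_pos: "Im z > 0 \<Longrightarrow> Im (mob g z) > 0"
  by (simp add: Im_mob)

lemma coord_act: "coord (act g p) = mob g (coord p)"
  by (simp add: act_def hpoint_inverse Im_mob_pos)

lemma hplane_eqI: "coord p = coord q \<Longrightarrow> p = q"
  by (simp add: coord_inject)

lemma mob_times_denom: "Im z > 0 \<Longrightarrow> mob g z * denom g z = of_real (ea g) * z + of_real (eb g)"
  by (simp add: mob_def)

lemma denom_mult:
  assumes "Im z > 0"
  shows "denom (g * h) z = denom g (mob h z) * denom h z"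
proof -
  have "denom g (mob h z) * denom h z = of_real (ec g) * (mob h z * denom h z) + of_real (ed g) * denom h z"
    by (simp add: denom_def[of g] algebra_simps)
  then show ?thesis
    unfolding mob_times_denom[OF assms] by (simp add: denom_def algebra_simps)
qed

lemma mob_mult:
  assumes "Im z > 0"
  shows "mob (g * h) z = mob g (mob h z)"
proof -
  have "(of_real (ea g) * mob h z + of_real (eb g)) * denom h z
      = of_real (ea g) * (mob h z * denom h z) + of_real (eb g) * denom h z"
    by (simp add: algebra_simps)
  also have "\<dots> = of_real (ea (g * h)) * z + of_real (eb (g * h))"
    unfolding mob_times_denom[OF assms] by (simp add: denom_def algebra_simps)
  finally show ?thesis
    unfolding mob_def[of "g * h"] mob_def[of g] denom_mult[OF assms]
    using assms by (metis denom_nonzero mult_divide_mult_cancel_right)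
qed

lemma act_mult: "act (g * h) = act g \<circ> act h"
  by (auto intro!: hplane_eqI simp: coord_act mob_mult)

lemma act_one [simp]: "act 1 = id"
  by (auto intro!: hplane_eqI simp: coord_act mob_def denom_def)

lemma act_act: "act g (act h p) = act (g * h) p"
  by (simp add: act_mult)

lemma act_sinv [simp]: "act (sinv g) (act g p) = p" "act g (act (sinv g) p) = p"
  by (simp_all add: act_act)

lemma dist_act [simp]: "dist (act g p) (act g q) = dist p q"
proof -
  have "cosh_hdist (mob g (coord p)) (mob g (coord q)) = cosh_hdist (coord p) (coord q)"
    by (simp add: cosh_hdist_def mob_diff Im_mob norm_divide norm_mult power_divide power_mult_distrib)
  then show ?thesis
    by (simp add: dist_hplane_def coord_act)
qed

lemma bij_act: "bij (act g)"
  by (rule o_bij[of "act (sinv g)"]) (auto simp flip: act_mult)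

lemma hisometry_act: "hisometry (act g)"
  by (simp add: hisometry_def bij_act)

text \<open>The complex derivative of \<open>act g\<close> at \<open>p\<close>;
  \<open>jac_mult\<close> is the chain rule.\<close>

definition jac :: "sl2 \<Rightarrow> hplane \<Rightarrow> complex" where
  "jac g p = 1 / (denom g (coord p))\<^sup>2"

lemma jac_nonzero [simp]: "jac g p \<noteq> 0"
  by (simp add: jac_def)

lemma has_hderivative_act: "has_hderivative (act g) (\<lambda>u. jac g p * u) p"
proof -
  have "(mob g has_field_derivative jac g p) (at (coord p))"
  proof -
    have "((\<lambda>z. (of_real (ea g) * z + of_real (eb g)) / (of_real (ec g) * z + of_real (ed g)))
      has_field_derivative jac g p) (at (coord p))"
    proof (rule DERIV_cong, rule DERIV_quotient)
      show "((\<lambda>z. complex_of_real (ea g) * z + of_real (eb g)) has_field_derivative of_real (ea g)) (at (coord p))"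
        "((\<lambda>z. complex_of_real (ec g) * z + of_real (ed g)) has_field_derivative of_real (ec g)) (at (coord p))"
        by (auto intro!: derivative_eq_intros)
      show "of_real (ec g) * coord p + of_real (ed g) \<noteq> 0"
        using denom_nonzero[of "coord p" g] by (simp add: denom_def)
      have "of_real (ea g) * (of_real (ec g) * coord p + of_real (ed g)) - of_real (ec g) * (of_real (ea g) * coord p + of_real (eb g))
        = complex_of_real (ea g * ed g - eb g * ec g)"
        by (simp add: algebra_simps)
      then show "(of_real (ea g) * (of_real (ec g) * coord p + of_real (ed g)) - of_real (ec g) * (of_real (ea g) * coord p + of_real (eb g)))
        / (of_real (ec g) * coord p + of_real (ed g)) ^ Suc (Suc 0) = jac g p"
        unfolding det1 by (simp add: jac_def denom_def power2_eq_square)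
    qed
    then show ?thesis
      unfolding mob_def[abs_def] denom_def .
  qed
  then have "(mob g has_derivative (\<lambda>u. jac g p * u)) (at (coord p))"
    by (simp add: has_field_derivative_def)
  then show ?thesis
    unfolding has_hderivative_def
    by (rule has_derivative_transform_within_open[OF _ open_coord_domain])
       (auto simp: coord_act hpoint_inverse)
qed

lemma has_hderivative_unique:
  "has_hderivative f D p \<Longrightarrow> has_hderivative f E p \<Longrightarrow> D = E"
  unfolding has_hderivative_def by (rule has_derivative_unique)

lemma jac_mult: "jac (g * h) p = jac g (act h p) * jac h p"
  by (simp add: jac_def denom_mult coord_act power_mult_distrib)

lemma jac_one [simp]: "jac 1 p = 1"
  by (simp add: jac_def denom_def)

lemma jac_sinv: "jac (sinv g) (act g p) = 1 / jac g p"
  using jac_mult[of "sinv g" g p] by (simp add: field_simps)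

lemma orientation_preserving_act: "orientation_preserving (act g)"
  unfolding orientation_preserving_def
proof
  fix p
  have "Im (cnj (jac g p * 1) * (jac g p * \<i>)) > 0"
  proof -
    have "cnj (jac g p * 1) * (jac g p * \<i>) = of_real ((cmod (jac g p))\<^sup>2) * \<i>"
      by (simp only: complex_norm_square mult_ac) simp
    then show ?thesis
      unfolding \<open>_ = of_real _ * \<i>\<close> by simp
  qed
  then show "\<exists>D. has_hderivative (act g) D p \<and> Im (cnj (D 1) * D \<i>) > 0"
    using has_hderivative_act by blast
qed

lemma act_carrier [simp]: "act g \<in> carrier Isom_plus"
  by (simp add: Isom_plus_def hisometry_act orientation_preserving_act)

section \<open>Rotations, translations and frames based at \<open>\<i>\<close>\<close>

definition hi :: hplane where "hi = hpoint \<i>"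

lemma coord_hi [simp]: "coord hi = \<i>"
  by (simp add: hi_def hpoint_inverse)

text \<open>By \<open>jac_rot_hi\<close> this turns counterclockwise by \<open>2 * t\<close>: the
  clockwise quarter turn is \<open>rot (- pi / 4)\<close> and the half turn
  \<open>rot (pi / 2)\<close>.\<close>

definition rot :: "real \<Rightarrow> sl2" where
  "rot t = sl2_of (cos t) (sin t) (- sin t) (cos t)"

definition tr :: "real \<Rightarrow> sl2" where
  "tr t = sl2_of (exp (t / 2)) 0 0 (exp (- t / 2))"

lemma entries_rot [simp]: "ea (rot t) = cos t" "eb (rot t) = sin t" "ec (rot t) = - sin t" "ed (rot t) = cos t"
  by (simp_all add: rot_def entries_sl2_of flip: power2_eq_square)

lemma entries_tr [simp]: "ea (tr t) = exp (t / 2)" "eb (tr t) = 0" "ec (tr t) = 0" "ed (tr t) = exp (- t / 2)"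
  by (simp_all add: tr_def entries_sl2_of flip: exp_add)

lemma act_rot_hi [simp]: "act (rot t) hi = hi"
proof (rule hplane_eqI)
  have "Complex (cos t) (- sin t) \<noteq> 0"
    using sin_zero_norm_cos_one[of t] by (auto simp: complex_eq_iff)
  moreover have "of_real (cos t) * \<i> + of_real (sin t) = \<i> * Complex (cos t) (- sin t)"
    "- of_real (sin t) * \<i> + of_real (cos t) = Complex (cos t) (- sin t)"
    by (simp_all add: complex_eq_iff)
  ultimately show "coord (act (rot t) hi) = coord hi"
    by (simp add: coord_act mob_def denom_def)
qed

lemma jac_rot_hi: "jac (rot t) hi = cis (2 * t)"
proof -
  have "denom (rot t) \<i> = cis (- t)"
    by (simp add: denom_def complex_eq_iff)
  then show ?thesis
    unfolding jac_def coord_hi by (simp only: Complex.DeMoivre) (simp add: field_simps cis_mult)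
qed

lemma coord_act_tr: "coord (act (tr t) p) = of_real (exp t) * coord p"
proof -
  have "exp t = exp (t / 2) * exp (t / 2)"
    by (simp flip: exp_add)
  then show ?thesis
    by (simp add: coord_act mob_def denom_def exp_minus field_simps flip: of_real_mult)
qed

definition up :: "real \<Rightarrow> hplane" where "up t = act (tr t) hi"

lemma coord_up [simp]: "coord (up t) = of_real (exp t) * \<i>"
  by (simp add: up_def coord_act_tr)

lemma up_0 [simp]: "up 0 = hi"
  by (rule hplane_eqI) simp

lemma tr_add: "tr (s + t) = tr s * tr t"
  by (rule sl2_eqI) (auto simp: add_divide_distrib exp_add[symmetric])

lemma tr_0 [simp]: "tr 0 = 1"
  by (rule sl2_eqI) auto

lemma rot_add: "rot (s + t) = rot s * rot t"
  by (rule sl2_eqI) (auto simp: cos_add sin_add)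

lemma act_tr_up [simp]: "act (tr s) (up t) = up (s + t)"
  by (simp add: up_def act_act tr_add)

text \<open>The upper triangular \<open>k\<close> takes \<open>\<i>\<close> to \<open>p\<close> with
  positive real derivative; a preceding rotation supplies the argument, halved because
  \<open>rot\<close> doubles angles.\<close>

lemma frame_exists:
  assumes "unit_tangent p u"
  shows "\<exists>g. act g hi = p \<and> jac g hi * \<i> = u"
proof -
  define x y where "x = Re (coord p)" and "y = Im (coord p)"
  have y: "y > 0" and u: "cmod u = y"
    using assms by (auto simp: y_def unit_tangent_def field_simps)
  define k where "k = sl2_of (sqrt y) (x / sqrt y) 0 (1 / sqrt y)"
  have k: "ea k = sqrt y" "eb k = x / sqrt y" "ec k = 0" "ed k = 1 / sqrt y"
    using y by (simp_all add: k_def entries_sl2_of)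
  define g where "g = k * rot (Arg (u / \<i>) / 2)"
  have "act k hi = p"
  proof (rule hplane_eqI)
    have "coord (act k hi) = of_real (sqrt y * sqrt y) * \<i> + of_real x"
      using y by (simp add: coord_act mob_def denom_def k field_simps flip: of_real_mult)
    then show "coord (act k hi) = coord p"
      using y by (simp add: complex_eq_iff x_def y_def abs_of_pos)
  qed
  moreover have "jac k hi = of_real y"
    using y by (simp add: jac_def denom_def k power_divide power2_eq_square flip: of_real_mult)
  moreover have "cis (Arg (u / \<i>)) = u / \<i> / of_real y"
    using y u by (subst cis_Arg) (auto simp: sgn_div_norm norm_divide norm_mult scaleR_conv_of_real field_simps)
  ultimately show ?thesis
    using y by (intro exI[of _ g]) (auto simp: g_def jac_mult jac_rot_hi act_mult algebra_simps)
qed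


section \<open>Distances and rigidity of isometries\<close>

lemma cosh_dist: "cosh (dist p q) = cosh_hdist (coord p) (coord q)"
  by (simp add: dist_hplane_def cosh_hdist_ge_1)

lemma dist_eq_iff: "dist p q = dist p' q' \<longleftrightarrow> cosh_hdist (coord p) (coord q) = cosh_hdist (coord p') (coord q')"
  unfolding cosh_dist[symmetric] by (metis arcosh_cosh_real zero_le_dist)

lemma cosh_hdist_axis:
  assumes "Im z > 0" "s > 0"
  shows "cosh_hdist (of_real s * \<i>) z = (s\<^sup>2 + (cmod z)\<^sup>2) / (2 * s * Im z)"
proof -
  have "(cmod (of_real s * \<i> - z))\<^sup>2 = s\<^sup>2 + (cmod z)\<^sup>2 - 2 * s * Im z"
    unfolding cmod_power2 by (simp add: power2_eq_square algebra_simps)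
  note eq = this
  show ?thesis
    unfolding cosh_hdist_def eq using assms by (simp add: field_simps)
qed

lemma dist_up: "dist (up s) (up t) = \<bar>s - t\<bar>"
proof -
  have "cosh_hdist (coord (up s)) (coord (up t)) = cosh (s - t)"
    unfolding coord_up by (subst cosh_hdist_axis)
      (simp_all add: cosh_def exp_diff norm_mult field_simps power2_eq_square)
  then have "dist (up s) (up t) = arcosh (cosh \<bar>s - t\<bar>)"
    by (simp add: dist_hplane_def)
  then show ?thesis
    by (simp only: arcosh_cosh_real abs_ge_zero)
qed

lemma act_rot_up: "act (rot (pi / 2)) (up t) = up (- t)"
  by (rule hplane_eqI) (simp add: coord_act mob_def denom_def exp_minus field_simps)

text \<open>The condition that \<open>rot t\<close> takes \<open>p\<close> to the imaginary axis is
  a homogeneous linear equation in \<open>cos (2 * t)\<close> and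
  \<open>sin (2 * t)\<close>.\<close>

lemma rotate_to_axis: "\<exists>t. act (rot t) (up (dist hi p)) = p"
proof -
  define z where "z = coord p"
  \<comment> \<open>A solution vector of that equation; it vanishes only for
    \<open>z = \<i>\<close>, where every angle works.\<close>
  define w where "w = Complex ((1 - (cmod z)\<^sup>2) / 2) (- Re z)"
  define t where "t = Arg w / 2"
  have w: "w = of_real (cmod w) * cis (2 * t)"
    by (simp add: t_def rcis_cmod_Arg flip: rcis_def)
  have "(cmod w) * (cos (2 * t) * Re z + (1 - (cmod z)\<^sup>2) / 2 * sin (2 * t)) = Re w * Re z + (1 - (cmod z)\<^sup>2) / 2 * Im w"
    by (subst (2 3) w) (simp add: algebra_simps)
  also have "\<dots> = 0"
    by (simp add: w_def)
  finally have "cmod w * (cos (2 * t) * Re z + (1 - (cmod z)\<^sup>2) / 2 * sin (2 * t)) = 0" .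
  moreover have "cos (2 * t) * Re z + (1 - (cmod z)\<^sup>2) / 2 * sin (2 * t) = 0" if "cmod w = 0"
    using that by (simp add: w_def complex_eq_iff)
  ultimately have 0: "cos (2 * t) * Re z + (1 - (cmod z)\<^sup>2) / 2 * sin (2 * t) = 0"
    by auto
  have "Re ((of_real (cos t) * z + of_real (sin t)) * cnj (denom (rot t) z)) = 0"
  proof -
    have "Re ((of_real (cos t) * z + of_real (sin t)) * cnj (denom (rot t) z))
       = cos (2 * t) * Re z + (1 - (cmod z)\<^sup>2) / 2 * sin (2 * t)"
      unfolding cmod_power2 cos_double sin_double
      by (simp add: denom_def power2_eq_square field_simps)
    then show ?thesis using 0 by simp
  qed
  then have "Re (mob (rot t) z) = 0"
    unfolding mob_def complex_div_cnj[of _ "denom (rot t) z"] by (simp add: Re_divide_of_real del: complex_cnj_add)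
  moreover have "Im (mob (rot t) z) > 0"
    by (simp add: Im_mob_pos z_def)
  ultimately have "act (rot t) p = up (ln (Im (mob (rot t) z)))"
    by (intro hplane_eqI) (simp add: coord_act complex_eq_iff flip: z_def)
  then obtain s where s: "act (rot t) p = up s" by blast
  then have p: "p = act (sinv (rot t)) (up s)"
    by (metis act_sinv(1))
  have sinv_rot: "sinv (rot t) = rot (- t)" for t
    by (rule sl2_eqI) auto
  have "dist (act (rot t) hi) (act (rot t) p) = dist hi p"
    by (rule dist_act)
  then have "dist hi p = \<bar>s\<bar>"
    using dist_up[of 0 s] by (simp add: s)
  then consider "dist hi p = s" | "dist hi p = - s" by linarith
  then show ?thesis
  proof cases
    case 1
    then show ?thesis using p sinv_rot by metis
  next
    \<comment> \<open>The image lies below \<open>\<i>\<close>; an additional half turn moves it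
      above.\<close>
    case 2
    have "act (rot (- t + pi / 2)) (up (- s)) = p"
      unfolding rot_add act_mult p sinv_rot by (simp add: act_rot_up)
    then show ?thesis using 2 by auto
  qed
qed

lemma frame_pair_exists: "\<exists>g. act g hi = p \<and> act g (up (dist p q)) = q"
proof -
  \<comment> \<open>Any unit tangent vector serves here, since \<open>rot t\<close> corrects the
    direction afterwards.\<close>
  have "unit_tangent p (of_real (Im (coord p)))"
    by (simp add: unit_tangent_def less_imp_neq[symmetric] abs_of_pos)
  then obtain h where h: "act h hi = p"
    using frame_exists by blast
  obtain t where t: "act (rot t) (up (dist hi (act (sinv h) q))) = act (sinv h) q"
    using rotate_to_axis by blast
  have "dist hi (act (sinv h) q) = dist p q"
    using dist_act[of h hi "act (sinv h) q"] h by simp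
  with t have "act h (act (rot t) (up (dist p q))) = q"
    by simp
  then show ?thesis
    using h by (intro exI[of _ "h * rot t"]) (simp add: act_mult)
qed

text \<open>Comparing the two formulas for the cosh of the distance gives the imaginary part, then
  either one gives the modulus; only the sign of the real part stays open.\<close>

lemma determined_up_to_reflection:
  assumes "dist (up a) p = dist (up a) q" "dist (up b) p = dist (up b) q" "a \<noteq> b"
  shows "q = p \<or> coord q = - cnj (coord p)"
proof -
  have *: "(exp a)\<^sup>2 / Im (coord p) + (cmod (coord p))\<^sup>2 / Im (coord p) = (exp a)\<^sup>2 / Im (coord q) + (cmod (coord q))\<^sup>2 / Im (coord q)"
    if "dist (up a) p = dist (up a) q" for a
  proof -
    have "2 * exp a * cosh_hdist (coord (up a)) (coord w) = ((exp a)\<^sup>2 + (cmod (coord w))\<^sup>2) / Im (coord w)" for w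
      unfolding coord_up by (subst cosh_hdist_axis) simp_all
    then show ?thesis
      using that unfolding dist_eq_iff add_divide_distrib[symmetric] by metis
  qed
  have "((exp a)\<^sup>2 - (exp b)\<^sup>2) / Im (coord p) = ((exp a)\<^sup>2 - (exp b)\<^sup>2) / Im (coord q)"
    using *[OF assms(1)] *[OF assms(2)] by (simp add: diff_divide_distrib)
  moreover have "(exp a)\<^sup>2 - (exp b)\<^sup>2 \<noteq> 0"
    using assms(3) by (metis power2_eq_imp_eq exp_ge_zero exp_inj_iff right_minus_eq)
  ultimately have Im: "Im (coord p) = Im (coord q)"
    by (simp add: less_imp_neq[symmetric] divide_eq_eq eq_divide_eq)
  then have "(cmod (coord p))\<^sup>2 = (cmod (coord q))\<^sup>2"
    using *[OF assms(1)] by (simp add: less_imp_neq[symmetric])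
  then have "(Re (coord p))\<^sup>2 = (Re (coord q))\<^sup>2"
    using Im by (simp add: cmod_power2)
  then have "Re (coord q) = Re (coord p) \<or> Re (coord q) = - Re (coord p)"
    by (metis power2_eq_iff)
  then show ?thesis
    using Im by (auto simp: complex_eq_iff intro: hplane_eqI)
qed

lemma up_unique:
  assumes "dist (up a) p = \<bar>a - t\<bar>" "dist (up b) p = \<bar>b - t\<bar>" "a \<noteq> b"
  shows "p = up t"
  using determined_up_to_reflection[of a "up t" p b] assms
  by (auto simp: dist_up intro: hplane_eqI)

text \<open>Each point is fixed or reflected in the imaginary axis. If some point off the axis is
  reflected, a fixed point has equal distance to it and its mirror image, so lies on the axis. Thus
  \<open>f\<close> is the reflection everywhere, which reverses orientation.\<close>

lemma isom_plus_fixing_two: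
  assumes f: "f \<in> carrier Isom_plus" "f hi = hi" "f (up b) = up b" "b \<noteq> 0"
  shows "f = id"
proof (rule ccontr)
  have dist: "dist (f p) (f q) = dist p q" for p q
    using f(1) by (auto simp: Isom_plus_def hisometry_def)
  have refl: "f p = p \<or> coord (f p) = - cnj (coord p)" for p
    using determined_up_to_reflection[of 0 p "f p" b] dist[of hi p] dist[of "up b" p] f by auto
  assume "f \<noteq> id"
  then obtain p where p: "f p \<noteq> p" by (auto simp: fun_eq_iff)
  then have fp: "coord (f p) = - cnj (coord p)" and Re_p: "Re (coord p) \<noteq> 0"
    using refl[of p] by (auto simp: complex_eq_iff intro!: hplane_eqI)
  have all: "coord (f q) = - cnj (coord q)" for q
  proof (cases "f q = q")
    case True
    have "cosh_hdist (- cnj (coord p)) (coord q) = cosh_hdist (coord p) (coord q)"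
      using dist[of p q] by (simp only: dist_eq_iff True fp)
    then have "(- Re (coord p) - Re (coord q))\<^sup>2 = (Re (coord p) - Re (coord q))\<^sup>2"
      by (simp add: cosh_hdist_def cmod_power2 less_imp_neq[symmetric])
    then have "Re (coord p) * Re (coord q) = 0"
      by (simp add: power2_eq_square algebra_simps)
    then show ?thesis
      using True Re_p by (simp add: complex_eq_iff)
  qed (use refl in blast)
  obtain D where D: "has_hderivative f D hi" "Im (cnj (D 1) * D \<i>) > 0"
    using f(1) by (auto simp: Isom_plus_def orientation_preserving_def)
  have "has_hderivative f (\<lambda>u. - cnj u) hi"
    unfolding has_hderivative_def
  proof (rule has_derivative_transform_within_open[OF _ open_coord_domain])
    show "((\<lambda>z. - cnj z) has_derivative (\<lambda>u. - cnj u)) (at (coord hi))"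
      by (intro derivative_intros bounded_linear_imp_has_derivative bounded_linear_cnj)
  qed (auto simp: all hpoint_inverse)
  with D(1) have "D = (\<lambda>u. - cnj u)"
    by (rule has_hderivative_unique)
  then show False
    using D(2) by simp
qed

lemma Isom_plus_comp: "f \<in> carrier Isom_plus \<Longrightarrow> g \<in> carrier Isom_plus \<Longrightarrow> f \<circ> g \<in> carrier Isom_plus"
  using monoid.m_closed[OF group.is_monoid[OF group_Isom_plus]] by (auto simp: Isom_plus_def)

lemma act_eq_of_two_points:
  assumes "act g hi = act h hi" "act g (up b) = act h (up b)" "b \<noteq> 0"
  shows "act g = act h"
proof -
  have "act (sinv h * g) = id"
    using assms by (intro isom_plus_fixing_two[OF act_carrier, of _ b]) (auto simp: act_mult)
  then have "act (h * (sinv h * g)) = act h"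
    by (subst act_mult) simp
  then show ?thesis by simp
qed

text \<open>Some Moebius map agrees with the isometry at \<open>hi\<close> and \<open>up 1\<close>,
  and \<open>isom_plus_fixing_two\<close> forces equality.\<close>

lemma Isom_plus_eq: "carrier Isom_plus = range act"
proof (intro equalityI subsetI)
  fix f assume f: "f \<in> carrier Isom_plus"
  have "dist (f hi) (f (up 1)) = 1"
    using f dist_up[of 0 1] by (auto simp: Isom_plus_def hisometry_def)
  then obtain g where g: "act g hi = f hi" "act g (up 1) = f (up 1)"
    using frame_pair_exists[of "f hi" "f (up 1)"] by auto
  have "act (sinv g) \<circ> f = id"
    by (rule isom_plus_fixing_two[of _ 1]) (auto simp: f Isom_plus_comp simp flip: g)
  then have "act g \<circ> (act (sinv g) \<circ> f) = act g"
    by simp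
  then have "f = act g"
    by (simp add: o_assoc flip: act_mult)
  then show "f \<in> range act" by blast
qed auto

lemma jac_eq: "act g = act h \<Longrightarrow> jac g p = jac h p"
  using has_hderivative_unique[OF has_hderivative_act[of g p]] has_hderivative_act[of h p]
  by (metis mult.right_neutral)

text \<open>The quotient fixes \<open>\<i>\<close> with derivative 1, so its denominator at
  \<open>\<i>\<close> is 1 or -1 and the matrix is plus or minus the identity.\<close>

lemma act_eq_of_jac_hi:
  assumes "act g hi = act h hi" "jac g hi = jac h hi"
  shows "act g = act h"
proof -
  define k where "k = sinv h * g"
  have k: "act k hi = hi" "jac k hi = 1"
    using assms jac_sinv[of h hi] by (auto simp: k_def act_mult jac_mult)
  from k(2) have "(denom k \<i>)\<^sup>2 = 1"
    by (simp add: jac_def)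
  then have "denom k \<i> = 1 \<or> denom k \<i> = - 1"
    by (simp add: power2_eq_1_iff)
  then have cd: "ec k = 0" "ed k = 1 \<or> ed k = - 1"
    by (auto simp: denom_def complex_eq_iff)
  moreover have "mob k \<i> = \<i>"
    using arg_cong[OF k(1), of coord] by (simp add: coord_act)
  ultimately have "eb k = 0" "ea k = ed k"
    using det1[of k] by (auto simp: mob_def denom_def complex_eq_iff)
  then have "act k = id"
    using cd by (auto intro!: hplane_eqI simp: coord_act mob_def denom_def fun_eq_iff)
  then have "act (h * k) = act h"
    by (subst act_mult) simp
  then show ?thesis by (simp add: k_def)
qed

lemma act_eq_of_jac:
  assumes "act g p = act h p" "jac g p = jac h p"
  shows "act g = act h"
proof -
  obtain k where k: "act k hi = p"
    using frame_pair_exists by blast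
  have "act (g * k) = act (h * k)"
    using assms by (intro act_eq_of_jac_hi) (auto simp: act_mult jac_mult k)
  then have "act (g * k * sinv k) = act (h * k * sinv k)"
    by (simp only: act_mult)
  then show ?thesis
    by (simp add: mult.assoc)
qed

section \<open>Geodesics, and explicit forms of the described isometries\<close>

lemma geodesic_from_up: "geodesic_from hi \<i> up"
  unfolding geodesic_from_def geodesic_line_def
  by (auto simp: dist_up has_vector_derivative_def scaleR_conv_of_real intro!: derivative_eq_intros)

lemma geodesic_from_act:
  assumes "geodesic_from p u \<gamma>"
  shows "geodesic_from (act g p) (jac g p * u) (act g \<circ> \<gamma>)"
proof -
  have \<gamma>: "((\<lambda>t. coord (\<gamma> t)) has_derivative (\<lambda>t. t *\<^sub>R u)) (at 0)" "\<gamma> 0 = p"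
    using assms by (auto simp: geodesic_from_def has_vector_derivative_def)
  from diff_chain_at[OF \<gamma>(1), of "\<lambda>z. coord (act g (hpoint z))" "\<lambda>u. jac g p * u"]
  have "((\<lambda>t. coord (act g (\<gamma> t))) has_derivative (\<lambda>t. jac g p * (t *\<^sub>R u))) (at 0)"
    using has_hderivative_act[of g p] \<gamma>(2) by (simp add: has_hderivative_def o_def coord_inverse)
  then show ?thesis
    using assms by (auto simp: geodesic_from_def geodesic_line_def has_vector_derivative_def)
qed

lemma geodesic_from_frame: "geodesic_from (act g hi) (jac g hi * \<i>) (act g \<circ> up)"
  using geodesic_from_act[OF geodesic_from_up] .

text \<open>Move \<open>\<gamma> 0\<close> and \<open>\<gamma> 1\<close> to the imaginary axis: the
  distances to these two points then determine every other point of the curve.\<close>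

lemma geodesic_from_obtain_frame:
  assumes "geodesic_from p u \<gamma>"
  obtains g where "act g hi = p" "jac g hi * \<i> = u" "\<gamma> = act g \<circ> up"
proof -
  have line: "dist (\<gamma> s) (\<gamma> t) = \<bar>s - t\<bar>" for s t
    using assms by (auto simp: geodesic_from_def geodesic_line_def)
  obtain g where g: "act g hi = \<gamma> 0" "act g (up 1) = \<gamma> 1"
    using frame_pair_exists[of "\<gamma> 0" "\<gamma> 1"] line[of 0 1] by auto
  have "act (sinv g) (\<gamma> t) = up t" for t
  proof (rule up_unique[of 0 _ _ 1])
    have "dist (act g (up s)) (act g (act (sinv g) (\<gamma> t))) = dist (up s) (act (sinv g) (\<gamma> t))" for s
      by (rule dist_act)
    from this[of 0] this[of 1]
    show "dist (up 0) (act (sinv g) (\<gamma> t)) = \<bar>0 - t\<bar>" "dist (up 1) (act (sinv g) (\<gamma> t)) = \<bar>1 - t\<bar>"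
      by (simp_all add: g line)
  qed auto
  then have \<gamma>: "\<gamma> = act g \<circ> up"
    by (metis act_sinv(2) comp_apply ext)
  have "geodesic_from (act g hi) (jac g hi * \<i>) \<gamma>"
    unfolding \<gamma> by (rule geodesic_from_frame)
  then have "u = jac g hi * \<i>"
    using assms vector_derivative_unique_at unfolding geodesic_from_def by blast
  then show thesis
    using that g(1) \<gamma> assms by (auto simp: geodesic_from_def)
qed

lemma geodesic_from_unique:
  assumes "geodesic_from p u \<gamma>" "geodesic_from p u \<gamma>'"
  shows "\<gamma> = \<gamma>'"
proof -
  obtain g where g: "act g hi = p" "jac g hi * \<i> = u" "\<gamma> = act g \<circ> up"
    using geodesic_from_obtain_frame[OF assms(1)] .
  obtain h where h: "act h hi = p" "jac h hi * \<i> = u" "\<gamma>' = act h \<circ> up"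
    using geodesic_from_obtain_frame[OF assms(2)] .
  have "act g = act h"
    using g h by (intro act_eq_of_jac_hi) (metis, metis mult_right_cancel complex_i_not_zero)
  then show ?thesis
    using g h by simp
qed

text \<open>The description is unique since a Moebius map is determined by its value and derivative
  at one point.\<close>

lemma clockwise_quarter_turn_eq:
  assumes "act g hi = p"
  shows "clockwise_quarter_turn p = act (g * rot (- pi / 4) * sinv g)"
proof -
  let ?k = "g * rot (- pi / 4) * sinv g"
  have k: "act ?k p = p" "jac ?k p = - \<i>"
    using jac_sinv[of g hi] by (auto simp: assms[symmetric] act_mult jac_mult jac_rot_hi)
  show ?thesis
    unfolding clockwise_quarter_turn_def
  proof (rule the_equality)
    show "act ?k \<in> carrier Isom_plus \<and> act ?k p = p \<and> has_hderivative (act ?k) (\<lambda>u. - \<i> * u) p"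
      using k has_hderivative_act[of ?k p] by simp
  next
    fix f assume f: "f \<in> carrier Isom_plus \<and> f p = p \<and> has_hderivative f (\<lambda>u. - \<i> * u) p"
    then obtain h where h: "f = act h"
      by (auto simp: Isom_plus_eq)
    have "(\<lambda>u. - \<i> * u) = (\<lambda>u. jac h p * u)"
      using f has_hderivative_act[of h p] has_hderivative_unique h by blast
    from fun_cong[OF this, of 1] have "jac h p = - \<i>"
      by simp
    then show "f = act ?k"
      unfolding h using f h k by (intro act_eq_of_jac[where p = p]) auto
  qed
qed

text \<open>The geodesic is unique, and two of its points determine the isometry.\<close>

lemma translation_eq:
  assumes "act g hi = p" "jac g hi * \<i> = u"
  shows "translation p u r = act (g * tr r * sinv g)"
proof -
  let ?k = "g * tr r * sinv g"
  have \<gamma>: "geodesic_from p u (act g \<circ> up)"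
    using geodesic_from_frame[of g] assms by simp
  show ?thesis
    unfolding translation_def
  proof (rule the_equality)
    have "\<forall>t. act ?k ((act g \<circ> up) t) = (act g \<circ> up) (t + r)"
      by (simp add: act_mult add.commute)
    then show "act ?k \<in> carrier Isom_plus \<and> (\<exists>\<gamma>. geodesic_from p u \<gamma> \<and> (\<forall>t. act ?k (\<gamma> t) = \<gamma> (t + r)))"
      using \<gamma> act_carrier by blast
  next
    fix f assume f: "f \<in> carrier Isom_plus \<and> (\<exists>\<gamma>. geodesic_from p u \<gamma> \<and> (\<forall>t. f (\<gamma> t) = \<gamma> (t + r)))"
    then obtain h where h: "f = act h"
      by (auto simp: Isom_plus_eq)
    have *: "act h (act g (up t)) = act g (up (t + r))" for t
      using f geodesic_from_unique[OF _ \<gamma>] by (metis comp_apply h)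
    have "act (h * g) = act (g * tr r)"
      using *[of 0] *[of 1]
      by (intro act_eq_of_two_points[of _ _ 1]) (simp_all add: act_mult add.commute flip: up_0)
    then have "act (h * g * sinv g) = act (g * tr r * sinv g)"
      by (simp only: act_mult)
    then show "f = act ?k"
      by (simp add: h mult.assoc)
  qed
qed

lemma direction_eq:
  assumes "act g hi = p" "act g (up t) = q" "t > 0"
  shows "direction p q = jac g hi * \<i>"
proof -
  have d: "dist p q = t"
    using assms dist_act[of g hi "up t"] dist_up[of 0 t] by auto
  show ?thesis
    unfolding direction_def d
  proof (rule the_equality)
    show "\<exists>\<gamma>. geodesic_from p (jac g hi * \<i>) \<gamma> \<and> \<gamma> t = q"
      using geodesic_from_frame[of g] assms by (intro exI[of _ "act g \<circ> up"]) auto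
  next
    fix u assume "\<exists>\<gamma>. geodesic_from p u \<gamma> \<and> \<gamma> t = q"
    then obtain \<gamma> where \<gamma>: "geodesic_from p u \<gamma>" "\<gamma> t = q" by blast
    obtain h where h: "act h hi = p" "jac h hi * \<i> = u" "\<gamma> = act h \<circ> up"
      using geodesic_from_obtain_frame[OF \<gamma>(1)] .
    have "act h = act g"
      using h assms \<gamma>(2) by (intro act_eq_of_two_points[of _ _ t]) auto
    then show "u = jac g hi * \<i>"
      using jac_eq h(2) by metis
  qed
qed

section \<open>Topology of the isometry group\<close>

lemma continuous_coord: "continuous_on UNIV coord"
  unfolding continuous_on_iff
proof (intro ballI allI impI)
  fix p :: hplane and e :: real
  assume e: "e > 0"
  define y where "y = Im (coord p)"
  have y: "y > 0" by (simp add: y_def)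
  \<comment> \<open>\<open>cosh_hdist\<close> from \<open>p\<close> to the point at height
    \<open>y + e\<close> straight above it, the hyperbolically closest point of the Euclidean circle
    of radius \<open>e\<close> about \<open>p\<close>.\<close>
  define K where "K = 1 + e\<^sup>2 / (2 * y * (y + e))"
  have K: "K > 1" using y e by (simp add: K_def)
  show "\<exists>d>0. \<forall>q\<in>UNIV. dist q p < d \<longrightarrow> dist (coord q) (coord p) < e"
  proof (intro exI[of _ "arcosh K"] conjI ballI impI)
    show "arcosh K > 0" using K by simp
    fix q assume "dist q p < arcosh K"
    then have "cosh (dist q p) < K"
      using K cosh_real_strict_mono[of "dist q p" "arcosh K"] by simp
    define \<delta> where "\<delta> = cmod (coord q - coord p)"
    have "\<delta>\<^sup>2 / (2 * Im (coord q) * y) < e\<^sup>2 / (2 * y * (y + e))"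
      using \<open>cosh (dist q p) < K\<close> by (simp add: cosh_dist cosh_hdist_def K_def \<delta>_def y_def)
    then have "\<delta>\<^sup>2 / (2 * Im (coord q) * y) * (2 * y * Im (coord q) * (y + e))
        < e\<^sup>2 / (2 * y * (y + e)) * (2 * y * Im (coord q) * (y + e))"
      using y e by (intro mult_strict_right_mono) auto
    then have 1: "\<delta>\<^sup>2 * (y + e) < e\<^sup>2 * Im (coord q)"
      using y e by (simp add: less_imp_neq[symmetric])
    have "Im (coord q) \<le> y + \<delta>"
      using abs_Im_le_cmod[of "coord q - coord p"] by (simp add: \<delta>_def y_def)
    then have "e\<^sup>2 * Im (coord q) \<le> e\<^sup>2 * (y + \<delta>)"
      by (intro mult_left_mono) auto
    with 1 have 2: "\<delta>\<^sup>2 * (y + e) < e\<^sup>2 * (y + \<delta>)" by linarith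
    have "\<delta> < e"
    proof (rule ccontr)
      assume "\<not> \<delta> < e"
      then have "e * e * y \<le> \<delta> * \<delta> * y" "(e * \<delta>) * e \<le> (e * \<delta>) * \<delta>"
        using e y by (auto intro!: mult_mono mult_left_mono)
      then show False
        using 2 by (simp add: power2_eq_square algebra_simps)
    qed
    then show "dist (coord q) (coord p) < e"
      by (simp add: \<delta>_def dist_norm)
  qed
qed

lemma tendsto_hplane:
  assumes "((\<lambda>n. coord (f n)) \<longlongrightarrow> coord l) F"
  shows "(f \<longlongrightarrow> l) F"
proof -
  have "((\<lambda>n. cosh_hdist (coord (f n)) (coord l)) \<longlongrightarrow> 1 + (cmod (coord l - coord l))\<^sup>2 / (2 * Im (coord l) * Im (coord l))) F"
    unfolding cosh_hdist_def by (intro tendsto_intros assms) (simp add: less_imp_neq[symmetric])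
  then have "((\<lambda>n. cosh_hdist (coord (f n)) (coord l)) \<longlongrightarrow> 1) F"
    by simp
  then have "((\<lambda>n. dist (f n) l) \<longlongrightarrow> arcosh 1) F"
    unfolding dist_hplane_def
    by (intro tendsto_arcosh_strong) (auto intro!: always_eventually cosh_hdist_ge_1)
  then show ?thesis
    by (subst tendsto_dist_iff) simp
qed

lemma tendsto_funI:
  fixes f :: "'c \<Rightarrow> 'a \<Rightarrow> 'b::topological_space"
  assumes "\<And>x. ((\<lambda>n. f n x) \<longlongrightarrow> l x) F"
  shows "(f \<longlongrightarrow> l) F"
proof -
  have "limitin (product_topology (\<lambda>i. euclidean) UNIV) f l F"
    by (simp add: limitin_componentwise assms)
  then show ?thesis
    by (simp add: euclidean_product_topology)
qed

lemma tendsto_act: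
  assumes "((\<lambda>n. ea (k n)) \<longlongrightarrow> ea l) F" "((\<lambda>n. eb (k n)) \<longlongrightarrow> eb l) F"
    "((\<lambda>n. ec (k n)) \<longlongrightarrow> ec l) F" "((\<lambda>n. ed (k n)) \<longlongrightarrow> ed l) F"
  shows "((\<lambda>n. act (k n)) \<longlongrightarrow> act l) F"
proof (intro tendsto_funI tendsto_hplane)
  fix p
  show "((\<lambda>n. coord (act (k n) p)) \<longlongrightarrow> coord (act l p)) F"
    unfolding coord_act mob_def denom_def
    by (intro tendsto_intros assms) (use denom_nonzero[of "coord p" l] in \<open>simp add: denom_def\<close>)
qed

lemma continuous_act: "continuous_on UNIV (act g)"
  unfolding continuous_on_iff by (metis dist_act)

lemma inv_Isom_plus_act: "inv\<^bsub>Isom_plus\<^esub> (act g) = act (sinv g)"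
  by (rule group.inv_equality[OF group_Isom_plus]) (auto simp: Isom_plus_def orientation_preserving_act hisometry_act simp flip: act_mult)

lemma mult_Isom_plus [simp]: "f \<otimes>\<^bsub>Isom_plus\<^esub> g = f \<circ> g"
  by (simp add: Isom_plus_def)

lemma one_Isom_plus [simp]: "\<one>\<^bsub>Isom_plus\<^esub> = id"
  by (simp add: Isom_plus_def)

section \<open>The generated group seen from a frame at the base point\<close>

text \<open>The preimage of \<open>G\<close> in SL(2,R), conjugated by \<open>g\<close> so that the base point becomes \<open>\<i>\<close>.\<close>

definition frame_group :: "hplane \<Rightarrow> complex \<Rightarrow> real \<Rightarrow> sl2 \<Rightarrow> sl2 set" where
  "frame_group p u r g = {k. act (g * k * sinv g) \<in> G p u r}"

context
  fixes p :: hplane and u :: complex and r :: real and g :: sl2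
  assumes g: "act g hi = p" "jac g hi * \<i> = u"
begin

lemma G_eq: "G p u r = generate Isom_plus {act (g * rot (- pi / 4) * sinv g), act (g * tr r * sinv g)}"
  unfolding G_def clockwise_quarter_turn_eq[OF g(1)] translation_eq[OF g] ..

lemma G_subset: "G p u r \<subseteq> carrier Isom_plus"
  unfolding G_eq by (rule group.generate_in_carrier[OF group_Isom_plus, THEN subsetI]) auto

lemma subgroup_G: "subgroup (G p u r) Isom_plus"
  unfolding G_eq by (rule group.generate_is_subgroup[OF group_Isom_plus]) auto

lemma G_eq_frame_group: "G p u r = (\<lambda>k. act (g * k * sinv g)) ` frame_group p u r g"
proof (intro equalityI subsetI)
  fix f assume f: "f \<in> G p u r"
  then obtain h where h: "f = act h"
    using G_subset by (auto simp: Isom_plus_eq)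
  have "g * (sinv g * h * g) * sinv g = h"
    by (simp add: mult.assoc)
  then show "f \<in> (\<lambda>k. act (g * k * sinv g)) ` frame_group p u r g"
    using f h by (intro image_eqI[of _ _ "sinv g * h * g"]) (auto simp: frame_group_def)
qed (auto simp: frame_group_def)

lemma frame_group_gens: "rot (- pi / 4) \<in> frame_group p u r g" "tr r \<in> frame_group p u r g"
  unfolding frame_group_def G_eq by (auto intro: generate.incl)

lemma frame_group_one: "1 \<in> frame_group p u r g"
  using subgroup.one_closed[OF subgroup_G] by (simp add: frame_group_def)

lemma frame_group_mult: "h \<in> frame_group p u r g \<Longrightarrow> k \<in> frame_group p u r g \<Longrightarrow> h * k \<in> frame_group p u r g"
proof -
  assume "h \<in> frame_group p u r g" "k \<in> frame_group p u r g"
  then have "act (g * h * sinv g) \<circ> act (g * k * sinv g) \<in> G p u r"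
    using subgroup.m_closed[OF subgroup_G] by (auto simp: frame_group_def)
  then show ?thesis
    by (simp add: frame_group_def mult.assoc flip: act_mult)
qed

lemma frame_group_sinv: "h \<in> frame_group p u r g \<Longrightarrow> sinv h \<in> frame_group p u r g"
proof -
  assume "h \<in> frame_group p u r g"
  then have "act (sinv (g * h * sinv g)) \<in> G p u r"
    using subgroup.m_inv_closed[OF subgroup_G] by (fastforce simp: frame_group_def inv_Isom_plus_act)
  then show ?thesis
    by (simp add: frame_group_def sinv_mult mult.assoc)
qed

text \<open>Evaluation at one point is continuous for pointwise convergence, so whether a map sends
  \<open>act g q\<close> into a translate of \<open>U\<close> is an open condition that isolates
  each element.\<close>

lemma discrete_G_of_free_open_set:
  assumes U: "open U" "q \<in> U" and free: "\<And>k. k \<in> frame_group p u r g \<Longrightarrow> act k q \<in> U \<Longrightarrow> act k = id"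
  shows "discrete (G p u r)"
proof (rule discreteI)
  fix f assume "f \<in> G p u r"
  then obtain k where k: "k \<in> frame_group p u r g" "f = act (g * k * sinv g)"
    by (auto simp: G_eq_frame_group)
  define V where "V = {h. act (sinv (g * k)) (h (act g q)) \<in> U}"
  have "continuous_on UNIV (\<lambda>h. act (sinv (g * k)) (h (act g q)))"
    by (intro continuous_on_compose2[OF continuous_act] continuous_on_product_coordinates) auto
  then have V: "open V"
    using open_vimage[OF U(1)] by (fastforce simp: V_def vimage_def)
  have "V \<inter> G p u r = {f}"
  proof (intro equalityI subsetI)
    fix h assume h: "h \<in> V \<inter> G p u r"
    then obtain l where l: "l \<in> frame_group p u r g" "h = act (g * l * sinv g)"
      by (auto simp: G_eq_frame_group)
    have "act (sinv k * l) q \<in> U"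
      using h by (simp add: V_def l(2) act_act sinv_mult mult.assoc)
    then have "act (sinv k * l) = id"
      using free frame_group_mult frame_group_sinv k l by blast
    then have "act (g * k * (sinv k * l) * sinv g) = act (g * k * sinv g)"
      by (simp only: act_mult) simp
    then show "h \<in> {f}"
      by (simp add: k(2) l(2) mult.assoc)
  next
    fix h assume "h \<in> {f}"
    then show "h \<in> V \<inter> G p u r"
      using U(2) k \<open>f \<in> G p u r\<close> by (auto simp: V_def act_act sinv_mult mult.assoc)
  qed
  then show "f isolated_in G p u r"
    using V \<open>f \<in> G p u r\<close> unfolding isolated_in_def by blast
qed

text \<open>Short translations converge to \<open>id\<close>, so a dense group has elements near
  \<open>id\<close> that move \<open>hi\<close>.\<close>

lemma not_discrete_of_dense:
  assumes "carrier Isom_plus \<subseteq> closure (G p u r)"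
  shows "\<not> discrete (G p u r)"
proof
  assume "discrete (G p u r)"
  moreover have "id \<in> G p u r"
    using subgroup.one_closed[OF subgroup_G] by simp
  ultimately have "id isolated_in G p u r"
    by (rule discreteD)
  then obtain U where U: "open U" "U \<inter> G p u r = {id}"
    by (auto simp: isolated_in_def)
  \<comment> \<open>Removing the maps that fix \<open>hi\<close> excludes \<open>id\<close> but
    keeps the set open.\<close>
  define V where "V = U \<inter> (\<lambda>f. f hi) -` (- {hi})"
  have "open ((\<lambda>f::hplane \<Rightarrow> hplane. f hi) -` (- {hi}))"
    by (intro open_vimage continuous_on_product_coordinates) auto
  then have V: "open V"
    using U(1) by (auto simp: V_def)
  have lim: "(\<lambda>n. act (tr (1 / real (Suc n)))) \<longlonglongrightarrow> act 1"
  proof (rule tendsto_act)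
    have "(\<lambda>n. exp (1 / real (Suc n) / 2)) \<longlonglongrightarrow> exp (0 / 2)" "(\<lambda>n. exp (- (1 / real (Suc n)) / 2)) \<longlonglongrightarrow> exp (- 0 / 2)"
      by (intro tendsto_intros LIMSEQ_Suc lim_1_over_n; simp)+
    then show "(\<lambda>n. ea (tr (1 / real (Suc n)))) \<longlonglongrightarrow> ea 1" "(\<lambda>n. ed (tr (1 / real (Suc n)))) \<longlonglongrightarrow> ed 1"
      by simp_all
  qed auto
  have "id \<in> U" using U(2) by auto
  then have "\<forall>\<^sub>F n in sequentially. act (tr (1 / real (Suc n))) \<in> U"
    using topological_tendstoD[OF lim U(1)] by simp
  then obtain n where n: "act (tr (1 / real (Suc n))) \<in> U"
    by (auto simp: eventually_sequentially)
  have "act (tr (1 / real (Suc n))) hi \<noteq> hi"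
    using dist_up[of "1 / real (Suc n)" 0] by (auto simp flip: up_def)
  then have "act (tr (1 / real (Suc n))) \<in> V \<inter> closure (G p u r)"
    using n assms act_carrier by (auto simp: V_def)
  then obtain f where "f \<in> V" "f \<in> G p u r"
    using open_Int_closure_eq_empty[OF V, of "G p u r"] by blast
  then have "f = id" "f hi \<noteq> hi"
    using U(2) by (auto simp: V_def)
  then show False by simp
qed

end

section \<open>The mirrors of a right-angled side\<close>

datatype mirror = Side | Diag | Bisector

text \<open>\<open>Diag\<close> is the inversion in the circle of radius \<open>sqrt 2\<close> about
  1, \<open>Bisector\<close> the one in the circle of radius \<open>exp (r / 2)\<close> about
  0.\<close>

fun mirror_map :: "real \<Rightarrow> mirror \<Rightarrow> complex \<Rightarrow> complex" where
  "mirror_map r Side z = - cnj z"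
| "mirror_map r Diag z = (cnj z + 1) / (cnj z - 1)"
| "mirror_map r Bisector z = of_real (exp r) / cnj z"

definition hrefl :: "real \<Rightarrow> mirror \<Rightarrow> hplane \<Rightarrow> hplane" where
  "hrefl r i p = hpoint (mirror_map r i (coord p))"

text \<open>Linear forms on the hyperboloid, normalised to norm 1; \<open>Side\<close> is the imaginary axis, \<open>Diag\<close> the line
  through \<open>\<i>\<close> at the angle \<open>pi/4\<close> to it, and \<open>Bisector\<close> the perpendicular bisector of the points \<open>\<i>\<close> and
  \<open>exp r * \<i>\<close>.\<close>

fun height :: "real \<Rightarrow> mirror \<Rightarrow> hplane \<Rightarrow> real" where
  "height r Side p = Re (coord p) / Im (coord p)"
| "height r Diag p = ((cmod (coord p))\<^sup>2 - 1 - 2 * Re (coord p)) / (2 * sqrt 2 * Im (coord p))"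
| "height r Bisector p = (exp r - (cmod (coord p))\<^sup>2) / (2 * exp (r / 2) * Im (coord p))"

lemma mirror_map_parts:
  assumes z: "Im z > 0"
  defines "N \<equiv> (cmod z)\<^sup>2"
  defines "D \<equiv> N + 1 - 2 * Re z"
  shows "N > 0" "D > 0"
    "Re (mirror_map r Diag z) = (N - 1) / D" "Im (mirror_map r Diag z) = 2 * Im z / D" "(cmod (mirror_map r Diag z))\<^sup>2 = (N + 1 + 2 * Re z) / D"
    "Re (mirror_map r Bisector z) = exp r * Re z / N" "Im (mirror_map r Bisector z) = exp r * Im z / N"
    "(cmod (mirror_map r Bisector z))\<^sup>2 = (exp r)\<^sup>2 / N"
proof -
  have z0: "z \<noteq> 0" "z \<noteq> 1" using z by auto
  then show "N > 0" by (simp add: N_def)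
  have D: "D = (cmod (cnj z - 1))\<^sup>2"
    by (simp only: D_def N_def cmod_power2) (simp add: power2_eq_square algebra_simps)
  have "cnj z - 1 \<noteq> 0"
    using z by (auto simp: complex_eq_iff)
  then show "D > 0"
    unfolding D by simp
  have "mirror_map r Diag z = ((cnj z + 1) * cnj (cnj z - 1)) / of_real D"
    unfolding D mirror_map.simps by (rule complex_div_cnj)
  then have "Re (mirror_map r Diag z) = Re ((cnj z + 1) * cnj (cnj z - 1)) / D" "Im (mirror_map r Diag z) = Im ((cnj z + 1) * cnj (cnj z - 1)) / D"
    by (simp_all only: Re_divide_of_real Im_divide_of_real)
  then show "Re (mirror_map r Diag z) = (N - 1) / D" "Im (mirror_map r Diag z) = 2 * Im z / D"
    unfolding N_def cmod_power2 by (simp_all add: power2_eq_square algebra_simps)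
  show "(cmod (mirror_map r Diag z))\<^sup>2 = (N + 1 + 2 * Re z) / D"
    unfolding D mirror_map.simps norm_divide power_divide N_def cmod_power2
    by (simp add: power2_eq_square algebra_simps)
  have "mirror_map r Bisector z = (of_real (exp r) * cnj (cnj z)) / of_real ((cmod (cnj z))\<^sup>2)"
    unfolding mirror_map.simps by (rule complex_div_cnj)
  then have b: "mirror_map r Bisector z = (of_real (exp r) * z) / of_real N"
    by (simp only: complex_cnj_cnj complex_mod_cnj N_def)
  show "Re (mirror_map r Bisector z) = exp r * Re z / N" "Im (mirror_map r Bisector z) = exp r * Im z / N"
    unfolding b Re_divide_of_real Im_divide_of_real by simp_all
  show "(cmod (mirror_map r Bisector z))\<^sup>2 = (exp r)\<^sup>2 / N"
    using z0 by (simp add: norm_divide power_divide N_def)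
qed

lemma coord_hrefl: "coord (hrefl r i p) = mirror_map r i (coord p)"
proof -
  have "Im (mirror_map r i (coord p)) > 0"
  proof (cases i)
    case Diag
    then show ?thesis
      using mirror_map_parts(2)[of "coord p"] mirror_map_parts(4)[of "coord p" r] by (simp del: mirror_map.simps)
  next
    case Bisector
    then show ?thesis
      using mirror_map_parts(1)[of "coord p"] mirror_map_parts(7)[of "coord p" r] by (simp del: mirror_map.simps)
  qed simp
  then show ?thesis
    by (simp add: hrefl_def hpoint_inverse)
qed

text \<open>The cosine of the angle between two mirrors, or the cosh of their distance if they are
  disjoint. The last clause includes the right angle between \<open>Side\<close> and
  \<open>Bisector\<close>.\<close>

fun gram_coeff :: "real \<Rightarrow> mirror \<Rightarrow> mirror \<Rightarrow> real" where
  "gram_coeff r Side Diag = cos (pi / 4)"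
| "gram_coeff r Diag Side = cos (pi / 4)"
| "gram_coeff r Diag Bisector = cosh (r / 2) / sqrt 2"
| "gram_coeff r Bisector Diag = cosh (r / 2) / sqrt 2"
| "gram_coeff r _ _ = 0"

fun coxeter :: "nat \<Rightarrow> mirror \<Rightarrow> mirror \<Rightarrow> nat" where
  "coxeter n Side Diag = 4"
| "coxeter n Diag Side = 4"
| "coxeter n Diag Bisector = n"
| "coxeter n Bisector Diag = n"
| "coxeter n _ _ = 2"

text \<open>The heights are linear in \<open>1 / y\<close>, \<open>x / y\<close> and
  \<open>N / y\<close>, coordinates on the hyperboloid, so the reflection laws become rational
  identities.\<close>

lemma mirrors_refl:
  assumes "r > 0" and n: "n \<ge> 2 \<and> cosh (r / 2) / sqrt 2 = cos (pi / real n) \<or> n = 0 \<and> cosh (r / 2) / sqrt 2 \<ge> 1"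
  shows "mirrors (hrefl r) (height r) (gram_coeff r) (coxeter n)"
proof
  define E where "E = exp (r / 2)"
  have E: "E > 1" "exp r = E\<^sup>2" "cosh (r / 2) = (E + 1 / E) / 2"
    using assms by (auto simp: E_def power2_eq_square cosh_def exp_minus field_simps simp flip: exp_add)
  fix p :: hplane and i j :: mirror
  define x y N D where "x = Re (coord p)" and "y = Im (coord p)" and "N = (cmod (coord p))\<^sup>2" and "D = N + 1 - 2 * x"
  have y: "y > 0" by (simp add: y_def)
  note parts = mirror_map_parts(1,2)[OF Im_coord_pos[of p], folded x_def y_def N_def, folded D_def]
    mirror_map_parts(3-8)[OF Im_coord_pos[of p], of r, folded x_def y_def N_def, folded D_def]
  have sq2: "sqrt 2 * sqrt 2 = (2::real)" by simp
  have c4: "cos (pi / 4) = 1 / sqrt (2::real)"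
    by (simp add: cos_45 real_div_sqrt divide_eq_eq eq_divide_eq)
  have hS: "height r Side p = x / y" "height r Diag p = (N - 1 - 2 * x) / (2 * sqrt 2 * y)"
    "height r Bisector p = (E\<^sup>2 - N) / (2 * E * y)"
    by (simp_all only: height.simps E(2) E_def x_def y_def N_def)
  have hSide: "height r Side (hrefl r Side p) = - x / y" "height r Diag (hrefl r Side p) = (N - 1 + 2 * x) / (2 * sqrt 2 * y)"
    "height r Bisector (hrefl r Side p) = (E\<^sup>2 - N) / (2 * E * y)"
    by (simp_all only: height.simps coord_hrefl mirror_map.simps E(2) E_def x_def y_def N_def) simp_all
  have hDiag: "height r Side (hrefl r Diag p) = (N - 1) / (2 * y)" "height r Diag (hrefl r Diag p) = - (N - 1 - 2 * x) / (2 * sqrt 2 * y)"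
    "height r Bisector (hrefl r Diag p) = (E\<^sup>2 * D - (N + 1 + 2 * x)) / (4 * E * y)"
    unfolding height.simps coord_hrefl parts E(2) E_def[symmetric] using y parts(1,2) E(1)
    by (simp_all add: field_simps) (simp add: D_def algebra_simps)
  have hBis: "height r Side (hrefl r Bisector p) = x / y" "height r Diag (hrefl r Bisector p) = (E^4 - N - 2 * E\<^sup>2 * x) / (2 * sqrt 2 * E\<^sup>2 * y)"
    "height r Bisector (hrefl r Bisector p) = - (E\<^sup>2 - N) / (2 * E * y)"
    unfolding height.simps coord_hrefl parts E(2) E_def[symmetric] using y parts(1,2) E(1)
    by (simp_all add: field_simps power2_eq_square eval_nat_numeral)
  show "height r i (hrefl r i p) = - height r i p"
    by (cases i) (simp_all only: hS hSide hDiag hBis minus_divide_left)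
  show "i \<noteq> j \<Longrightarrow> height r j (hrefl r i p) = height r j p + 2 * gram_coeff r i j * height r i p"
    using y E(1)
    by (cases i; cases j; simp only: hS hSide hDiag hBis gram_coeff.simps c4 E(3))
       (simp_all add: D_def sq2 field_simps power2_eq_square eval_nat_numeral)
  show "gram_coeff r i j = gram_coeff r j i"
    by (cases i; cases j) auto
  show "i \<noteq> j \<Longrightarrow> coxeter n i j \<ge> 2 \<and> gram_coeff r i j = cos (pi / real (coxeter n i j)) \<or> coxeter n i j = 0 \<and> gram_coeff r i j \<ge> 1"
    using n by (cases i; cases j) auto
  fix q
  assume eq: "\<And>i. height r i p = height r i q"
  define x' y' N' where "x' = Re (coord q)" and "y' = Im (coord q)" and "N' = (cmod (coord q))\<^sup>2"
  have y': "y' > 0" by (simp add: y'_def)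
  have hS': "height r Side q = x' / y'" "height r Diag q = (N' - 1 - 2 * x') / (2 * sqrt 2 * y')"
    "height r Bisector q = (E\<^sup>2 - N') / (2 * E * y')"
    by (simp_all only: height.simps E(2) E_def x'_def y'_def N'_def)
  have 1: "x / y = x' / y'"
    using eq[of Side] by (simp only: hS hS')
  have "(2 * sqrt 2) * ((N - 1 - 2 * x) / (2 * sqrt 2 * y)) = (2 * sqrt 2) * ((N' - 1 - 2 * x') / (2 * sqrt 2 * y'))"
    using eq[of Diag] by (simp only: hS hS')
  then have 2: "(N - 1 - 2 * x) / y = (N' - 1 - 2 * x') / y'"
    by simp
  have "(2 * E) * ((E\<^sup>2 - N) / (2 * E * y)) = (2 * E) * ((E\<^sup>2 - N') / (2 * E * y'))"
    using eq[of Bisector] by (simp only: hS hS')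
  then have 3: "(E\<^sup>2 - N) / y = (E\<^sup>2 - N') / y'"
    using E(1) by simp
  \<comment> \<open>The combination of the three heights in which \<open>N\<close> and
    \<open>x\<close> cancel; it determines \<open>y\<close> because \<open>E > 1\<close>.\<close>
  have "(E\<^sup>2 - 1) / y = (N - 1 - 2 * x) / y + (E\<^sup>2 - N) / y + 2 * (x / y)"
    by (simp add: diff_divide_distrib)
  also have "\<dots> = (E\<^sup>2 - 1) / y'"
    unfolding 1 2 3 by (simp add: diff_divide_distrib)
  finally have "y = y'"
    using y y' E(1) by (simp add: frac_eq_eq power2_eq_1_iff)
  with 1 y have "x = x'" by simp
  then show "p = q"
    using \<open>y = y'\<close> by (intro hplane_eqI) (simp add: complex_eq_iff x_def y_def x'_def y'_def)
qed

text \<open>The product of reflections in two lines through \<open>\<i>\<close> at the angle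
  \<open>pi / 4\<close> is a quarter turn.\<close>

lemma act_rot_eq_refl: "act (rot (- pi / 4)) p = hrefl r Diag (hrefl r Side p)"
proof (rule hplane_eqI)
  define s :: complex where "s = of_real (cos (pi / 4))"
  have s: "s \<noteq> 0" "of_real (sin (pi / 4)) = s" by (simp_all add: s_def cos_45 sin_45)
  have "coord (act (rot (- pi / 4)) p) = (s * (coord p - 1)) / (s * (coord p + 1))"
    by (simp add: coord_act mob_def denom_def s(2) algebra_simps flip: s_def)
  also have "\<dots> = (coord p - 1) / (coord p + 1)"
    using s by simp
  also have "\<dots> = coord (hrefl r Diag (hrefl r Side p))"
  proof -
    have "(coord p - 1) / (coord p + 1) = (- (coord p - 1)) / (- (coord p + 1))"
      by (rule minus_divide_divide[symmetric])
    then show ?thesis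
      by (simp add: coord_hrefl)
  qed
  finally show "coord (act (rot (- pi / 4)) p) = coord (hrefl r Diag (hrefl r Side p))" .
qed

text \<open>Conjugating \<open>Side\<close> by \<open>Diag\<close> gives the reflection in the unit
  circle, the perpendicular to the axis at \<open>\<i>\<close>. Its distance to
  \<open>Bisector\<close> is \<open>r / 2\<close>, so the product translates by
  \<open>r\<close>.\<close>

lemma act_tr_eq_refl: "act (tr r) p = hrefl r Bisector (hrefl r Diag (hrefl r Side (hrefl r Diag p)))"
proof (rule hplane_eqI)
  define w where "w = cnj (coord p)"
  have w: "Im w < 0" by (simp add: w_def)
  then have w1: "w - 1 \<noteq> 0" "w \<noteq> 0" by (auto simp: complex_eq_iff)
  have "coord (hrefl r Diag (hrefl r Side (hrefl r Diag p))) = (- ((w + 1) / (w - 1)) + 1) / (- ((w + 1) / (w - 1)) - 1)"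
    by (simp add: coord_hrefl w_def)
  also have "\<dots> = 1 / w"
    using w1 by (simp add: divide_simps)
  finally show "coord (act (tr r) p) = coord (hrefl r Bisector (hrefl r Diag (hrefl r Side (hrefl r Diag p))))"
    by (simp add: coord_act_tr coord_hrefl[of r Bisector] w_def)
qed

section \<open>Discreteness and density\<close>

context mirrors
begin

lemma word_rev: "word (rev us) (word us x) = x"
  by (induction us arbitrary: x) (auto simp: word_append)

lemma range_word_comp: "v \<in> range word \<Longrightarrow> w \<in> range word \<Longrightarrow> v \<circ> w \<in> range word"
  using len_comp(1) by blast

lemma range_word_left_inverse:
  assumes "w \<in> range word" "\<And>x. w (v x) = x"
  shows "v \<in> range word"
proof -
  obtain us where us: "w = word us" using assms(1) by blast
  have "v x = word (rev us) x" for x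
    using word_rev[of us "v x"] assms(2)[of x] us by simp
  then show ?thesis by blast
qed

end

lemma continuous_height: "continuous_on UNIV (height r i)"
proof (cases i)
  case Side
  have "continuous_on UNIV (\<lambda>p. Re (coord p) / Im (coord p))"
    by (intro continuous_intros continuous_coord) (simp add: less_imp_neq[symmetric])
  then show ?thesis by (simp add: Side)
next
  case Diag
  have "continuous_on UNIV (\<lambda>p. ((cmod (coord p))\<^sup>2 - 1 - 2 * Re (coord p)) / (2 * sqrt 2 * Im (coord p)))"
    by (intro continuous_intros continuous_coord) (simp add: less_imp_neq[symmetric])
  then show ?thesis by (simp add: Diag)
next
  case Bisector
  have "continuous_on UNIV (\<lambda>p. (exp r - (cmod (coord p))\<^sup>2) / (2 * exp (r / 2) * Im (coord p)))"
    by (intro continuous_intros continuous_coord) (simp add: less_imp_neq[symmetric])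
  then show ?thesis by (simp add: Bisector)
qed

lemma chamber_point:
  assumes "r > 0"
  shows "\<exists>p. \<forall>i. height r i p > 0"
proof -
  \<comment> \<open>The three conditions are \<open>x > 0\<close>, \<open>N > 1 + 2 * x\<close> and
    \<open>N < exp r\<close>. So \<open>N\<close> is taken halfway between 1 and
    \<open>exp r\<close>, and \<open>x\<close> small against their difference and against
    \<open>N\<close>.\<close>
  define x where "x = min 1 (exp r - 1) / 8"
  define N where "N = (1 + exp r) / 2"
  have x: "0 < x" "x \<le> 1 / 8" "8 * x \<le> exp r - 1"
    using assms by (auto simp: x_def)
  have "x * x \<le> 1 * 1"
    using x by (intro mult_mono) auto
  moreover have "exp r > 1"
    using assms by simp
  ultimately have "N - x\<^sup>2 > 0"
    unfolding N_def power2_eq_square by argo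
  define p where "p = hpoint (Complex x (sqrt (N - x\<^sup>2)))"
  have p: "coord p = Complex x (sqrt (N - x\<^sup>2))"
    using \<open>N - x\<^sup>2 > 0\<close> by (simp add: p_def hpoint_inverse)
  have N: "(cmod (coord p))\<^sup>2 = N"
    using \<open>N - x\<^sup>2 > 0\<close> by (simp add: p cmod_power2)
  have "height r i p > 0" for i
    using x assms \<open>N - x\<^sup>2 > 0\<close>
    by (cases i; simp add: N del: power2_less_0) (simp_all add: p N_def)
  then show ?thesis by blast
qed

text \<open>In the frame the generators are words in the three reflections, so
  \<open>chamber_free\<close> applies with the chamber as the open set.\<close>

lemma discrete_of_angle:
  assumes g: "act g hi = p" "jac g hi * \<i> = u" and "r > 0"
    and n: "n \<ge> 2 \<and> cosh (r / 2) / sqrt 2 = cos (pi / real n) \<or> n = 0 \<and> cosh (r / 2) / sqrt 2 \<ge> 1"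
  shows "discrete (G p u r)"
proof -
  interpret M: mirrors "hrefl r" "height r" "gram_coeff r" "coxeter n"
    using assms(3) n by (rule mirrors_refl)
  have gens: "act (rot (- pi / 4)) \<in> range M.word" "act (tr r) \<in> range M.word"
  proof -
    have "act (rot (- pi / 4)) = M.word [Diag, Side]" "act (tr r) = M.word [Bisector, Diag, Side, Diag]"
      by (rule ext, simp only: act_rot_eq_refl[of _ r] act_tr_eq_refl M.word.simps)+
    then show "act (rot (- pi / 4)) \<in> range M.word" "act (tr r) \<in> range M.word"
      by blast+
  qed
  have conj: "act (sinv g) \<circ> act (g * k * sinv g) \<circ> act g = act k" for k
    by (simp add: mult.assoc flip: act_mult)
  have word: "act (sinv g) \<circ> f \<circ> act g \<in> range M.word"
    if "f \<in> generate Isom_plus {act (g * rot (- pi / 4) * sinv g), act (g * tr r * sinv g)}" for f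
    using that
  proof induction
    case one
    have "act (sinv g) \<circ> \<one>\<^bsub>Isom_plus\<^esub> \<circ> act g = M.word []"
      by (auto simp: fun_eq_iff)
    then show ?case by (metis rangeI)
  next
    case (incl h)
    then obtain k where "h = act (g * k * sinv g)" "act k \<in> range M.word"
      using gens by auto
    then show ?case by (simp only: conj)
  next
    case (inv h)
    then obtain k where k: "h = act (g * k * sinv g)" "act k \<in> range M.word"
      using gens by auto
    have "act (sinv g) \<circ> inv\<^bsub>Isom_plus\<^esub> h \<circ> act g = act (sinv k)"
      using conj[of "sinv k"] by (simp add: k inv_Isom_plus_act sinv_mult mult.assoc)
    moreover have "act (sinv k) \<in> range M.word"
      by (rule M.range_word_left_inverse[OF k(2)]) simp
    ultimately show ?case by (simp only:)
  next
    case (eng f h)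
    have "act (sinv g) \<circ> (f \<otimes>\<^bsub>Isom_plus\<^esub> h) \<circ> act g = (act (sinv g) \<circ> f \<circ> act g) \<circ> (act (sinv g) \<circ> h \<circ> act g)"
      by (auto simp: fun_eq_iff)
    then show ?case
      using M.range_word_comp eng.IH by metis
  qed
  obtain q where q: "q \<in> M.chamber"
    using chamber_point[OF assms(3)] by (auto simp: M.chamber_def)
  have "M.chamber = {q. height r Side q > 0} \<inter> {q. height r Diag q > 0} \<inter> {q. height r Bisector q > 0}"
    unfolding M.chamber_def by (auto simp del: height.simps) (metis mirror.exhaust)
  moreover have "open {q. height r i q > 0}" for i
    by (intro open_Collect_less continuous_on_const continuous_height)
  ultimately have "open M.chamber"
    by (simp only: open_Int)
  then show ?thesis
  proof (rule discrete_G_of_free_open_set[OF g _ q])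
    fix k assume k: "k \<in> frame_group p u r g" "act k q \<in> M.chamber"
    then have "act k \<in> range M.word"
      using word[of "act (g * k * sinv g)"] conj[of k] by (simp add: frame_group_def G_eq[OF g])
    then show "act k = id"
      using M.chamber_free q k(2) by blast
  qed
qed

section \<open>Density via SU(1,1)\<close>

text \<open>The isomorphism onto SU(1,1) induced by the Cayley transform, up to conjugation.\<close>

definition su11_pair :: "sl2 \<Rightarrow> complex \<times> complex" where
  "su11_pair g = (Complex ((ea g + ed g) / 2) ((eb g - ec g) / 2), Complex ((ea g - ed g) / 2) (- (eb g + ec g) / 2))"

lemma su11_pair_mult: "su11_pair (g * h) = pmul (su11_pair g) (su11_pair h)"
  by (simp add: su11_pair_def pmul_def complex_eq_iff field_simps)

lemma su11_pair_sinv: "su11_pair (sinv g) = pinv (su11_pair g)"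
  by (simp add: su11_pair_def pinv_def complex_eq_iff diff_divide_distrib add_divide_distrib)

lemma su11_pair_one: "su11_pair 1 = (1, 0)"
  by (simp add: su11_pair_def complex_eq_iff)

lemma su11_pair_rot: "su11_pair (rot t) = (cis t, 0)"
  by (simp add: su11_pair_def complex_eq_iff)

lemma su11_pair_in_su11: "su11_pair g \<in> su11"
  using det1[of g] unfolding su11_def mem_Collect_eq cmod_power2
  by (simp add: su11_pair_def power2_eq_square field_simps)

lemma entries_su11_pair:
  "ea g = Re (fst (su11_pair g)) + Re (snd (su11_pair g))" "eb g = Im (fst (su11_pair g)) - Im (snd (su11_pair g))"
  "ec g = - Im (fst (su11_pair g)) - Im (snd (su11_pair g))" "ed g = Re (fst (su11_pair g)) - Re (snd (su11_pair g))"
  by (simp_all add: su11_pair_def field_simps)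

lemma trace_commute: "ea (g * h) + ed (g * h) = ea (h * g) + ed (h * g)"
  by simp

lemma trace_conj: "ea (sinv k * g * k) + ed (sinv k * g * k) = ea g + ed g"
  using trace_commute[of "sinv k * g" k] by (simp add: mult.assoc[symmetric] del: entries_mult)

text \<open>\<open>x + \<i> * y\<close> is the fixed point of \<open>m\<close> in the upper
  half-plane and \<open>k\<close> takes \<open>\<i>\<close> to it. The sign of \<open>ec m\<close>
  selects \<open>- \<theta>\<close> rather than \<open>\<theta>\<close>.\<close>

lemma elliptic_conj:
  assumes "ea m + ed m = 2 * cos \<theta>" "sin \<theta> > 0" "ec m > 0"
  shows "\<exists>k. sinv k * m * k = rot (- \<theta>)"
proof -
  define y x where "y = sin \<theta> / ec m" and "x = (cos \<theta> - ed m) / ec m"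
  have y: "y > 0" using assms by (simp add: y_def)
  define k where "k = sl2_of (sqrt y) (x / sqrt y) 0 (1 / sqrt y)"
  have k: "ea k = sqrt y" "eb k = x / sqrt y" "ec k = 0" "ed k = 1 / sqrt y"
    using y by (simp_all add: k_def entries_sl2_of)
  let ?n = "sinv k * m * k"
  have "ec ?n = ec m * (sqrt y * sqrt y)"
    by (simp add: k mult_ac)
  then have c: "ec ?n = sin \<theta>"
    using assms(2,3) y by (simp add: y_def del: entries_mult)
  have "ed ?n = ec m * x + ed m"
    using y by (simp add: k field_simps)
  then have d: "ed ?n = cos \<theta>"
    using assms by (simp add: x_def)
  have a: "ea ?n = cos \<theta>"
    using trace_conj[of k m] assms(1) d by simp
  have "eb ?n * sin \<theta> = - (sin \<theta> * sin \<theta>)"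
    using det1[of ?n] sin_cos_squared_add[of \<theta>] unfolding a c d power2_eq_square by linarith
  then have "eb ?n = - sin \<theta>"
    using assms(2) by (metis less_irrefl minus_mult_left mult_right_cancel)
  then have "?n = rot (- \<theta>)"
    using a c d by (intro sl2_eqI) (simp_all del: entries_mult)
  then show ?thesis by blast
qed

text \<open>Conjugation by \<open>k\<close> moves the centre of the rotation \<open>m\<close> to
  \<open>\<i>\<close>; its inverse becomes the pair \<open>(cis \<theta>, 0)\<close>, and the half
  turn \<open>R * m\<close> becomes \<open>H\<close>.\<close>

lemma dense_of_angle:
  assumes g: "act g hi = p" "jac g hi * \<i> = u"
    and \<theta>: "0 < \<theta>" "\<theta> < pi / 4" "\<And>n::nat. n > 0 \<Longrightarrow> \<theta> \<noteq> pi / real n" "cosh (r / 2) / sqrt 2 = cos \<theta>"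
  shows "carrier Isom_plus \<subseteq> closure (G p u r)"
proof -
  note frame_group = frame_group_gens[OF g, of r] frame_group_one[OF g, of r] frame_group_mult[OF g, of _ r] frame_group_sinv[OF g, of _ r]
  define R where "R = rot (- pi / 4)"
  define m where "m = R * tr r"
  have s: "sin \<theta> > 0"
    using \<theta> by (intro sin_gt_zero) auto
  have sq: "sqrt 2 * (sqrt 2 * x) = 2 * x" for x :: real
    by (simp flip: mult.assoc)
  have tr_m: "ea m + ed m = 2 * cos \<theta>"
    unfolding \<theta>(4)[symmetric] by (simp add: m_def R_def cos_45 cosh_def field_simps sq)
  have "ec m > 0"
    by (simp add: m_def R_def sin_45)
  from elliptic_conj[OF tr_m s this] obtain k where k: "sinv k * m * k = rot (- \<theta>)"
    by blast
  have R: "R \<in> frame_group p u r g" and m: "m \<in> frame_group p u r g"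
    using frame_group by (auto simp: R_def m_def)
  define S where "S = su11_pair ` {h. k * h * sinv k \<in> frame_group p u r g}"
  have S: "su11_subgroup S"
  proof
    show "S \<subseteq> su11" by (auto simp: S_def su11_pair_in_su11)
    have "(1::sl2) \<in> {h. k * h * sinv k \<in> frame_group p u r g}"
      using frame_group by simp
    then show "(1, 0) \<in> S"
      unfolding S_def su11_pair_one[symmetric] by (rule imageI)
    show "pmul x y \<in> S" if xy: "x \<in> S" "y \<in> S" for x y
    proof -
      obtain h l where hl: "x = su11_pair h" "y = su11_pair l" "k * h * sinv k \<in> frame_group p u r g" "k * l * sinv k \<in> frame_group p u r g"
        using xy by (auto simp: S_def)
      have "(k * h * sinv k) * (k * l * sinv k) \<in> frame_group p u r g"
        using frame_group hl by blast
      then have "h * l \<in> {h. k * h * sinv k \<in> frame_group p u r g}"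
        by (simp add: mult.assoc)
      then show ?thesis
        unfolding S_def hl su11_pair_mult[symmetric] by (rule imageI)
    qed
    show "pinv x \<in> S" if x: "x \<in> S" for x
    proof -
      obtain h where h: "x = su11_pair h" "k * h * sinv k \<in> frame_group p u r g"
        using x by (auto simp: S_def)
      have "sinv (k * h * sinv k) \<in> frame_group p u r g"
        using frame_group h by blast
      then have "sinv h \<in> {h. k * h * sinv k \<in> frame_group p u r g}"
        by (simp add: mult.assoc sinv_mult)
      then show ?thesis
        unfolding S_def h su11_pair_sinv[symmetric] by (rule imageI)
    qed
  qed
  have rot_inv: "sinv (rot (- \<theta>)) = rot \<theta>"
    by (rule sl2_eqI) auto
  have rot_eq: "rot \<theta> = sinv k * sinv m * k"
    unfolding rot_inv[symmetric] k[symmetric] by (simp add: sinv_mult mult.assoc)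
  then have "k * rot \<theta> * sinv k = sinv m"
    by (simp add: mult.assoc)
  then have T: "(cis \<theta>, 0) \<in> S"
    using frame_group m unfolding S_def su11_pair_rot[symmetric] by (intro imageI) simp
  define H where "H = sinv k * (R * m) * k"
  have "k * H * sinv k = R * m"
    by (simp add: H_def mult.assoc)
  then have H: "su11_pair H \<in> S"
    using frame_group R m unfolding S_def by (intro imageI) simp
  have "ea (R * m) + ed (R * m) = 0"
    by (simp add: m_def R_def cos_45 sin_45)
  then have tr_H: "ea H + ed H = 0"
    unfolding H_def trace_conj .
  \<comment> \<open>This product is conjugate to \<open>R\<close>. Its trace, computed in both ways,
    gives the imaginary part of the first entry of \<open>su11_pair H\<close>; the real part is half
    the trace of \<open>H\<close>, namely 0.\<close>
  have "H * rot \<theta> = sinv k * R * k"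
    by (simp add: H_def rot_eq mult.assoc)
  then have "ea (H * rot \<theta>) + ed (H * rot \<theta>) = ea R + ed R"
    by (simp only: trace_conj)
  also have "\<dots> = sqrt 2"
    by (simp add: R_def cos_45)
  also have "ea (H * rot \<theta>) + ed (H * rot \<theta>) = (ea H + ed H) * cos \<theta> - (eb H - ec H) * sin \<theta>"
    by (simp add: algebra_simps)
  finally have im: "(eb H - ec H) * sin \<theta> = - sqrt 2"
    using tr_H by simp
  have "2 * (sin \<theta>)\<^sup>2 * (cmod (fst (su11_pair H)))\<^sup>2 = ((eb H - ec H) * sin \<theta>)\<^sup>2 / 2"
    by (simp add: su11_pair_def tr_H cmod_power2 power_mult_distrib power_divide)
  also have "\<dots> = 1"
    unfolding im by simp
  finally have closure: "closure S = su11"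
    using su11_subgroup.dense_of_rotation_and_half_turn[OF S T H _ \<theta>(1-3)] by blast
  show ?thesis
  proof
    fix f assume "f \<in> carrier Isom_plus"
    then obtain h where h: "f = act h"
      by (auto simp: Isom_plus_eq)
    \<comment> \<open>\<open>h\<close> in the coordinates of \<open>S\<close>; the approximation of
      its pair is carried back entry by entry.\<close>
    define l where "l = sinv k * sinv g * h * g * k"
    have "su11_pair l \<in> closure S"
      using su11_pair_in_su11 closure by blast
    then obtain x where x: "\<And>n. x n \<in> S" "x \<longlonglongrightarrow> su11_pair l"
      unfolding closure_sequential by blast
    have "\<forall>n. \<exists>h. x n = su11_pair h \<and> k * h * sinv k \<in> frame_group p u r g"
      using x(1) by (auto simp: S_def)
    then obtain w where w: "\<And>n. x n = su11_pair (w n)" "\<And>n. k * w n * sinv k \<in> frame_group p u r g"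
      by metis
    have lim: "(\<lambda>n. su11_pair (w n)) \<longlonglongrightarrow> su11_pair l"
      using x(2) unfolding w(1)[symmetric] .
    have "(\<lambda>n. ea (w n)) \<longlonglongrightarrow> ea l" "(\<lambda>n. eb (w n)) \<longlonglongrightarrow> eb l" "(\<lambda>n. ec (w n)) \<longlonglongrightarrow> ec l" "(\<lambda>n. ed (w n)) \<longlonglongrightarrow> ed l"
      unfolding entries_su11_pair by (intro tendsto_intros lim)+
    then have lim': "(\<lambda>n. act (g * (k * w n * sinv k) * sinv g)) \<longlonglongrightarrow> act (g * (k * l * sinv k) * sinv g)"
      unfolding entries_mult by (intro tendsto_act) (simp_all only: entries_mult, (intro tendsto_intros; assumption)+)
    have mem: "act (g * (k * w n * sinv k) * sinv g) \<in> closure (G p u r)" for n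
      using w(2)[of n] closure_subset[of "G p u r"] unfolding frame_group_def by blast
    have "act (g * (k * l * sinv k) * sinv g) \<in> closure (G p u r)"
      by (rule closed_sequentially[OF closed_closure mem lim'])
    moreover have "g * (k * l * sinv k) * sinv g = h"
      by (simp add: l_def mult.assoc)
    ultimately show "f \<in> closure (G p u r)"
      using h by simp
  qed
qed

section \<open>From angles to the lengths \<open>r_seq\<close> and \<open>r_inf\<close>\<close>

lemma cosh_half: "2 * (cosh (r / 2))\<^sup>2 = cosh r + (1::real)"
  using cosh_double_cosh[of "r / 2"] by simp

text \<open>By the half-angle formulas both sides say
  \<open>cosh r = 1 + 2 * cos (2 * pi / n)\<close>; \<open>n \<ge> 5\<close> makes that cosine
  positive, so \<open>arcosh\<close> inverts \<open>cosh\<close> there.\<close>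

lemma angle_iff_r_seq:
  assumes "r > 0" "n \<ge> 5"
  shows "r = r_seq n \<longleftrightarrow> cosh (r / 2) / sqrt 2 = cos (pi / real n)"
proof -
  have "0 < pi / real n" "pi / real n \<le> pi / 5" "2 * pi / real n \<le> 2 * pi / 5"
    using assms(2) frac_le[of pi pi 5 "real n"] frac_le[of "2 * pi" "2 * pi" 5 "real n"] by simp_all
  then have pos: "cos (pi / real n) > 0" "cos (2 * pi / real n) > 0"
    using pi_gt_zero by (auto intro!: cos_gt_zero_pi)
  have "2 * (cos (pi / real n))\<^sup>2 = 1 + cos (2 * pi / real n)"
    using cos_double_cos[of "pi / real n"] by simp
  then have "cosh (r / 2) / sqrt 2 = cos (pi / real n) \<longleftrightarrow> cosh r = 1 + 2 * cos (2 * pi / real n)"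
  proof -
    have "cosh (r / 2) / sqrt 2 = cos (pi / real n) \<longleftrightarrow> (cosh (r / 2) / sqrt 2)\<^sup>2 = (cos (pi / real n))\<^sup>2"
      using pos(1) by (intro iffI) (simp, rule power2_eq_imp_eq, auto)
    also have "\<dots> \<longleftrightarrow> cosh r + 1 = 4 * (cos (pi / real n))\<^sup>2"
      using cosh_half[of r] by (auto simp: power_divide)
    finally show ?thesis
      using \<open>2 * (cos (pi / real n))\<^sup>2 = _\<close> by auto
  qed
  also have "\<dots> \<longleftrightarrow> r = r_seq n"
  proof
    assume "cosh r = 1 + 2 * cos (2 * pi / real n)"
    then show "r = r_seq n"
      using assms(1) arcosh_cosh_real[of r] by (simp add: r_seq_def)
  next
    assume "r = r_seq n"
    then show "cosh r = 1 + 2 * cos (2 * pi / real n)"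
      unfolding r_seq_def using pos(2) by (simp only:) (rule cosh_arcosh_real, simp)
  qed
  finally show ?thesis by blast
qed

lemma r_inf_le_iff:
  assumes "r > 0"
  shows "r_inf \<le> r \<longleftrightarrow> cosh (r / 2) / sqrt 2 \<ge> 1"
proof -
  have "r_inf \<le> r \<longleftrightarrow> cosh r \<ge> 3"
    using assms arcosh_cosh_real[of r] arcosh_less_iff_real[of "cosh r" 3] cosh_real_ge_1[of r]
    by (auto simp: r_inf_def not_less[symmetric])
  also have "\<dots> \<longleftrightarrow> (cosh (r / 2))\<^sup>2 \<ge> 2"
    using cosh_half[of r] by auto
  also have "\<dots> \<longleftrightarrow> cosh (r / 2) \<ge> sqrt 2"
    by (metis cosh_real_nonneg real_sqrt_le_iff real_sqrt_unique)
  finally show ?thesis by simp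
qed

lemma discrete_G:
  assumes g: "act g hi = p" "jac g hi * \<i> = u" and r: "r > 0" "r \<in> {r_seq n | n. n \<ge> 5} \<union> {r_inf..}"
  shows "discrete (G p u r)"
proof (cases "r_inf \<le> r")
  case True
  \<comment> \<open>The label \<open>n = 0\<close> encodes \<open>Diag\<close> and
    \<open>Bisector\<close> being disjoint.\<close>
  then show ?thesis
    using discrete_of_angle[OF g r(1), of 0] r_inf_le_iff[OF r(1)] by simp
next
  case False
  then obtain n where "n \<ge> 5" "r = r_seq n"
    using r by auto
  then show ?thesis
    using discrete_of_angle[OF g r(1), of n] angle_iff_r_seq[OF r(1), of n] by simp
qed

lemma dense_G:
  assumes g: "act g hi = p" "jac g hi * \<i> = u" and r: "r > 0" "r \<notin> {r_seq n | n. n \<ge> 5} \<union> {r_inf..}"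
  shows "carrier Isom_plus \<subseteq> closure (G p u r)"
proof -
  define c where "c = cosh (r / 2) / sqrt 2"
  have c1: "c < 1"
    using r r_inf_le_iff[OF r(1)] by (auto simp: c_def)
  have "cosh (r / 2) > 1"
    using r(1) cosh_real_strict_mono[of 0 "r / 2"] by simp
  then have c2: "cos (pi / 4) < c"
    by (simp add: c_def cos_45 field_simps)
  define \<theta> where "\<theta> = arccos c"
  have "-1 \<le> c"
    using c2 by (simp add: cos_45) (smt (verit) real_sqrt_ge_0_iff)
  then have cos: "cos \<theta> = c" "0 \<le> \<theta>" "\<theta> \<le> pi"
    using c1 by (auto simp: \<theta>_def arccos_lbound arccos_ubound)
  have "\<theta> \<noteq> 0"
    using cos(1) c1 by auto
  then have \<theta>: "0 < \<theta>" "\<theta> < pi / 4"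
    using cos c2 cos_mono_less_eq[of "pi / 4" \<theta>] by auto
  have "\<theta> \<noteq> pi / real n" if "n > 0" for n
  proof
    assume *: "\<theta> = pi / real n"
    then have "real n * \<theta> = pi"
      using that by simp
    \<comment> \<open>The bound \<open>\<theta> < pi / 4\<close>, from \<open>r > 0\<close>, leaves
      only \<open>n \<ge> 5\<close>, where \<open>angle_iff_r_seq\<close> applies.\<close>
    then have "4 * \<theta> < real n * \<theta>"
      using \<theta>(2) by simp
    then have "n \<ge> 5"
      using \<theta>(1) by simp
    then show False
      using angle_iff_r_seq[OF r(1), of n] cos(1) r(2) * by (auto simp: c_def)
  qed
  then show ?thesis
    using dense_of_angle[OF g \<theta>] cos(1) by (simp add: c_def)
qed

lemma strict_mono_r_seq: "strict_mono_on {5..} r_seq"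
proof (rule strict_mono_onI)
  fix m n :: nat assume mn: "m \<in> {5..}" "n \<in> {5..}" "m < n"
  have "2 * pi / real n < 2 * pi / real m" "2 * pi / real m \<le> 2 * pi / 5" "0 < 2 * pi / real n"
    using mn frac_le[of "2 * pi" "2 * pi" 5 "real m"] frac_less2[of "2 * pi" "2 * pi" "real m" "real n"] by simp_all
  then have "cos (2 * pi / real m) < cos (2 * pi / real n)" "0 < cos (2 * pi / real m)"
    using pi_gt_zero by (auto intro!: cos_monotone_0_pi cos_gt_zero_pi)
  then show "r_seq m < r_seq n"
    by (simp add: r_seq_def)
qed

lemma r_seq_tendsto: "r_seq \<longlonglongrightarrow> r_inf"
proof -
  have "(\<lambda>n. 1 + 2 * cos (2 * pi / real n)) \<longlonglongrightarrow> 1 + 2 * cos 0"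
    by (intro tendsto_intros lim_const_over_n)
  then have "(\<lambda>n. arcosh (1 + 2 * cos (2 * pi / real n))) \<longlonglongrightarrow> arcosh 3"
    by (intro tendsto_arcosh) auto
  then show ?thesis
    by (simp add: r_seq_def[abs_def] r_inf_def)
qed

section \<open>Right-angled regular polygons\<close>

text \<open>By Cayley-Hamilton the square of \<open>m\<close> is \<open>2 * c * m - 1\<close>, so
  the \<open>Suc j\<close>-th power is \<open>cheb c (Suc j) * m - cheb c j\<close>.\<close>

lemma entries_power_Suc:
  assumes "ea m + ed m = 2 * c"
  shows "ea (m ^ Suc j) = cheb c (Suc j) * ea m - cheb c j \<and> eb (m ^ Suc j) = cheb c (Suc j) * eb m \<and>
    ec (m ^ Suc j) = cheb c (Suc j) * ec m \<and> ed (m ^ Suc j) = cheb c (Suc j) * ed m - cheb c j"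
proof (induction j)
  case (Suc j)
  have c: "2 * c = ea m + ed m" using assms by simp
  have bc: "eb m * ec m = ea m * ed m - 1" "ec m * eb m = ea m * ed m - 1"
    using det1[of m] by (simp_all add: algebra_simps)
  show ?case
    unfolding power_Suc[of m "Suc j"] entries_mult cheb.simps(3) c
    using Suc bc by (simp add: algebra_simps del: power_Suc) algebra
qed simp

lemma Re_act_hi: "Re (coord (act g hi)) = (ea g * ec g + eb g * ed g) / ((ec g)\<^sup>2 + (ed g)\<^sup>2)"
  by (simp add: coord_act mob_def denom_def Re_divide power2_eq_square algebra_simps)

lemma Re_act_hi_neg_iff: "Re (coord (act g hi)) < 0 \<longleftrightarrow> ea g * ec g + eb g * ed g < 0"
  and Re_act_hi_eq_0_iff: "Re (coord (act g hi)) = 0 \<longleftrightarrow> ea g * ec g + eb g * ed g = 0"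
proof -
  have "(ec g)\<^sup>2 + (ed g)\<^sup>2 > 0"
    using det1[of g] by (auto simp: sum_power2_gt_zero_iff)
  then show "Re (coord (act g hi)) < 0 \<longleftrightarrow> ea g * ec g + eb g * ed g < 0"
    "Re (coord (act g hi)) = 0 \<longleftrightarrow> ea g * ec g + eb g * ed g = 0"
    unfolding Re_act_hi by (auto simp: divide_less_0_iff)
qed

section \<open>The step along a side, and convexity as a sign condition\<close>

text \<open>Moves the frame at a vertex, pointing along a side, to the frame at the next vertex.\<close>

definition side_step :: "real \<Rightarrow> sl2" where
  "side_step s = tr s * rot (pi / 4)"

abbreviation side_coeff :: "real \<Rightarrow> real" where
  "side_coeff s \<equiv> cosh (s / 2) / sqrt 2"

lemma act_side_step_hi [simp]: "act (side_step s) hi = up s"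
  by (simp add: side_step_def act_mult up_def)

lemma side_step_trace: "ea (side_step s) + ed (side_step s) = 2 * side_coeff s"
proof -
  have sq: "sqrt 2 * (sqrt 2 * x) = 2 * x" for x :: real
    by (simp flip: mult.assoc)
  show ?thesis
    by (simp add: side_step_def cos_45 cosh_def field_simps sq)
qed

text \<open>The numerator of the real part is minus the product of the two coefficients times
  \<open>h * (E - 1 / E)\<close>, which is positive for \<open>s > 0\<close>.\<close>

lemma Re_side_step_power:
  assumes "s > 0"
  shows "Re (coord (act (side_step s ^ Suc j) hi)) < 0 \<longleftrightarrow> cheb (side_coeff s) (Suc j) * cheb (side_coeff s) j > 0"
    "Re (coord (act (side_step s ^ Suc j) hi)) = 0 \<longleftrightarrow> cheb (side_coeff s) (Suc j) * cheb (side_coeff s) j = 0"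
proof -
  define E where "E = exp (s / 2)"
  define p q where "p = cheb (side_coeff s) (Suc j)" and "q = cheb (side_coeff s) j"
  define h where "h = sqrt 2 / 2"
  have E: "E > 1" "exp (- s / 2) = 1 / E"
    using assms by (auto simp: E_def exp_minus field_simps)
  have hh: "h * h = 1 / 2" "h > 0" by (simp_all add: h_def)
  let ?g = "side_step s ^ Suc j"
  have m: "ea (side_step s) = E * h" "eb (side_step s) = E * h" "ec (side_step s) = - (h / E)" "ed (side_step s) = h / E"
    using E by (simp_all add: side_step_def cos_45 sin_45 h_def E_def)
  have "ea ?g * ec ?g + eb ?g * ed ?g = (p * (E * h) - q) * (p * - (h / E)) + p * (E * h) * (p * (h / E) - q)"
    using entries_power_Suc[OF side_step_trace, of s j] m by (simp add: p_def q_def del: power_Suc cheb.simps)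
  also have "\<dots> = - (p * q * (h * (E - 1 / E)))"
    using E(1) by (simp add: field_simps)
  finally have eq: "ea ?g * ec ?g + eb ?g * ed ?g = - (p * q * (h * (E - 1 / E)))" .
  have "1 / E < 1"
    using E(1) by simp
  then have "h * (E - 1 / E) > 0"
    using hh(2) E(1) by (intro mult_pos_pos) linarith+
  then show "Re (coord (act ?g hi)) < 0 \<longleftrightarrow> p * q > 0" "Re (coord (act ?g hi)) = 0 \<longleftrightarrow> p * q = 0"
    unfolding Re_act_hi_neg_iff Re_act_hi_eq_0_iff eq by (auto simp: zero_less_mult_iff mult_less_0_iff)
qed

text \<open>\<open>jac h\<close> scales the determinant of the two directions by its squared
  modulus, so only the angle \<open>2 * \<phi>\<close> from the axis to \<open>z\<close> matters;
  the real part of \<open>z\<close> has the sign of \<open>- sin (2 * \<phi>)\<close>.\<close>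

lemma strictly_left_iff:
  assumes "t > 0" "z \<noteq> hi"
  shows "strictly_left_of (act h hi) (act h (up t)) (act h z) \<longleftrightarrow> Re (coord z) < 0"
proof -
  obtain \<phi> where \<phi>: "act (rot \<phi>) (up (dist hi z)) = z"
    using rotate_to_axis by blast
  define d where "d = dist hi z"
  have d: "d > 0" using assms(2) by (auto simp: d_def)
  have z: "z = act (rot \<phi> * tr d) hi"
    using \<phi> by (simp add: d_def act_mult up_def)
  have dir1: "direction (act h hi) (act h (up t)) = jac h hi * \<i>"
    using assms(1) by (intro direction_eq[of h _ t]) auto
  have dir2: "direction (act h hi) (act h z) = jac h hi * cis (2 * \<phi>) * \<i>"
    using d by (subst direction_eq[of "h * rot \<phi>" _ d]) (simp_all add: act_mult z up_def jac_mult jac_rot_hi)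
  have neq: "act h z \<noteq> act h hi"
    using assms(2) by (metis act_sinv(1))
  have "cnj (jac h hi * \<i>) * (jac h hi * cis (2 * \<phi>) * \<i>) = (jac h hi * cnj (jac h hi)) * cis (2 * \<phi>)"
    by (simp add: mult_ac)
  also have "\<dots> = of_real ((cmod (jac h hi))\<^sup>2) * cis (2 * \<phi>)"
    by (simp only: complex_norm_square)
  finally have eq: "cnj (jac h hi * \<i>) * (jac h hi * cis (2 * \<phi>) * \<i>) = of_real ((cmod (jac h hi))\<^sup>2) * cis (2 * \<phi>)" .
  have "Im (cnj (jac h hi * \<i>) * (jac h hi * cis (2 * \<phi>) * \<i>)) = (cmod (jac h hi))\<^sup>2 * sin (2 * \<phi>)"
    unfolding eq by simp
  then have 1: "strictly_left_of (act h hi) (act h (up t)) (act h z) \<longleftrightarrow> sin (2 * \<phi>) > 0"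
    unfolding strictly_left_of_def dir1 dir2 using neq by (simp only: zero_less_mult_iff) auto
  have E: "exp (d / 2) * exp (d / 2) = exp d" "exp (- d / 2) * exp (- d / 2) = exp (- d)"
    by (simp_all flip: exp_add)
  have "ea (rot \<phi> * tr d) * ec (rot \<phi> * tr d) + eb (rot \<phi> * tr d) * ed (rot \<phi> * tr d)
    = - (sin \<phi> * cos \<phi> * (exp (d / 2) * exp (d / 2) - exp (- d / 2) * exp (- d / 2)))"
    by (simp add: algebra_simps)
  also have "\<dots> = - (sin (2 * \<phi>) * ((exp d - exp (- d)) / 2))"
    unfolding E sin_double by simp
  finally have "Re (coord z) < 0 \<longleftrightarrow> sin (2 * \<phi>) * ((exp d - exp (- d)) / 2) > 0"
    unfolding z Re_act_hi_neg_iff by simp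
  moreover have "(exp d - exp (- d)) / 2 > 0"
    using d by simp
  ultimately show ?thesis
    unfolding 1 by (simp add: zero_less_mult_iff)
qed

lemma direction_back:
  assumes "s > 0"
  shows "direction (act (h * tr s) hi) (act h hi) = - (jac (h * tr s) hi * \<i>)"
proof -
  have "act (h * tr s * rot (pi / 2)) (up s) = act h hi"
    by (simp add: act_mult act_rot_up)
  then have "direction (act (h * tr s) hi) (act h hi) = jac (h * tr s * rot (pi / 2)) hi * \<i>"
    using assms by (intro direction_eq[of _ _ s]) (simp_all add: act_mult)
  then show ?thesis
    by (simp add: jac_mult jac_rot_hi)
qed

lemma inner_quotient_cis:
  assumes "w \<noteq> 0"
  shows "inner (- (w * \<i>)) (w * cis t * \<i>) / (cmod (- (w * \<i>)) * cmod (w * cis t * \<i>)) = - cos t"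
proof -
  have "inner (- (w * \<i>)) (w * cis t * \<i>) = - ((cmod w)\<^sup>2 * cos t)"
    unfolding cmod_power2 by (simp add: inner_complex_def power2_eq_square algebra_simps)
  then show ?thesis
    using assms by (simp add: norm_mult power2_eq_square)
qed

text \<open>A left turn by \<open>2 * \<phi>\<close> leaves the interior angle
  \<open>pi - 2 * \<phi>\<close>; the \<open>arccos\<close> form is valid for every
  \<open>\<phi>\<close>.\<close>

lemma hangle_turn:
  assumes "s > 0" "t > 0"
  shows "hangle (act h hi) (act (h * tr s) hi) (act (h * tr s * rot \<phi>) (up t)) = arccos (- cos (2 * \<phi>))"
proof -
  have "direction (act (h * tr s) hi) (act (h * tr s * rot \<phi>) (up t)) = jac (h * tr s) hi * cis (2 * \<phi>) * \<i>"
    using assms by (subst direction_eq[of "h * tr s * rot \<phi>" _ t]) (simp_all add: act_mult[of _ "rot \<phi>"] jac_mult[of _ "rot \<phi>"] jac_rot_hi)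
  then show ?thesis
    unfolding hangle_def direction_back[OF assms(1)] by (simp only: inner_quotient_cis jac_nonzero not_False_eq_True)
qed

lemma hangle_side_step:
  assumes "s > 0"
  shows "hangle (act h hi) (act (h * side_step s) hi) (act (h * side_step s * side_step s) hi) = pi / 2"
proof -
  have "act (h * side_step s) hi = act (h * tr s) hi" "act (h * side_step s * side_step s) hi = act (h * tr s * rot (pi / 4)) (up s)"
    by (simp_all add: act_mult side_step_def up_def)
  then show ?thesis
    using hangle_turn[OF assms assms, of h "pi / 4"] by simp
qed

text \<open>Length and right angle leave two candidates, with \<open>sin (2 * \<phi>)\<close> equal
  to 1 or -1; lying to the left of the first side selects 1.\<close>

lemma third_vertex:
  assumes "s > 0" "dist (act (h * side_step s) hi) X = s"
    "hangle (act h hi) (act (h * side_step s) hi) X = pi / 2"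
    "strictly_left_of (act h hi) (act (h * side_step s) hi) X"
  shows "X = act (h * side_step s * side_step s) hi"
proof -
  have Q: "act (h * side_step s) hi = act (h * tr s) hi"
    by (simp add: act_mult up_def)
  have "dist hi (act (sinv (h * tr s)) X) = s"
    using assms(2) dist_act[of "h * tr s" hi "act (sinv (h * tr s)) X"] by (simp add: Q)
  then obtain \<phi> where \<phi>: "act (rot \<phi>) (up s) = act (sinv (h * tr s)) X"
    using rotate_to_axis[of "act (sinv (h * tr s)) X"] by auto
  then have X: "X = act (h * tr s * rot \<phi>) (up s)"
    by (simp add: act_mult[of _ "rot \<phi>"])
  have "arccos (- cos (2 * \<phi>)) = pi / 2"
    using assms(3) hangle_turn[OF assms(1,1), of h \<phi>] by (simp add: Q X)
  then have "cos (arccos (- cos (2 * \<phi>))) = cos (pi / 2)"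
    by (simp only:)
  then have c: "cos (2 * \<phi>) = 0"
    using cos_arccos[of "- cos (2 * \<phi>)"] by simp
  define z where "z = act (tr s * rot \<phi>) (up s)"
  have Xz: "X = act h z"
    by (simp add: X z_def act_mult mult.assoc)
  have "z \<noteq> hi"
    using assms(4) by (auto simp: strictly_left_of_def Xz)
  then have "Re (coord z) < 0"
    using strictly_left_iff[OF assms(1), of z h] assms(4) by (simp add: Xz act_mult)
  \<comment> \<open>\<open>tr s\<close> multiplies coordinates by a positive real, so the sign of
    the real part is the same in the frame of the second vertex.\<close>
  then have "Re (coord (act (rot \<phi>) (up s))) < 0"
    by (simp add: z_def act_mult coord_act_tr mult_less_0_iff)
  moreover have "act (rot \<phi>) (up s) \<noteq> hi"
  proof
    assume "act (rot \<phi>) (up s) = hi"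
    then have "dist (up s) (up 0) = 0"
      using dist_act[of "rot \<phi>" "up s" hi] by simp
    then show False using assms(1) by (simp only: dist_up)
  qed
  ultimately have "strictly_left_of (act 1 hi) (act 1 (up s)) (act 1 (act (rot \<phi>) (up s)))"
    using strictly_left_iff[OF assms(1), of "act (rot \<phi>) (up s)" 1] by simp
  moreover have "direction (act 1 hi) (act 1 (up s)) = jac 1 hi * \<i>"
    using assms(1) by (intro direction_eq[of _ _ s]) auto
  moreover have "direction (act 1 hi) (act 1 (act (rot \<phi>) (up s))) = jac (rot \<phi>) hi * \<i>"
    using assms(1) by (intro direction_eq[of _ _ s]) auto
  ultimately have "sin (2 * \<phi>) > 0"
    by (simp add: strictly_left_of_def jac_rot_hi)
  moreover have "(sin (2 * \<phi>))\<^sup>2 = 1"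
    using sin_cos_squared_add[of "2 * \<phi>"] c by simp
  ultimately have "sin (2 * \<phi>) = 1"
    by (metis abs_of_pos abs_square_eq_1)
  with c have "cis (2 * \<phi>) = \<i>"
    by (simp add: complex_eq_iff)
  then have "act (rot \<phi>) = act (rot (pi / 4))"
    by (intro act_eq_of_jac_hi) (simp_all add: jac_rot_hi)
  then show ?thesis
    by (simp add: X act_mult) (simp add: side_step_def act_mult)
qed

text \<open>Convexity controls only products of consecutive values; positivity spreads from
  \<open>cheb c 1 = 1\<close>.\<close>

lemma cheb_pos_of_polygon:
  assumes "n \<ge> 1" "\<And>j. 2 \<le> j \<Longrightarrow> j < n \<Longrightarrow> cheb c j * cheb c (j - 1) > 0" "1 \<le> j" "j < n"
  shows "cheb c j > 0"
  using assms(3,4)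
proof (induction j rule: nat_induct_at_least)
  case (Suc j)
  then show ?case
    using assms(2)[of "Suc j"] by (simp add: zero_less_mult_iff del: cheb.simps)
qed simp

text \<open>A zero forces \<open>c < 1\<close>, so \<open>c = cos \<psi>\<close>. Positive sines
  keep \<open>j * \<psi>\<close> below \<open>pi\<close> for \<open>j < n\<close>, since a step
  \<open>\<psi> < pi\<close> cannot jump over the interval of negative sines. Hence the zero
  \<open>n * \<psi>\<close> is \<open>pi\<close>.\<close>

lemma side_coeff_of_cheb:
  assumes "n \<ge> 3" "s > 0" "\<And>j. 1 \<le> j \<Longrightarrow> j < n \<Longrightarrow> cheb (side_coeff s) j > 0" "cheb (side_coeff s) n = 0"
  shows "side_coeff s = cos (pi / real n)"
proof -
  define c where "c = side_coeff s"
  have "c < 1"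
    using assms cheb_pos_of_ge_1[of c n] by (force simp: c_def)
  moreover have "c > 0"
    by (simp add: c_def)
  ultimately have \<psi>: "cos (arccos c) = c" "0 < arccos c" "arccos c < pi"
    using arccos_lt_bounded[of c] by auto
  define \<psi> where "\<psi> = arccos c"
  note \<psi> = \<psi>[folded \<psi>_def]
  have s: "sin \<psi> > 0"
    using \<psi> by (intro sin_gt_zero)
  have ch: "cheb c k * sin \<psi> = sin (real k * \<psi>)" for k
    using cheb_cos[of \<psi> k] \<psi>(1) by simp
  have lt: "real j * \<psi> < pi" if "1 \<le> j" "j < n" for j
    using that
  proof (induction j rule: nat_induct_at_least)
    case base
    then show ?case using \<psi> by simp
  next
    case (Suc j)
    have "sin (real (Suc j) * \<psi>) > 0"
      using ch[of "Suc j"] assms(3)[of "Suc j"] Suc.prems s by (metis c_def le_add1 mult_pos_pos plus_1_eq_Suc)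
    moreover have "real (Suc j) * \<psi> < 2 * pi"
      using Suc \<psi> by (simp add: algebra_simps)
    moreover have "\<not> (pi < real (Suc j) * \<psi>)"
      using calculation sin_lt_zero[of "real (Suc j) * \<psi>"] by linarith
    ultimately show ?case
      by (cases "real (Suc j) * \<psi> = pi") auto
  qed
  have "sin (real n * \<psi>) = 0"
    using ch[of n] assms(4) by (simp add: c_def)
  moreover have "real n * \<psi> < 2 * pi"
  proof -
    have "1 \<le> n - 1" "n - 1 < n"
      using assms(1) by auto
    from lt[OF this] show ?thesis
      using assms(1) \<psi> by (simp add: of_nat_diff algebra_simps)
  qed
  moreover have "real n * \<psi> > 0"
    using assms(1) \<psi> by simp
  ultimately have "real n * \<psi> = pi"
    using sin_gt_zero[of "real n * \<psi>"] sin_lt_zero[of "real n * \<psi>"] by linarith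
  then have "\<psi> = pi / real n"
    using assms(1) by (simp add: field_simps)
  then show ?thesis
    using \<psi>(1) by (simp add: c_def)
qed

section \<open>Uniqueness and existence of right-angled regular polygons\<close>

lemma regular_polygon_vertices:
  assumes "regular_polygon n s (pi / 2) P"
  obtains g where "\<And>j. j < n \<Longrightarrow> P j = act (g * side_step s ^ j) hi" "s > 0" "side_coeff s = cos (pi / real n)"
proof -
  have n: "n \<ge> 3" and inj: "inj_on P {..<n}"
    and left: "\<And>i j. i < n \<Longrightarrow> j < n \<Longrightarrow> j \<noteq> i \<Longrightarrow> j \<noteq> Suc i mod n \<Longrightarrow> strictly_left_of (P i) (P (Suc i mod n)) (P j)"
    and side: "\<And>i. i < n \<Longrightarrow> dist (P i) (P (Suc i mod n)) = s"
    and angle: "\<And>i. i < n \<Longrightarrow> hangle (P ((i + n - 1) mod n)) (P i) (P (Suc i mod n)) = pi / 2"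
    using assms by (auto simp: regular_polygon_def convex_polygon_def)
  have "P 0 \<noteq> P 1"
    using inj_onD[OF inj, of 0 1] n by auto
  then have s: "s > 0"
    using side[of 0] n by auto
  obtain g where g: "act g hi = P 0" "act g (up s) = P 1"
    using frame_pair_exists[of "P 0" "P 1"] side[of 0] n by auto
  \<comment> \<open>Including \<open>j = n\<close> makes closing up part of the claim: the
    \<open>n\<close>-th power of the step fixes \<open>hi\<close>.\<close>
  have P: "P (j mod n) = act (g * side_step s ^ j) hi" if "j \<le> n" for j
    using that
  proof (induction j rule: less_induct)
    case (less j)
    consider "j = 0" | "j = 1" | i where "j = Suc (Suc i)"
      by (metis One_nat_def not0_implies_Suc)
    then show ?case
    proof cases
      case 3
      define h where "h = g * side_step s ^ i"
      have i: "P i = act h hi" "P (Suc i) = act (h * side_step s) hi"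
        using less.IH[of i] less.IH[of "Suc i"] less.prems 3 by (simp_all add: h_def mult.assoc power_commutes)
      have j: "j mod n = Suc (Suc i) mod n" "Suc i < n" "i < n"
        using 3 less.prems by auto
      have ne: "j mod n \<noteq> i" "j mod n \<noteq> Suc i"
        using 3 less.prems n by (cases "j = n"; simp)+
      have "P (j mod n) = act (h * side_step s * side_step s) hi"
      proof (rule third_vertex[OF s])
        show "dist (act (h * side_step s) hi) (P (j mod n)) = s"
          using side[OF j(2)] by (simp add: j(1) flip: i)
        show "hangle (act h hi) (act (h * side_step s) hi) (P (j mod n)) = pi / 2"
          using angle[OF j(2)] j(3) by (simp add: j(1) flip: i)
        show "strictly_left_of (act h hi) (act (h * side_step s) hi) (P (j mod n))"
          using left[OF j(3), of "j mod n"] ne n j(2) by (simp flip: i)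
      qed
      then show ?thesis
        by (simp add: h_def 3 mult.assoc power_commutes)
    qed (use g n in \<open>auto simp: act_mult\<close>)
  qed
  \<comment> \<open>Convexity with respect to the first side, which lies on the imaginary axis in
    the frame \<open>g\<close>.\<close>
  have left': "cheb (side_coeff s) j * cheb (side_coeff s) (j - 1) > 0" if "2 \<le> j" "j < n" for j
  proof -
    obtain i where i: "j = Suc i" using \<open>2 \<le> j\<close> by (cases j) auto
    have "strictly_left_of (act g hi) (act g (up s)) (act g (act (side_step s ^ j) hi))"
      using left[of 0 j] P[of j] that n g by (simp add: act_mult)
    moreover from this have "act (side_step s ^ j) hi \<noteq> hi"
      by (auto simp: strictly_left_of_def)
    ultimately have "Re (coord (act (side_step s ^ j) hi)) < 0"
      using strictly_left_iff[OF s] by blast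
    then show ?thesis
      using Re_side_step_power(1)[OF s, of i] by (simp add: i)
  qed
  have pos: "cheb (side_coeff s) j > 0" if "1 \<le> j" "j < n" for j
    using cheb_pos_of_polygon[of n "side_coeff s" j] left' that n by auto
  have "act g (act (side_step s ^ n) hi) = act g hi"
    using P[of n] g by (simp add: act_mult)
  then have "act (side_step s ^ n) hi = hi"
    by (metis act_sinv(1))
  then have "cheb (side_coeff s) n * cheb (side_coeff s) (n - 1) = 0"
    using Re_side_step_power(2)[OF s, of "n - 1"] n by simp
  moreover have "cheb (side_coeff s) (n - 1) > 0"
    by (rule pos) (use n in auto)
  ultimately have "cheb (side_coeff s) n = 0"
    by simp
  with pos have "side_coeff s = cos (pi / real n)"
    using side_coeff_of_cheb[OF n s] by blast
  moreover have "P j = act (g * side_step s ^ j) hi" if "j < n" for j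
    using P[of j] that by simp
  ultimately show thesis
    using that[of g] s by blast
qed

text \<open>The angle \<open>pi / n\<close> determines the side length, so the two vertex sequences
  differ only by their initial frames.\<close>

lemma regular_polygons_isometric:
  assumes "regular_polygon n s (pi / 2) P" "regular_polygon n t (pi / 2) Q"
  shows "\<exists>f. hisometry f \<and> (\<forall>i<n. f (P i) = Q i)"
proof -
  obtain g where g: "\<And>j. j < n \<Longrightarrow> P j = act (g * side_step s ^ j) hi" "s > 0" "side_coeff s = cos (pi / real n)"
    by (rule regular_polygon_vertices[OF assms(1)]) blast
  obtain h where h: "\<And>j. j < n \<Longrightarrow> Q j = act (h * side_step t ^ j) hi" "t > 0" "side_coeff t = cos (pi / real n)"
    by (rule regular_polygon_vertices[OF assms(2)]) blast
  have "side_coeff s = side_coeff t"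
    by (rule trans[OF g(3) h(3)[symmetric]])
  then have "s = t"
    using g(2) h(2) by simp
  then have "act (h * sinv g) (P i) = Q i" if "i < n" for i
    using g(1)[OF that] h(1)[OF that] by (simp add: act_act mult.assoc)
  then show ?thesis
    using hisometry_act by blast
qed

lemma regular_polygon_exists:
  assumes n: "n \<ge> 5" and s: "s > 0" "side_coeff s = cos (pi / real n)"
  shows "\<exists>P. regular_polygon n s (pi / 2) P"
proof -
  define P where "P j = act (side_step s ^ j) hi" for j
  have p_n: "cheb (side_coeff s) n = 0" "cheb (side_coeff s) (n - 1) = 1"
    using cheb_at_order[of n] n s by simp_all
  have pos: "cheb (side_coeff s) k > 0" if "0 < k" "k < n" for k
    using cheb_pos_of_cos[of n k] n s that by simp
  \<comment> \<open>The matrix is minus the identity, which acts trivially; thus \<open>P\<close> is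
    defined for all indices with period \<open>n\<close>.\<close>
  have "ea (side_step s ^ n) = - 1 \<and> eb (side_step s ^ n) = 0 \<and> ec (side_step s ^ n) = 0 \<and> ed (side_step s ^ n) = - 1"
    using entries_power_Suc[OF side_step_trace, of s "n - 1"] p_n n by simp
  then have period: "act (side_step s ^ n) = id"
    by (auto intro!: hplane_eqI simp: coord_act mob_def denom_def fun_eq_iff)
  have P_add: "P (i + j) = act (side_step s ^ i) (P j)" for i j
    by (simp add: P_def power_add act_mult)
  have P_period: "P (i + n) = P i" for i
    by (simp add: P_def power_add act_mult period)
  have P_mult: "P (i + k * n) = P i" for i k
  proof (induction k)
    case (Suc k)
    then show ?case
      using P_period[of "i + k * n"] by (simp add: algebra_simps)
  qed simp
  have P_mod: "P (i mod n) = P i" for i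
    using P_mult[of "i mod n" "i div n"] by simp
  have P_Suc: "P (Suc i) = act (side_step s ^ i) (up s)" for i
    using P_add[of i 1] by (simp add: P_def)
  have P_neq: "P k \<noteq> hi" if k: "0 < k" "k < n" for k
  proof (cases "k = 1")
    case True
    then show ?thesis
      using dist_up[of s 0] s(1) by (auto simp: P_def)
  next
    case False
    with k obtain i where i: "k = Suc i" "0 < i"
      by (cases k) auto
    then have "Re (coord (P k)) \<noteq> 0"
      using Re_side_step_power(2)[OF s(1), of i] pos[of k] pos[of i] k by (auto simp: P_def)
    then show ?thesis by auto
  qed
  have "regular_polygon n s (pi / 2) P"
    unfolding regular_polygon_def convex_polygon_def
  proof (intro conjI allI impI)
    show "3 \<le> n" using n by simp
    have "P i \<noteq> P j" if "i < j" "j < n" for i j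
    proof
      assume "P i = P j"
      moreover have "P i = act (side_step s ^ i) hi" "P j = act (side_step s ^ i) (P (j - i))"
        using P_add[of i "j - i"] that by (simp_all add: P_def)
      ultimately have "P (j - i) = hi"
        by (metis act_sinv(1))
      then show False
        using P_neq[of "j - i"] that by simp
    qed
    then show "inj_on P {..<n}"
      by (metis inj_onI lessThan_iff linorder_neqE_nat)
    show "dist (P i) (P (Suc i mod n)) = s" for i
      unfolding P_mod P_Suc using dist_up[of 0 s] s(1) by (simp add: P_def)
    show "hangle (P ((i + n - 1) mod n)) (P i) (P (Suc i mod n)) = pi / 2" if "i < n" for i
    proof -
      define j where "j = i + n - 1"
      have j: "Suc j = i + n" "Suc (Suc j) = Suc i + n"
        using n by (auto simp: j_def)
      have "P i = P (Suc j)" "P (Suc i) = P (Suc (Suc j))"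
        using P_period[of i] P_period[of "Suc i"] unfolding j by simp_all
      then show ?thesis
        unfolding P_mod j_def[symmetric]
        using hangle_side_step[OF s(1), of "side_step s ^ j"] by (simp add: P_def mult.assoc power_commutes)
    qed
    fix i j assume ij: "i < n" "j < n" "j \<noteq> i \<and> j \<noteq> Suc i mod n"
    \<comment> \<open>The index \<open>j - i\<close> modulo \<open>n\<close>: rotating side
      \<open>i\<close> to side 0 reduces convexity to the first side, with
      \<open>2 \<le> k < n\<close>.\<close>
    define k where "k = (if i < j then j - i else j + n - i)"
    have k: "k > 0" "k < n" "k \<noteq> 1"
      using ij by (auto simp: k_def mod_Suc split: if_splits)
    have "P j = act (side_step s ^ i) (P k)"
      using P_add[of i k] P_period[of j] ij by (auto simp: k_def)
    moreover have "strictly_left_of (act (side_step s ^ i) hi) (act (side_step s ^ i) (up s)) (act (side_step s ^ i) (P k))"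
    proof (subst strictly_left_iff[OF s(1) P_neq[OF k(1,2)]])
      have "cheb (side_coeff s) k * cheb (side_coeff s) (k - 1) > 0"
        using pos[of k] pos[of "k - 1"] k by simp
      then show "Re (coord (P k)) < 0"
        using Re_side_step_power(1)[OF s(1), of "k - 1"] k by (simp add: P_def)
    qed
    ultimately show "strictly_left_of (P i) (P (Suc i mod n)) (P j)"
      unfolding P_mod P_Suc by (simp add: P_def)
  qed
  then show ?thesis by blast
qed

theorem theorem1:
  fixes x\<^sub>0 :: hplane and v :: complex
  assumes "unit_tangent x\<^sub>0 v"
  shows
    "(\<forall>n\<ge>5. (\<exists>P. regular_polygon n (r_seq n) (pi / 2) P) \<and>
             (\<forall>s P t Q. regular_polygon n s (pi / 2) P \<and> regular_polygon n t (pi / 2) Q \<longrightarrow>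
                (\<exists>f. hisometry f \<and> (\<forall>i<n. f (P i) = Q i)))) \<and>
     strict_mono_on {5..} r_seq \<and>
     r_seq \<longlonglongrightarrow> r_inf \<and>
     (\<forall>r>0. discrete (G x\<^sub>0 v r) \<longleftrightarrow> r \<in> {r_seq n | n. n \<ge> 5} \<union> {r_inf..}) \<and>
     (\<forall>r>0. r \<notin> {r_seq n | n. n \<ge> 5} \<union> {r_inf..} \<longrightarrow> carrier Isom_plus \<subseteq> closure (G x\<^sub>0 v r))"
proof -
  obtain g where g: "act g hi = x\<^sub>0" "jac g hi * \<i> = v"
    using frame_exists[OF assms] by blast
  have "\<exists>P. regular_polygon n (r_seq n) (pi / 2) P" if n: "n \<ge> 5" for n
  proof -
    have "2 * pi / real n \<le> 2 * pi / 5" "0 < 2 * pi / real n"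
      using n frac_le[of "2 * pi" "2 * pi" 5 "real n"] by simp_all
    then have "cos (2 * pi / real n) > 0"
      using pi_gt_zero by (intro cos_gt_zero_pi) linarith+
    then have "r_seq n > 0"
      by (simp add: r_seq_def)
    then show ?thesis
      using regular_polygon_exists[OF n] angle_iff_r_seq[OF _ n] by blast
  qed
  then show ?thesis
  proof (intro conjI allI impI iffI)
    show "\<exists>f. hisometry f \<and> (\<forall>i<n. f (P i) = Q i)"
      if "regular_polygon n s (pi / 2) P \<and> regular_polygon n t (pi / 2) Q" for n s P t Q
      using that regular_polygons_isometric by blast
    \<comment> \<open>For any other \<open>r\<close> the group is dense, hence not discrete.\<close>
    show "r \<in> {r_seq n | n. n \<ge> 5} \<union> {r_inf..}" if "r > 0" "discrete (G x\<^sub>0 v r)" for r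
      using not_discrete_of_dense[OF g] dense_G[OF g] that by blast
  qed (use strict_mono_r_seq r_seq_tendsto discrete_G[OF g] dense_G[OF g] in blast)+
qed

end
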